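(* Let $K$ be a field, let $t\ge 1$ and $n\ge t$ be integers, and let $I$ be a nonzero $t$-spread ideal of $S=K[x_1,\dots,x_n]$. Then $$\operatorname{reg}(I)\le n-(t-1).$$
   Context: $S$ is standard graded. A monomial $x_{i_1}x_{i_2}\cdots x_{i_d}$ of $S$ with $1\le i_1\le i_2\le\cdots\le i_d\le n$ is $t$-spread if $i_{j+1}-i_j\ge t$ for all $j=1,\dots,d-1$. A $t$-spread ideal is a monomial ideal generated by $t$-spread monomials. For a nonzero graded ideal $I$ with graded Betti numbers $\beta_{i,j}(I)$ (so the $i$-th module, $i\ge 0$, of the minimal graded free $S$-resolution of $I$ is $\bigoplus_jS(-j)^{\beta_{i,j}(I)}$), the Castelnuovo–Mumford regularity is $\operatorname{reg}(I)=\max\{j-i:\beta_{i,j}(I)\ne 0\}$. *)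

theory Defs
  imports
    "HOL-Library.Poly_Mapping"
    "HOL-Algebra.Ideal"
    "Jordan_Normal_Form.Matrix"
begin

text \<open>A polynomial is a finitely supported map from exponent vectors to coefficients, and an
  exponent vector is a finitely supported map from variable indices to exponents.\<close>

type_synonym 'k mpoly = "(nat \<Rightarrow>\<^sub>0 nat) \<Rightarrow>\<^sub>0 'k"

text \<open>The ring $K[x_1,\dots,x_n]$, as the polynomials in which only variables with an index
  in $\{1,\dots,n\}$ occur.\<close>

definition poly_ring :: "nat \<Rightarrow> ('k::field) mpoly ring" where
  "poly_ring n =
    \<lparr>carrier = {p. \<forall>m\<in>Poly_Mapping.keys p. Poly_Mapping.keys m \<subseteq> {1..n}},
     monoid.mult = (*), one = 1, zero = 0, add = (+)\<rparr>"

definition var :: "nat \<Rightarrow> ('k::field) mpoly" where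
  "var i = Poly_Mapping.single (Poly_Mapping.single i 1) 1"

definition mon_degree :: "(nat \<Rightarrow>\<^sub>0 nat) \<Rightarrow> nat" where
  "mon_degree m = (\<Sum>i\<in>Poly_Mapping.keys m. Poly_Mapping.lookup m i)"

text \<open>The zero polynomial is homogeneous of every degree; it is the only polynomial that is
  homogeneous of a negative degree.\<close>

definition homogeneous_of_degree :: "int \<Rightarrow> ('k::field) mpoly \<Rightarrow> bool" where
  "homogeneous_of_degree d p \<longleftrightarrow> (\<forall>m\<in>Poly_Mapping.keys p. int (mon_degree m) = d)"

text \<open>The list \<open>is\<close> is the index sequence $i_1\le\dots\le i_d$. The empty list is allowed, so
  the monomial $1$ is $t$-spread.\<close>

definition t_spread_monomial :: "nat \<Rightarrow> nat \<Rightarrow> ('k::field) mpoly \<Rightarrow> bool" where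
  "t_spread_monomial n t u \<longleftrightarrow>
    (\<exists>is. set is \<subseteq> {1..n} \<and> sorted is \<and>
      (\<forall>j. Suc j < length is \<longrightarrow> int (is ! Suc j) - int (is ! j) \<ge> int t) \<and>
      u = prod_list (map var is))"

definition t_spread_ideal :: "nat \<Rightarrow> nat \<Rightarrow> ('k::field) mpoly set \<Rightarrow> bool" where
  "t_spread_ideal n t I \<longleftrightarrow>
    (\<exists>G. (\<forall>u\<in>G. t_spread_monomial n t u) \<and> I = Idl\<^bsub>poly_ring n\<^esub> G)"

definition free_module :: "nat \<Rightarrow> nat \<Rightarrow> ('k::field) mpoly vec set" where
  "free_module n r = {v \<in> carrier_vec r. \<forall>k<r. v $ k \<in> carrier (poly_ring n)}"

text \<open>Data of an augmented complex of finitely generated graded free modules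
  $\cdots\to F_1\to F_0\to I$ with $F_i=\bigoplus_{k<\mathit{rank}\,i} S(-\mathit{shift}\,i\,k)$.
  The matrix \<open>diff i\<close> represents the map $F_{i+1}\to F_i$ acting on column vectors, and
  the entries of \<open>aug\<close> are the images in $I$ of the basis elements of $F_0$.\<close>

record 'r graded_free_complex =
  rank :: "nat \<Rightarrow> nat"
  shift :: "nat \<Rightarrow> nat \<Rightarrow> int"
  aug :: "'r vec"
  diff :: "nat \<Rightarrow> 'r mat"

text \<open>The basis element \<open>k\<close> of $F_i$ has degree \<open>shift i k\<close>; the homogeneity conditions say that
  all maps are graded of degree $0$.\<close>

definition graded_free_resolution ::
    "nat \<Rightarrow> ('k::field) mpoly set \<Rightarrow> 'k mpoly graded_free_complex \<Rightarrow> bool" where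
  "graded_free_resolution n I F \<longleftrightarrow>
    aug F \<in> free_module n (rank F 0) \<and>
    (\<forall>k<rank F 0. homogeneous_of_degree (shift F 0 k) (aug F $ k)) \<and>
    (\<forall>i. diff F i \<in> carrier_mat (rank F i) (rank F (Suc i))) \<and>
    (\<forall>i. \<forall>l<rank F i. \<forall>k<rank F (Suc i).
      diff F i $$ (l, k) \<in> carrier (poly_ring n) \<and>
      homogeneous_of_degree (shift F (Suc i) k - shift F i l) (diff F i $$ (l, k))) \<and>
    (\<lambda>v. aug F \<bullet> v) ` free_module n (rank F 0) = I \<and>
    {v \<in> free_module n (rank F 0). aug F \<bullet> v = 0} =
      (\<lambda>w. diff F 0 *\<^sub>v w) ` free_module n (rank F 1) \<and>
    (\<forall>i. {v \<in> free_module n (rank F (Suc i)). diff F i *\<^sub>v v = 0\<^sub>v (rank F i)} =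
      (\<lambda>w. diff F (Suc i) *\<^sub>v w) ` free_module n (rank F (Suc (Suc i))))"

text \<open>Minimality: $F_{i+1}\to F_i$ has image in $(x_1,\dots,x_n)F_i$, that is, the entries of its
  matrix have no constant term. There is no such condition on the augmentation.\<close>

definition minimal_graded_free_resolution ::
    "nat \<Rightarrow> ('k::field) mpoly set \<Rightarrow> 'k mpoly graded_free_complex \<Rightarrow> bool" where
  "minimal_graded_free_resolution n I F \<longleftrightarrow>
    graded_free_resolution n I F \<and>
    (\<forall>i. \<forall>l<rank F i. \<forall>k<rank F (Suc i). Poly_Mapping.lookup (diff F i $$ (l, k)) 0 = 0)"

text \<open>The number of summands $S(-j)$ in the $i$-th module of the minimal graded free resolution.
  The resolution is unique up to isomorphism, so the choice does not matter.\<close>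

definition graded_betti :: "nat \<Rightarrow> ('k::field) mpoly set \<Rightarrow> nat \<Rightarrow> int \<Rightarrow> nat" where
  "graded_betti n I i j =
    (let F = (SOME F. minimal_graded_free_resolution n I F)
     in card {k. k < rank F i \<and> shift F i k = j})"

definition regularity :: "nat \<Rightarrow> ('k::field) mpoly set \<Rightarrow> int" where
  "regularity n I = Max {j - int i | i j. graded_betti n I i j \<noteq> 0}"

end

theory Submission
  imports Defs "HOL-Library.Function_Algebras"
begin

text \<open>The spread condition enters through a single consequence: among the $t$ consecutive variables
  $x_1,\dots,x_t$, a $t$-spread monomial contains at most one. So $I$ is generated by squarefree
  monomials in $n$ variables, each of which contains at most one variable from a set $A$ of $t$
  variables. For every nonempty set $A$ such an ideal has regularity at most $n-|A|+1$
  (\<open>reg_le_transversal\<close>). The proof is by induction on $A$. If $A$ has one element, the bound is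
  $n$, and indeed the regularity of a squarefree monomial ideal is at most the number of variables
  that occur in its generators (\<open>reg_le_squarefree\<close>). Otherwise choose $v\in A$ and write $I=J+x_vH$,
  where the generators of $J$ avoid $x_v$. The generators of $H$ contain no variable of $A$ at all,
  so $\operatorname{reg}H\le n-|A|$, and multiplication by $x_v$ adds one. The intersection is
  $J\cap x_vH=x_v(J\cap H)$, and the generators of $J\cap H$ again contain at most one variable from
  $A\setminus\{v\}$. A Mayer--Vietoris argument (\<open>reg_le_sum\<close>) combines the three bounds.

  Regularity is measured in this induction by Koszul homology: \<open>reg_le n M c\<close> says that every cycle
  of the Koszul complex $K(x_1,\dots,x_n;M)$ whose coefficients have degree greater than $c$ is a
  boundary. Mayer--Vietoris and multiplication by a variable are then diagram chases with explicit
  chains, and no resolution has to be constructed for the intermediate ideals.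

  The bound passes to resolutions as follows. Let $F\to M$ be a surjection from a free module with
  kernel $Z\subseteq(x_1,\dots,x_n)F$. The Koszul complex of $F$ is exact in positive exterior
  degree, so the connecting homomorphism turns the bound $c$ for $M$ into the bound $c+1$ for $Z$
  (\<open>reg_le_graded_kernel\<close>). Moreover, a basis element of $F$ has degree at most $c$, since otherwise its
  image would be a $0$-boundary and the basis element would lie in $(x_1,\dots,x_n)F$
  (\<open>minimal_cover_shift_le\<close>). By induction, the shifts in step $i$ of any minimal resolution of $M$
  are at most $c+i$.

  The regularity is the maximum of a set that is read off from a chosen minimal resolution, so such a
  resolution has to exist and the set has to be finite and nonempty. Existence also comes from the
  Koszul bound: it shows that $M$ is generated in degrees at most $c$, hence by finitely many
  elements because the graded pieces are finite-dimensional (\<open>finitely_generated\<close>); a smallest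
  homogeneous generating set gives a minimal cover, and its kernel satisfies the next bound.
  Finiteness holds because the shifts grow strictly along a minimal resolution
  (\<open>minimal_tower_shift_ge\<close>), so that $j-i\ge0$ whenever $\beta_{i,j}\ne0$.

  Elements of a free module are represented by functions from indices to polynomials that vanish
  from the rank on, with pointwise addition; an ideal is a submodule of the free module of rank one.\<close>

section \<open>Polynomials and their graded pieces\<close>

lemma sum_fun_apply: "(\<Sum>a\<in>A. f a) x = (\<Sum>a\<in>A. f a x)"
  by (induction A rule: infinite_finite_induct) auto

abbreviation Polys :: "nat \<Rightarrow> ('k::field) mpoly set" where
  "Polys n \<equiv> carrier (poly_ring n)"

lemma Polys_iff: "p \<in> Polys n \<longleftrightarrow> (\<forall>m\<in>Poly_Mapping.keys p. Poly_Mapping.keys m \<subseteq> {1..n})"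
  by (simp add: poly_ring_def)

lemma keys_exponent_add: "Poly_Mapping.keys (a + b) = Poly_Mapping.keys a \<union> Poly_Mapping.keys (b :: nat \<Rightarrow>\<^sub>0 nat)"
  by (auto simp: in_keys_iff lookup_add)

lemma keys_eq_0: "Poly_Mapping.keys p = {} \<longleftrightarrow> p = (0 :: 'a \<Rightarrow>\<^sub>0 'b::zero)"
  by (metis equals0D keys_zero poly_mapping_eqI in_keys_iff lookup_zero)

lemma Polys_zero [simp]: "0 \<in> Polys n" by (simp add: Polys_iff)
lemma Polys_one [simp]: "1 \<in> Polys n" by (simp add: Polys_iff)
lemma Polys_add: "p \<in> Polys n \<Longrightarrow> q \<in> Polys n \<Longrightarrow> p + q \<in> Polys n"
  using keys_add[of p q] unfolding Polys_iff by blast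
lemma keys_uminus: "Poly_Mapping.keys (- p) = Poly_Mapping.keys (p :: 'a \<Rightarrow>\<^sub>0 'b::ab_group_add)"
  by (auto simp: in_keys_iff)
lemma Polys_uminus: "p \<in> Polys n \<Longrightarrow> - p \<in> Polys n"
  by (simp add: Polys_iff keys_uminus)
lemma keys_mult_E:
  assumes "m \<in> Poly_Mapping.keys (p * q)"
  obtains a b where "m = a + b" "a \<in> Poly_Mapping.keys p" "b \<in> Poly_Mapping.keys q"
  using assms keys_mult[of p q] by blast
lemma Polys_mult: "p \<in> Polys n \<Longrightarrow> q \<in> Polys n \<Longrightarrow> p * q \<in> Polys n"
  unfolding Polys_iff using keys_mult_E[of _ p q] by (metis Un_least keys_exponent_add)
lemma Polys_sum: "(\<And>a. a \<in> A \<Longrightarrow> f a \<in> Polys n) \<Longrightarrow> sum f A \<in> Polys n"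
  by (induction A rule: infinite_finite_induct) (auto intro: Polys_add)
lemma mon_degree_superset:
  assumes "finite A" "Poly_Mapping.keys m \<subseteq> A"
  shows "mon_degree m = (\<Sum>i\<in>A. Poly_Mapping.lookup m i)"
  unfolding mon_degree_def using assms by (intro sum.mono_neutral_left) (auto simp: in_keys_iff)

lemma mon_degree_add: "mon_degree (a + b) = mon_degree a + mon_degree b"
  using mon_degree_superset[of "Poly_Mapping.keys a \<union> Poly_Mapping.keys b" a]
    mon_degree_superset[of "Poly_Mapping.keys a \<union> Poly_Mapping.keys b" b]
    mon_degree_superset[of "Poly_Mapping.keys a \<union> Poly_Mapping.keys b" "a + b"]
  by (simp add: keys_exponent_add lookup_add sum.distrib)

lemma mon_degree_zero [simp]: "mon_degree 0 = 0" by (simp add: mon_degree_def)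
lemma mon_degree_eq_0: "mon_degree m = 0 \<longleftrightarrow> m = 0"
proof
  assume "mon_degree m = 0"
  then have "\<forall>i\<in>Poly_Mapping.keys m. Poly_Mapping.lookup m i = 0" by (simp add: mon_degree_def)
  then show "m = 0" by (intro poly_mapping_eqI) (auto simp: in_keys_iff)
qed simp
lemma mon_degree_single [simp]: "mon_degree (Poly_Mapping.single v k) = k"
  by (simp add: mon_degree_def)

definition graded_polys :: "nat \<Rightarrow> int \<Rightarrow> ('k::field) mpoly set" where
  "graded_polys n d = {p \<in> Polys n. homogeneous_of_degree d p}"

lemma graded_polys_iff: "p \<in> graded_polys n d \<longleftrightarrow>
    (\<forall>m\<in>Poly_Mapping.keys p. Poly_Mapping.keys m \<subseteq> {1..n} \<and> int (mon_degree m) = d)"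
  by (auto simp: graded_polys_def Polys_iff homogeneous_of_degree_def)

lemma graded_polys_Polys: "p \<in> graded_polys n d \<Longrightarrow> p \<in> Polys n" by (simp add: graded_polys_def)
lemma graded_polys_zero [simp]: "0 \<in> graded_polys n d" by (simp add: graded_polys_iff)
lemma graded_polys_add: "p \<in> graded_polys n d \<Longrightarrow> q \<in> graded_polys n d \<Longrightarrow> p + q \<in> graded_polys n d"
  using keys_add[of p q] unfolding graded_polys_iff by blast
lemma graded_polys_uminus: "p \<in> graded_polys n d \<Longrightarrow> - p \<in> graded_polys n d"
  by (simp add: graded_polys_iff keys_uminus)
lemma graded_polys_mult: "p \<in> graded_polys n a \<Longrightarrow> q \<in> graded_polys n b \<Longrightarrow> p * q \<in> graded_polys n (a + b)"
  unfolding graded_polys_iff by (metis keys_mult_E Un_least keys_exponent_add mon_degree_add of_nat_add)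
lemma graded_polys_sum: "(\<And>a. a \<in> A \<Longrightarrow> f a \<in> graded_polys n d) \<Longrightarrow> sum f A \<in> graded_polys n d"
  by (induction A rule: infinite_finite_induct) (auto intro: graded_polys_add)
lemma graded_polys_var: "v \<in> {1..n} \<Longrightarrow> var v \<in> graded_polys n 1"
  by (auto simp: graded_polys_iff var_def)
lemma graded_polys_const: "Poly_Mapping.single 0 c \<in> graded_polys n 0"
  by (auto simp: graded_polys_iff split: if_splits)
lemma graded_polys_neg: "p \<in> graded_polys n d \<Longrightarrow> d < 0 \<Longrightarrow> p = 0"
  by (rule poly_mapping_eqI) (auto simp: graded_polys_iff in_keys_iff)
lemma graded_polys_lookup0: "p \<in> graded_polys n d \<Longrightarrow> d \<noteq> 0 \<Longrightarrow> Poly_Mapping.lookup p 0 = 0"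
  unfolding graded_polys_iff by (metis in_keys_iff mon_degree_zero of_nat_0)
lemma graded_polys_0: "p \<in> graded_polys n 0 \<Longrightarrow> p = Poly_Mapping.single 0 (Poly_Mapping.lookup p 0)"
  by (rule poly_mapping_eqI) (auto simp: graded_polys_iff in_keys_iff lookup_single when_def mon_degree_eq_0)

lemma lookup_mult_0: "Poly_Mapping.lookup (p * q) (0 :: nat \<Rightarrow>\<^sub>0 nat) = Poly_Mapping.lookup p 0 * Poly_Mapping.lookup (q :: 'k::field mpoly) 0"
proof -
  have *: "(0 = l + r) = (l = 0 \<and> r = 0)" for l r :: "nat \<Rightarrow>\<^sub>0 nat"
    by (metis add.right_neutral add_cancel_right_left keys_exponent_add keys_zero sup_eq_bot_iff keys_eq_0)
  have "(\<Sum>r. Poly_Mapping.lookup q r when 0 = l + r) = (Poly_Mapping.lookup q 0 when l = 0)" for l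
  proof (cases "l = 0")
    case False
    then show ?thesis by (simp add: *)
  next
    case True
    then show ?thesis by simp
  qed
  then show ?thesis by (simp add: lookup_mult mult_when)
qed

lemma lookup_monomial_mult:
  "Poly_Mapping.lookup (Poly_Mapping.single a c * q) (a + m) = c * Poly_Mapping.lookup (q :: 'k::field mpoly) m"
proof -
  have "Poly_Mapping.lookup (Poly_Mapping.single a c * q) (a + m)
     = (\<Sum>l. (c when a = l) * (\<Sum>r. Poly_Mapping.lookup q r when a + m = l + r))"
    by (simp add: lookup_mult lookup_single)
  also have "\<dots> = (\<Sum>l. (c * (\<Sum>r. Poly_Mapping.lookup q r when a + m = l + r)) when a = l)"
    by (simp add: when_mult)
  also have "\<dots> = c * Poly_Mapping.lookup q m" by simp
  finally show ?thesis .
qed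

definition var_exp :: "nat \<Rightarrow> (nat \<Rightarrow>\<^sub>0 nat)" where "var_exp v = Poly_Mapping.single v 1"

lemma var_var_exp: "var v = Poly_Mapping.single (var_exp v) 1" by (simp add: var_def var_exp_def)
lemma keys_var_exp [simp]: "Poly_Mapping.keys (var_exp v) = {v}" by (simp add: var_exp_def)
lemma mon_degree_var_exp [simp]: "mon_degree (var_exp v) = 1" by (simp add: var_exp_def)

lemma var_exp_split: "v \<in> Poly_Mapping.keys m \<Longrightarrow> \<exists>m'. m = var_exp v + m'"
  by (rule exI[of _ "m - var_exp v"])
    (auto simp: var_exp_def poly_mapping_eq_iff fun_eq_iff lookup_add lookup_minus lookup_single in_keys_iff when_def)

lemma lookup_var_mult [simp]: "Poly_Mapping.lookup (var v * q) (var_exp v + m) = Poly_Mapping.lookup (q :: 'k::field mpoly) m"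
  unfolding var_var_exp by (simp add: lookup_monomial_mult)

lemma lookup_var_mult_0:
  assumes "v \<notin> Poly_Mapping.keys m"
  shows "Poly_Mapping.lookup (var v * (q :: 'k::field mpoly)) m = 0"
proof (rule ccontr)
  assume "Poly_Mapping.lookup (var v * q) m \<noteq> 0"
  then have "m \<in> Poly_Mapping.keys (var v * q)" by (simp add: in_keys_iff)
  then obtain b where "m = var_exp v + b"
    by (auto elim!: keys_mult_E simp: var_var_exp)
  then show False using assms by (simp add: keys_exponent_add)
qed

lemma var_mult_inj: "var v * p = var v * (q :: 'k::field mpoly) \<Longrightarrow> p = q"
  by (rule poly_mapping_eqI) (metis lookup_var_mult)

text \<open>Monomials that $x_v$ does not divide are dropped. This makes the division total, a left inverse
  of multiplication by $x_v$, and compatible with multiplication by every other variable.\<close>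

definition div_var :: "nat \<Rightarrow> ('k::field) mpoly \<Rightarrow> 'k mpoly" where
  "div_var v p = Poly_Mapping.map_key ((+) (var_exp v)) p"

lemma lookup_div_var [simp]: "Poly_Mapping.lookup (div_var v p) m = Poly_Mapping.lookup p (var_exp v + m)"
  unfolding div_var_def by (simp add: map_key.rep_eq)

lemma div_var_add: "div_var v (p + q) = div_var v p + div_var v q"
  by (rule poly_mapping_eqI) (simp add: lookup_add)
lemma div_var_var: "div_var v (var v * p) = p"
  by (rule poly_mapping_eqI) simp
lemma div_var_var_other:
  assumes "u \<noteq> v"
  shows "div_var v (var u * p) = var u * div_var v p"
proof (rule poly_mapping_eqI)
  fix m
  show "Poly_Mapping.lookup (div_var v (var u * p)) m = Poly_Mapping.lookup (var u * div_var v p) m"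
  proof (cases "u \<in> Poly_Mapping.keys m")
    case True
    then obtain m' where m: "m = var_exp u + m'" using var_exp_split by blast
    show ?thesis using lookup_var_mult[of u p "var_exp v + m'"] unfolding m
      by (simp add: add.left_commute)
  next
    case False
    then show ?thesis using assms
      by (simp add: lookup_var_mult_0 keys_exponent_add)
  qed
qed
lemma div_var_graded_polys: "p \<in> graded_polys n d \<Longrightarrow> div_var v p \<in> graded_polys n (d - 1)"
proof -
  assume p: "p \<in> graded_polys n d"
  show ?thesis unfolding graded_polys_iff
  proof
    fix m assume "m \<in> Poly_Mapping.keys (div_var v p)"
    then have "var_exp v + m \<in> Poly_Mapping.keys p" by (simp add: in_keys_iff)
    then have "Poly_Mapping.keys (var_exp v + m) \<subseteq> {1..n} \<and> int (mon_degree (var_exp v + m)) = d"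
      using p unfolding graded_polys_iff by blast
    then show "Poly_Mapping.keys m \<subseteq> {1..n} \<and> int (mon_degree m) = d - 1"
      by (auto simp: keys_exponent_add mon_degree_add)
  qed
qed

lemma var_div_var:
  assumes "\<And>m. m \<in> Poly_Mapping.keys p \<Longrightarrow> v \<in> Poly_Mapping.keys m"
  shows "var v * div_var v p = p"
proof (rule poly_mapping_eqI)
  fix m
  show "Poly_Mapping.lookup (var v * div_var v p) m = Poly_Mapping.lookup p m"
  proof (cases "v \<in> Poly_Mapping.keys m")
    case True
    then obtain m' where m: "m = var_exp v + m'" using var_exp_split by blast
    show ?thesis unfolding m by simp
  next
    case False
    then show ?thesis using assms[of m] by (auto simp: lookup_var_mult_0 in_keys_iff)
  qed
qed

definition restrict_mons :: "((nat \<Rightarrow>\<^sub>0 nat) \<Rightarrow> bool) \<Rightarrow> ('k::field) mpoly \<Rightarrow> 'k mpoly" where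
  "restrict_mons P p = Poly_Mapping.mapp (\<lambda>m a. a when P m) p"

lemma lookup_restrict_mons: "Poly_Mapping.lookup (restrict_mons P p) m = (if P m then Poly_Mapping.lookup p m else 0)"
  by (auto simp: restrict_mons_def lookup_mapp when_def in_keys_iff)
lemma keys_restrict_mons: "Poly_Mapping.keys (restrict_mons P p) = {m \<in> Poly_Mapping.keys p. P m}"
  by (auto simp: in_keys_iff lookup_restrict_mons split: if_splits)
lemma restrict_mons_add: "restrict_mons P (p + q) = restrict_mons P p + restrict_mons P q"
  by (rule poly_mapping_eqI) (simp add: lookup_restrict_mons lookup_add)
lemma restrict_mons_zero [simp]: "restrict_mons P 0 = 0"
  by (rule poly_mapping_eqI) (simp add: lookup_restrict_mons)
lemma restrict_mons_sum: "restrict_mons P (sum f A) = (\<Sum>a\<in>A. restrict_mons P (f a))"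
  by (induction A rule: infinite_finite_induct) (auto simp: restrict_mons_add)

definition hom_comp :: "int \<Rightarrow> ('k::field) mpoly \<Rightarrow> 'k mpoly" where
  "hom_comp d = restrict_mons (\<lambda>m. int (mon_degree m) = d)"

lemma hom_comp_graded_polys: "p \<in> Polys n \<Longrightarrow> hom_comp d p \<in> graded_polys n d"
  by (auto simp: hom_comp_def graded_polys_iff Polys_iff keys_restrict_mons)

text \<open>Multiplication by a homogeneous $q$ of degree $e$ sends the part of $p$ of degree other than
  $d-e$ to degrees other than $d$.\<close>

lemma hom_comp_mult:
  assumes "q \<in> graded_polys n e"
  shows "hom_comp d (q * p) = q * hom_comp (d - e) p"
proof -
  let ?r = "restrict_mons (\<lambda>m. int (mon_degree m) \<noteq> d - e) p"
  have p: "p = hom_comp (d - e) p + ?r"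
    by (rule poly_mapping_eqI) (simp add: lookup_add hom_comp_def lookup_restrict_mons)
  have 1: "hom_comp d (q * hom_comp (d - e) p) = q * hom_comp (d - e) p"
  proof (rule poly_mapping_eqI)
    fix m
    have "int (mon_degree m) = d" if "m \<in> Poly_Mapping.keys (q * hom_comp (d - e) p)"
      using that assms by (auto elim!: keys_mult_E simp: graded_polys_iff hom_comp_def keys_restrict_mons mon_degree_add)
    then show "Poly_Mapping.lookup (hom_comp d (q * hom_comp (d - e) p)) m = Poly_Mapping.lookup (q * hom_comp (d - e) p) m"
      by (auto simp: hom_comp_def[of d] lookup_restrict_mons in_keys_iff)
  qed
  have 2: "hom_comp d (q * ?r) = 0"
  proof (rule poly_mapping_eqI)
    fix m
    have "int (mon_degree m) \<noteq> d" if "m \<in> Poly_Mapping.keys (q * ?r)"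
      using that assms by (auto elim!: keys_mult_E simp: graded_polys_iff keys_restrict_mons mon_degree_add)
    then show "Poly_Mapping.lookup (hom_comp d (q * ?r)) m = Poly_Mapping.lookup 0 m"
      by (auto simp: hom_comp_def[of d] lookup_restrict_mons in_keys_iff)
  qed
  have "q * p = q * hom_comp (d - e) p + q * ?r"
    by (subst p) (simp only: distrib_left)
  then have "hom_comp d (q * p) = hom_comp d (q * hom_comp (d - e) p) + hom_comp d (q * ?r)"
    by (simp add: hom_comp_def restrict_mons_add)
  then show ?thesis by (simp add: 1 2)
qed

section \<open>Koszul homology as a measure of regularity\<close>

text \<open>The scalar $(-1)^k$, which has to act on an arbitrary abelian group.\<close>

definition alt_sign :: "nat \<Rightarrow> 'm \<Rightarrow> 'm::ab_group_add" where
  "alt_sign k a = (if even k then a else - a)"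

lemma alt_sign_0 [simp]: "alt_sign 0 a = a" by (simp add: alt_sign_def)
lemma alt_sign_zero [simp]: "alt_sign k 0 = 0" by (simp add: alt_sign_def)
lemma alt_sign_involution [simp]: "alt_sign k (alt_sign k a) = a" by (simp add: alt_sign_def)
lemma alt_sign_Suc: "alt_sign (Suc k) a = - alt_sign k a" by (simp add: alt_sign_def)
lemma alt_sign_add: "alt_sign k (a + b) = alt_sign k a + alt_sign k b" by (simp add: alt_sign_def)
lemma alt_sign_uminus: "alt_sign k (- a) = - alt_sign k a" by (simp add: alt_sign_def)
lemma alt_sign_comm: "alt_sign k (alt_sign l a) = alt_sign l (alt_sign k a)" by (simp add: alt_sign_def)

locale commuting_operators =
  fixes X :: "nat \<Rightarrow> 'm::ab_group_add \<Rightarrow> 'm"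
  assumes X_add: "X v (a + b) = X v a + X v b"
    and X_comm: "X u (X v a) = X v (X u a)"
begin

lemma X_zero [simp]: "X v 0 = 0" using X_add[of v 0 0] by simp
lemma X_uminus: "X v (- a) = - X v a"
  using X_add[of v a "- a"] by (simp add: eq_neg_iff_add_eq_0 add.commute)
lemma X_alt_sign: "X v (alt_sign k a) = alt_sign k (X v a)" by (simp add: alt_sign_def X_uminus)

text \<open>The Koszul differential. A chain assigns to $\tau$ the coefficient of the basis element
  $e_\tau$ of the exterior algebra, and the sign of $v$ is given by its position in
  $\tau\cup\{v\}$.\<close>

definition boundary :: "nat \<Rightarrow> (nat set \<Rightarrow> 'm) \<Rightarrow> nat set \<Rightarrow> 'm" where
  "boundary n z \<tau> = (\<Sum>v\<in>{1..n} - \<tau>. alt_sign (card (\<tau> \<inter> {..<v})) (X v (z (insert v \<tau>))))"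

lemma boundary_add: "boundary n (y + z) = boundary n y + boundary n z"
  by (rule ext) (simp add: boundary_def X_add alt_sign_add sum.distrib)
lemma boundary_uminus: "boundary n (- z) = - boundary n z"
  by (rule ext) (simp add: boundary_def X_uminus alt_sign_uminus sum_negf)
lemma boundary_diff: "boundary n (y - z) = boundary n y - boundary n z"
  using boundary_add[of n y "- z"] by (simp add: boundary_uminus)
lemma boundary_zero [simp]: "boundary n 0 = 0"
  by (rule ext) (simp add: boundary_def)

text \<open>The complex on $k+1$ operators is the mapping cone of the last operator on the complex on $k$
  operators. All inductions on the number of variables go through this formula.\<close>

lemma boundary_Suc:
  "boundary (Suc k) z \<tau> = boundary k z \<tau> + (if Suc k \<in> \<tau> then 0
     else alt_sign (card (\<tau> \<inter> {..<Suc k})) (X (Suc k) (z (insert (Suc k) \<tau>))))"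
proof (cases "Suc k \<in> \<tau>")
  case True
  then have "{1..Suc k} - \<tau> = {1..k} - \<tau>" by (auto simp: le_Suc_eq)
  then show ?thesis using True by (simp add: boundary_def)
next
  case False
  then have "{1..Suc k} - \<tau> = insert (Suc k) ({1..k} - \<tau>)" by auto
  then show ?thesis using False by (simp add: boundary_def add.commute)
qed

lemma X_sum: "X v (sum f A) = (\<Sum>a\<in>A. X v (f a))"
  by (induction A rule: infinite_finite_induct) (auto simp: X_add)
lemma alt_sign_sum: "alt_sign k (sum f A) = (\<Sum>a\<in>A. alt_sign k (f a))"
  by (induction A rule: infinite_finite_induct) (auto simp: alt_sign_add)

text \<open>The two differentials of the mapping cone anticommute: an inserted index $v\le k$ raises by one
  the number of elements below $k+1$.\<close>

lemma boundary_insert_new: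
  assumes "Suc k \<notin> \<tau>"
  shows "boundary k (\<lambda>\<sigma>. alt_sign (card (\<sigma> \<inter> {..<Suc k})) (X (Suc k) (z (insert (Suc k) \<sigma>)))) \<tau>
     = - alt_sign (card (\<tau> \<inter> {..<Suc k})) (X (Suc k) (boundary k z (insert (Suc k) \<tau>)))"
proof -
  have D: "{1..k} - insert (Suc k) \<tau> = {1..k} - \<tau>" by auto
  have "alt_sign (card (\<tau> \<inter> {..<v})) (X v (alt_sign (card (insert v \<tau> \<inter> {..<Suc k})) (X (Suc k) (z (insert (Suc k) (insert v \<tau>))))))
     = - alt_sign (card (\<tau> \<inter> {..<Suc k})) (X (Suc k) (alt_sign (card (insert (Suc k) \<tau> \<inter> {..<v})) (X v (z (insert v (insert (Suc k) \<tau>))))))"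
    if v: "v \<in> {1..k} - \<tau>" for v
  proof -
    have "insert v \<tau> \<inter> {..<Suc k} = insert v (\<tau> \<inter> {..<Suc k})" using v by auto
    then have c1: "card (insert v \<tau> \<inter> {..<Suc k}) = Suc (card (\<tau> \<inter> {..<Suc k}))" using v by simp
    have c2: "insert (Suc k) \<tau> \<inter> {..<v} = \<tau> \<inter> {..<v}" using v by auto
    show ?thesis unfolding c1 c2
      by (simp add: X_alt_sign alt_sign_Suc X_uminus alt_sign_uminus X_comm[of v "Suc k"] alt_sign_comm insert_commute)
  qed
  then show ?thesis
    by (simp add: boundary_def D X_sum alt_sign_sum sum_negf[symmetric])
qed

lemma boundary_squared: "boundary n (boundary n z) = 0"
proof (induction n)
  case 0
  show ?case by (rule ext) (simp add: boundary_def)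
next
  case (Suc k)
  show ?case
  proof
    fix \<tau>
    have IH: "boundary k (boundary k z) \<sigma> = 0" for \<sigma> using Suc by simp
    let ?t = "\<lambda>\<sigma>. alt_sign (card (\<sigma> \<inter> {..<Suc k})) (X (Suc k) (z (insert (Suc k) \<sigma>)))"
    show "boundary (Suc k) (boundary (Suc k) z) \<tau> = 0 \<tau>"
    proof (cases "Suc k \<in> \<tau>")
      case True
      have "boundary k (boundary (Suc k) z) \<tau> = boundary k (boundary k z) \<tau>"
        unfolding boundary_def[of k "boundary _ z"] using True by (intro sum.cong) (auto simp: boundary_Suc)
      then show ?thesis using True IH by (simp add: boundary_Suc[of k "boundary (Suc k) z"])
    next
      case False
      have "boundary k (boundary (Suc k) z) \<tau> = boundary k (boundary k z + ?t) \<tau>"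
        unfolding boundary_def[of k "boundary (Suc k) z"] boundary_def[of k "boundary k z + ?t"] using False
        by (intro sum.cong) (auto simp: boundary_Suc)
      also have "\<dots> = boundary k ?t \<tau>" by (simp add: boundary_add IH)
      also have "\<dots> = - alt_sign (card (\<tau> \<inter> {..<Suc k})) (X (Suc k) (boundary k z (insert (Suc k) \<tau>)))"
        using False by (rule boundary_insert_new)
      finally show ?thesis using False
        by (simp add: boundary_Suc[of k "boundary (Suc k) z"]) (simp add: boundary_Suc)
    qed
  qed
qed

text \<open>Chains of exterior degree $i$ are functions on all sets, so vanishing away from the $i$-element
  subsets of the index set has to be demanded.\<close>

definition koszul_chain :: "nat \<Rightarrow> nat \<Rightarrow> 'm set \<Rightarrow> (nat set \<Rightarrow> 'm) \<Rightarrow> bool" where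
  "koszul_chain n i A z \<longleftrightarrow> (\<forall>\<tau>. z \<tau> \<in> A) \<and> (\<forall>\<tau>. z \<tau> \<noteq> 0 \<longrightarrow> \<tau> \<subseteq> {1..n} \<and> card \<tau> = i)"

text \<open>A graded module is the family of its homogeneous pieces inside one ambient group. The Koszul
  complex is built from the action of the variables, so closure under that action is recorded.\<close>

definition graded_submodule :: "nat \<Rightarrow> (int \<Rightarrow> 'm set) \<Rightarrow> bool" where
  "graded_submodule n M \<longleftrightarrow> (\<forall>d. 0 \<in> M d \<and> (\<forall>a\<in>M d. - a \<in> M d \<and> (\<forall>b\<in>M d. a + b \<in> M d)
      \<and> (\<forall>v\<in>{1..n}. X v a \<in> M (d + 1))))"

text \<open>Here $d$ is the degree of the coefficients, so the chain has total degree $d+i$ and the condition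
  says that the Koszul homology $H_i$ vanishes in total degrees greater than $c+i$. For a module over the
  polynomial ring this is the usual bound $\operatorname{reg}(M)\le c$, with $\operatorname{Tor}_i(M,K)$ computed by the Koszul
  complex.\<close>

definition reg_le :: "nat \<Rightarrow> (int \<Rightarrow> 'm set) \<Rightarrow> int \<Rightarrow> bool" where
  "reg_le n M c \<longleftrightarrow> (\<forall>i d z. c < d \<longrightarrow> koszul_chain n i (M d) z \<longrightarrow> boundary n z = 0 \<longrightarrow>
      (\<exists>w. koszul_chain n (Suc i) (M (d - 1)) w \<and> boundary n w = z))"

lemma reg_leD:
  assumes "reg_le n M c" "c < d" "koszul_chain n i (M d) z" "boundary n z = 0"
  obtains w where "koszul_chain n (Suc i) (M (d - 1)) w" "boundary n w = z"
  using assms unfolding reg_le_def by blast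

lemma reg_le_mono: "reg_le n M c \<Longrightarrow> c \<le> c' \<Longrightarrow> reg_le n M c'"
  unfolding reg_le_def by (meson order.strict_trans1)

lemma graded_submodule_zero: "graded_submodule n M \<Longrightarrow> 0 \<in> M d" by (simp add: graded_submodule_def)
lemma graded_submodule_add: "graded_submodule n M \<Longrightarrow> a \<in> M d \<Longrightarrow> b \<in> M d \<Longrightarrow> a + b \<in> M d"
  by (simp add: graded_submodule_def)
lemma graded_submodule_uminus: "graded_submodule n M \<Longrightarrow> a \<in> M d \<Longrightarrow> - a \<in> M d"
  by (simp add: graded_submodule_def)
lemma graded_submodule_X: "graded_submodule n M \<Longrightarrow> a \<in> M d \<Longrightarrow> v \<in> {1..n} \<Longrightarrow> X v a \<in> M (d + 1)"
  by (simp add: graded_submodule_def)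
lemma graded_submodule_diff: "graded_submodule n M \<Longrightarrow> a \<in> M d \<Longrightarrow> b \<in> M d \<Longrightarrow> a - b \<in> M d"
  using graded_submodule_add[of n M a d "- b"] graded_submodule_uminus[of n M b d] by simp
lemma graded_submodule_alt_sign: "graded_submodule n M \<Longrightarrow> a \<in> M d \<Longrightarrow> alt_sign k a \<in> M d"
  by (simp add: alt_sign_def graded_submodule_uminus)
lemma graded_submodule_sum: "graded_submodule n M \<Longrightarrow> (\<And>a. a \<in> A \<Longrightarrow> f a \<in> M d) \<Longrightarrow> sum f A \<in> M d"
  by (induction A rule: infinite_finite_induct) (auto intro: graded_submodule_add graded_submodule_zero)
lemma koszul_chain_add: "graded_submodule n M \<Longrightarrow> koszul_chain k i (M d) y \<Longrightarrow> koszul_chain k i (M d) z \<Longrightarrow> koszul_chain k i (M d) (y + z)"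
  unfolding koszul_chain_def by (auto simp: graded_submodule_add) (metis add.right_neutral add_cancel_right_left subsetD atLeastAtMost_iff)+
lemma koszul_chain_uminus: "graded_submodule n M \<Longrightarrow> koszul_chain k i (M d) z \<Longrightarrow> koszul_chain k i (M d) (- z)"
  unfolding koszul_chain_def by (auto simp: graded_submodule_uminus)
lemma koszul_chain_diff: "graded_submodule n M \<Longrightarrow> koszul_chain k i (M d) y \<Longrightarrow> koszul_chain k i (M d) z \<Longrightarrow> koszul_chain k i (M d) (y - z)"
  using koszul_chain_add[of n M k i d y "- z"] koszul_chain_uminus[of n M k i d z] by simp

lemma boundary_supp:
  assumes "koszul_chain k i A z" "boundary n z \<tau> \<noteq> 0"
  shows "finite \<tau> \<and> \<tau> \<subseteq> {1..k} \<and> Suc (card \<tau>) = i"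
proof -
  obtain v where v: "v \<in> {1..n} - \<tau>" "z (insert v \<tau>) \<noteq> 0"
    using assms(2) unfolding boundary_def by (metis (no_types, lifting) sum.neutral X_zero alt_sign_zero)
  then have *: "insert v \<tau> \<subseteq> {1..k}" "card (insert v \<tau>) = i" using assms(1) by (auto simp: koszul_chain_def)
  then have "finite \<tau>" by (meson finite_atLeastAtMost finite_insert finite_subset)
  then show ?thesis using * v by auto
qed

lemma boundary_koszul_chain:
  assumes "graded_submodule n M" "koszul_chain n (Suc i) (M d) z"
  shows "koszul_chain n i (M (d + 1)) (boundary n z)"
  unfolding koszul_chain_def
proof (intro conjI allI impI)
  fix \<tau>
  show "boundary n z \<tau> \<in> M (d + 1)" unfolding boundary_def using assms
    by (intro graded_submodule_sum[OF assms(1)] graded_submodule_alt_sign[OF assms(1)] graded_submodule_X[OF assms(1)]) (auto simp: koszul_chain_def)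
  show "\<tau> \<subseteq> {1..n}" "card \<tau> = i" if "boundary n z \<tau> \<noteq> 0" using boundary_supp[OF assms(2) that] by auto
qed

lemma koszul_chain_0_boundary: "koszul_chain n 0 A z \<Longrightarrow> boundary n z = 0"
  using boundary_supp[of n 0 A z n] by (fastforce simp: fun_eq_iff)

text \<open>Mayer--Vietoris. Split a cycle as $z=a+b$. Then $\partial a=-\partial b$ is a cycle of
  $A\cap B$ whose coefficients have degree $d+1>c+1$, hence $\partial a=\partial u$ with $u$ in
  $A\cap B$, and $a-u$ and $b+u$ are cycles of $A$ and of $B$.\<close>

lemma reg_le_sum:
  assumes gA: "graded_submodule n A" and gB: "graded_submodule n B"
    and A: "reg_le n A c" and B: "reg_le n B c" and AB: "reg_le n (\<lambda>d. A d \<inter> B d) (c + 1)"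
  shows "reg_le n (\<lambda>d. {a + b | a b. a \<in> A d \<and> b \<in> B d}) c"
  unfolding reg_le_def
proof (intro allI impI)
  fix i d z
  assume d: "c < d" and z: "koszul_chain n i {a + b | a b. a \<in> A d \<and> b \<in> B d} z" and bz: "boundary n z = 0"
  have "\<exists>a b. a \<in> A d \<and> b \<in> B d \<and> z \<tau> = a + b \<and> (z \<tau> = 0 \<longrightarrow> a = 0 \<and> b = 0)" for \<tau>
  proof (cases "z \<tau> = 0")
    case True
    then show ?thesis using graded_submodule_zero[OF gA] graded_submodule_zero[OF gB] by auto
  next
    case False
    then show ?thesis using z unfolding koszul_chain_def by blast
  qed
  then obtain a b where ab: "\<And>\<tau>. a \<tau> \<in> A d" "\<And>\<tau>. b \<tau> \<in> B d" "\<And>\<tau>. z \<tau> = a \<tau> + b \<tau>"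
      "\<And>\<tau>. z \<tau> = 0 \<Longrightarrow> a \<tau> = 0 \<and> b \<tau> = 0" by metis
  have a: "koszul_chain n i (A d) a" and b: "koszul_chain n i (B d) b" using z ab unfolding koszul_chain_def by metis+
  have zab: "z = a + b" using ab(3) by (simp add: fun_eq_iff)
  have bab: "boundary n a = - boundary n b" using bz by (simp add: zab boundary_add eq_neg_iff_add_eq_0)
  obtain u where u: "koszul_chain n (Suc (i - 1)) (A d \<inter> B d) u \<or> u = 0" "i = 0 \<Longrightarrow> u = 0" "boundary n u = boundary n a"
  proof (cases i)
    case 0
    then show ?thesis using that[of 0] koszul_chain_0_boundary[of n "A d" a] a by auto
  next
    case (Suc j)
    have "koszul_chain n j (A (d + 1)) (boundary n a)" "koszul_chain n j (B (d + 1)) (- boundary n b)"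
      using boundary_koszul_chain[OF gA] boundary_koszul_chain[OF gB] a b Suc koszul_chain_uminus[OF gB] by auto
    then have "koszul_chain n j (A (d + 1) \<inter> B (d + 1)) (boundary n a)" using bab by (auto simp: koszul_chain_def)
    then obtain u where "koszul_chain n (Suc j) (A d \<inter> B d) u" "boundary n u = boundary n a"
      using reg_leD[OF AB, of "d + 1" j "boundary n a"] d by (auto simp: boundary_squared)
    then show ?thesis using that Suc by auto
  qed
  have uA: "koszul_chain n i (A d) u" and uB: "koszul_chain n i (B d) u"
    using u(1,2) graded_submodule_zero[OF gA] graded_submodule_zero[OF gB] by (cases i; auto simp: koszul_chain_def)+
  obtain p where p: "koszul_chain n (Suc i) (A (d - 1)) p" "boundary n p = a - u"
    using reg_leD[OF A d koszul_chain_diff[OF gA a uA]] u(3) boundary_diff[of n a u] by (metis diff_self)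
  obtain q where q: "koszul_chain n (Suc i) (B (d - 1)) q" "boundary n q = b + u"
    using reg_leD[OF B d koszul_chain_add[OF gB b uB]] u(3) bab boundary_add[of n b u] by (metis add.right_inverse)
  have "koszul_chain n (Suc i) {a + b | a b. a \<in> A (d - 1) \<and> b \<in> B (d - 1)} (p + q)"
    using p(1) q(1) unfolding koszul_chain_def
    by auto (metis add.right_neutral add_cancel_right_left subsetD atLeastAtMost_iff)+
  moreover have "boundary n (p + q) = z" by (simp add: boundary_add p q zab)
  ultimately show "\<exists>w. koszul_chain n (Suc i) {a + b | a b. a \<in> A (d - 1) \<and> b \<in> B (d - 1)} w \<and> boundary n w = z"
    by blast
qed

text \<open>An injective operator that commutes with the others identifies $M$ with its image, shifted by one
  degree.\<close>

lemma reg_le_shift: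
  assumes M: "reg_le n M c" and inj: "inj (X v)"
  shows "reg_le n (\<lambda>d. X v ` M (d - 1)) (c + 1)"
  unfolding reg_le_def
proof (intro allI impI)
  fix i d z
  assume d: "c + 1 < d" and z: "koszul_chain n i (X v ` M (d - 1)) z" and bz: "boundary n z = 0"
  have "\<exists>y. y \<in> M (d - 1) \<and> z \<tau> = X v y" for \<tau>
    using z by (auto simp: koszul_chain_def)
  then obtain y where y: "\<And>\<tau>. y \<tau> \<in> M (d - 1)" "\<And>\<tau>. z \<tau> = X v (y \<tau>)" by metis
  have y0: "y \<tau> \<noteq> 0 \<Longrightarrow> z \<tau> \<noteq> 0" for \<tau> using y(2) inj by (metis X_zero injD)
  have XX: "boundary n (\<lambda>\<tau>. X v (f \<tau>)) \<tau> = X v (boundary n f \<tau>)" for f \<tau>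
    by (simp add: boundary_def X_sum X_alt_sign X_comm[of _ v])
  have "X v (boundary n y \<tau>) = 0" for \<tau>
  proof -
    have "z = (\<lambda>\<tau>. X v (y \<tau>))" using y(2) by (rule ext)
    then show ?thesis using fun_cong[OF bz, of \<tau>] XX[of y \<tau>] by simp
  qed
  then have "boundary n y = 0" using inj by (auto simp: fun_eq_iff) (metis X_zero injD)
  moreover have "koszul_chain n i (M (d - 1)) y" using y0 y(1) z by (auto simp: koszul_chain_def)
  ultimately obtain w where w: "koszul_chain n (Suc i) (M (d - 1 - 1)) w" "boundary n w = y"
    using reg_leD[OF M, of "d - 1"] d by auto
  have "koszul_chain n (Suc i) (X v ` M (d - 1 - 1)) (\<lambda>\<tau>. X v (w \<tau>))"
    using w(1) unfolding koszul_chain_def by (metis X_zero imageI)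
  moreover have "boundary n (\<lambda>\<tau>. X v (w \<tau>)) = z" using XX[of w] w(2) y(2) by (auto simp: fun_eq_iff)
  ultimately show "\<exists>w. koszul_chain n (Suc i) (X v ` M (d - 1 - 1)) w \<and> boundary n w = z" by blast
qed

text \<open>Chains of exterior degree one encode the linear combinations $\sum_vx_vw_v$: their boundary is
  this sum, placed at the empty set.\<close>

definition linear_chain :: "nat \<Rightarrow> (nat \<Rightarrow> 'm) \<Rightarrow> nat set \<Rightarrow> 'm" where
  "linear_chain n w \<tau> = (if card \<tau> = 1 \<and> \<tau> \<subseteq> {1..n} then w (the_elem \<tau>) else 0)"

lemma linear_chain_is_chain: "0 \<in> A \<Longrightarrow> (\<And>v. v \<in> {1..n} \<Longrightarrow> w v \<in> A) \<Longrightarrow> koszul_chain n 1 A (linear_chain n w)"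
  by (auto simp: koszul_chain_def linear_chain_def card_1_singleton_iff)

lemma boundary_linear_chain: "boundary n (linear_chain n w) \<tau> = (if \<tau> = {} then \<Sum>v\<in>{1..n}. X v (w v) else 0)"
proof (cases "\<tau> = {}")
  case True
  then show ?thesis by (simp add: boundary_def) (intro sum.cong, auto simp: linear_chain_def)
next
  case False
  have "linear_chain n w (insert v \<tau>) = 0" if "v \<notin> \<tau>" for v
    using that False by (auto simp: linear_chain_def card_1_singleton_iff)
  then show ?thesis using False by (simp add: boundary_def)
qed

lemma koszul_chain_0_eq:
  assumes "koszul_chain n 0 A z" shows "z \<tau> = (if \<tau> = {} then z {} else 0)"
  using assms unfolding koszul_chain_def by (metis card_0_eq finite_atLeastAtMost finite_subset)

text \<open>In exterior degree zero every chain is a cycle, so the Koszul bound also bounds the degrees of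
  minimal generators.\<close>

lemma reg_le_generated:
  assumes "reg_le n M c" "c < d" "f \<in> M d" "graded_submodule n M"
  obtains w where "\<And>v. v \<in> {1..n} \<Longrightarrow> w v \<in> M (d - 1)" "f = (\<Sum>v\<in>{1..n}. X v (w v))"
proof -
  define z :: "nat set \<Rightarrow> 'm" where "z \<tau> = (if \<tau> = {} then f else 0)" for \<tau>
  have z: "koszul_chain n 0 (M d) z" using assms graded_submodule_zero by (auto simp: koszul_chain_def z_def)
  obtain w where w: "koszul_chain n 1 (M (d - 1)) w" "boundary n w = z"
    using reg_leD[OF assms(1,2) z koszul_chain_0_boundary[OF z]] by auto
  have "f = boundary n w {}" using w by (simp add: z_def)
  also have "\<dots> = (\<Sum>v\<in>{1..n}. X v (w {v}))" by (simp add: boundary_def)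
  finally show thesis using that[of "\<lambda>v. w {v}"] w by (auto simp: koszul_chain_def)
qed

text \<open>Exactness is required in positive exterior degree only; in degree zero the homology of a free
  module $F$ is $F/(x_1,\dots,x_n)F$.\<close>

definition exact :: "nat \<Rightarrow> (int \<Rightarrow> 'm set) \<Rightarrow> bool" where
  "exact n F \<longleftrightarrow> (\<forall>i d z. koszul_chain n (Suc i) (F d) z \<longrightarrow> boundary n z = 0 \<longrightarrow>
      (\<exists>w. koszul_chain n (Suc (Suc i)) (F (d - 1)) w \<and> boundary n w = z))"

lemma boundary_map:
  assumes "\<And>a b. \<phi> (a + b) = \<phi> a + \<phi> b" "\<And>v a. v \<in> {1..n} \<Longrightarrow> \<phi> (X v a) = X v (\<phi> a)"
  shows "boundary n (\<lambda>\<tau>. \<phi> (z \<tau>)) \<tau> = \<phi> (boundary n z \<tau>)"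
proof -
  have 0: "\<phi> 0 = 0" using assms(1)[of 0 0] by simp
  have "\<phi> (- a) = - \<phi> a" for a using assms(1)[of a "- a"] 0 by (simp add: eq_neg_iff_add_eq_0 add.commute)
  then have s: "\<phi> (alt_sign k a) = alt_sign k (\<phi> a)" for k a by (simp add: alt_sign_def)
  have "\<phi> (sum f A) = (\<Sum>a\<in>A. \<phi> (f a))" for f :: "nat \<Rightarrow> 'm" and A
    by (induction A rule: infinite_finite_induct) (auto simp: assms 0)
  then show ?thesis by (simp add: boundary_def s assms(2))
qed

text \<open>The connecting homomorphism of $0\to Z\to F\to N\to0$. A cycle $z$ of $Z$ bounds some $w$ in $F$:
  in positive exterior degree by exactness, in exterior degree zero because
  $Z\subseteq(x_1,\dots,x_n)F$. The image of $w$ in $N$ is a cycle with coefficients of degree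
  $d-1>c$, hence the boundary of some $u$. Subtracting from $w$ the boundary of a lift of $u$ moves
  $w$ into $Z$ and leaves its boundary unchanged.\<close>

lemma reg_le_kernel:
  assumes F: "graded_submodule n F" and ex: "exact n F"
    and add: "\<And>a b. \<phi> (a + b) = \<phi> a + \<phi> b"
    and com: "\<And>v a. v \<in> {1..n} \<Longrightarrow> \<phi> (X v a) = X v (\<phi> a)"
    and onto: "\<And>d. \<phi> ` F d = N d"
    and N: "reg_le n N c"
    and minim: "\<And>d f. f \<in> F d \<Longrightarrow> \<phi> f = 0 \<Longrightarrow>
       \<exists>w. (\<forall>v\<in>{1..n}. w v \<in> F (d - 1)) \<and> f = (\<Sum>v\<in>{1..n}. X v (w v))"
  shows "reg_le n (\<lambda>d. {f \<in> F d. \<phi> f = 0}) (c + 1)"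
  unfolding reg_le_def
proof (intro allI impI)
  fix i d z
  assume d: "c + 1 < d" and z: "koszul_chain n i {f \<in> F d. \<phi> f = 0} z" and bz: "boundary n z = 0"
  have \<phi>0: "\<phi> 0 = 0" using add[of 0 0] by simp
  have zF: "koszul_chain n i (F d) z" using z by (auto simp: koszul_chain_def)
  have z\<phi>: "\<phi> (z \<tau>) = 0" for \<tau> using z by (auto simp: koszul_chain_def)
  obtain w where w: "koszul_chain n (Suc i) (F (d - 1)) w" "boundary n w = z"
  proof (cases i)
    case 0
    have "z {} \<in> F d" "\<phi> (z {}) = 0" using z by (auto simp: koszul_chain_def)
    then obtain w where "\<forall>v\<in>{1..n}. w v \<in> F (d - 1)" "z {} = (\<Sum>v\<in>{1..n}. X v (w v))"
      using minim by blast
    then have "koszul_chain n 1 (F (d - 1)) (linear_chain n w)" "z {} = (\<Sum>v\<in>{1..n}. X v (w v))"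
      using linear_chain_is_chain[of "F (d - 1)" n w] graded_submodule_zero[OF F] by auto
    moreover have "boundary n (linear_chain n w) = z"
    proof
      fix \<tau>
      show "boundary n (linear_chain n w) \<tau> = z \<tau>"
        using koszul_chain_0_eq[OF zF[unfolded 0], of \<tau>] calculation(2) by (simp add: boundary_linear_chain)
    qed
    ultimately show ?thesis using that[of "linear_chain n w"] 0 by simp
  next
    case (Suc j)
    then show ?thesis using that ex zF bz unfolding exact_def by blast
  qed
  have "koszul_chain n (Suc i) (N (d - 1)) (\<lambda>\<tau>. \<phi> (w \<tau>))"
    using w(1) onto[of "d - 1"] \<phi>0 unfolding koszul_chain_def by (metis imageI)
  moreover have "boundary n (\<lambda>\<tau>. \<phi> (w \<tau>)) = 0"
  proof
    fix \<tau>
    have "boundary n (\<lambda>\<tau>. \<phi> (w \<tau>)) \<tau> = \<phi> (boundary n w \<tau>)" by (rule boundary_map[OF add com])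
    then show "boundary n (\<lambda>\<tau>. \<phi> (w \<tau>)) \<tau> = 0 \<tau>" by (simp add: w z\<phi>)
  qed
  ultimately obtain u where u: "koszul_chain n (Suc (Suc i)) (N (d - 1 - 1)) u" "boundary n u = (\<lambda>\<tau>. \<phi> (w \<tau>))"
    using reg_leD[OF N] d by (metis less_diff_eq)
  have "\<exists>y. y \<in> F (d - 1 - 1) \<and> u \<tau> = \<phi> y \<and> (u \<tau> = 0 \<longrightarrow> y = 0)" for \<tau>
  proof (cases "u \<tau> = 0")
    case True
    then show ?thesis using graded_submodule_zero[OF F] \<phi>0 by (intro exI[of _ 0]) simp
  next
    case False
    have "u \<tau> \<in> \<phi> ` F (d - 1 - 1)" using u(1) onto[of "d - 1 - 1"] by (simp add: koszul_chain_def)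
    then show ?thesis using False by blast
  qed
  then obtain y where y: "\<And>\<tau>. y \<tau> \<in> F (d - 1 - 1)" "\<And>\<tau>. u \<tau> = \<phi> (y \<tau>)" "\<And>\<tau>. u \<tau> = 0 \<Longrightarrow> y \<tau> = 0"
    by metis
  have yc: "koszul_chain n (Suc (Suc i)) (F (d - 1 - 1)) y" using y u(1) unfolding koszul_chain_def by metis
  let ?w = "w - boundary n y"
  have "koszul_chain n (Suc i) (F (d - 1)) ?w"
    using koszul_chain_diff[OF F w(1)] boundary_koszul_chain[OF F yc] by simp
  moreover have "\<phi> (?w \<tau>) = 0" for \<tau>
  proof -
    have "\<phi> (boundary n y \<tau>) = \<phi> (w \<tau>)"
      using boundary_map[OF add com, of \<open>n\<close> y \<tau>] u(2) y(2) by (metis (no_types, lifting) ext)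
    then show ?thesis using add[of "?w \<tau>" "boundary n y \<tau>"] by simp
  qed
  ultimately have "koszul_chain n (Suc i) {f \<in> F (d - 1). \<phi> f = 0} ?w" by (auto simp: koszul_chain_def)
  moreover have "boundary n ?w = z" by (simp add: boundary_diff boundary_squared w)
  ultimately show "\<exists>w. koszul_chain n (Suc i) {f \<in> F (d - 1). \<phi> f = 0} w \<and> boundary n w = z" by blast
qed

end

text \<open>The operators $Q_v$ model division by the variables on a free module. They provide the
  contractions that make its Koszul complex exact.\<close>

locale divisible_operators = commuting_operators X for X :: "nat \<Rightarrow> 'm::ab_group_add \<Rightarrow> 'm" +
  fixes Q :: "nat \<Rightarrow> 'm::ab_group_add \<Rightarrow> 'm"
  assumes Q_add: "Q v (a + b) = Q v a + Q v b"
    and Q_X: "Q v (X v a) = a"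
    and Q_X_other: "u \<noteq> v \<Longrightarrow> Q v (X u a) = X u (Q v a)"
begin

lemma Q_zero [simp]: "Q v 0 = 0" using Q_add[of v 0 0] by simp
lemma Q_diff: "Q v (a - b) = Q v a - Q v b"
  using Q_add[of v "a - b" b] by simp

text \<open>Induction on the number of variables. Let $v$ be the last one and $w_0=\pm e_v\wedge Q_v(z)$.
  Subtracting $\partial w_0$ replaces the coefficients at sets without $v$ by their remainders under
  division by $x_v$. For such a cycle $z'$, applying $Q_v$ to the cycle condition shows that the
  coefficients at sets containing $v$ vanish, so $z'$ is a cycle in the remaining variables.\<close>

lemma exactI_aux:
  assumes M: "graded_submodule n M" and QM: "\<And>v d a. a \<in> M d \<Longrightarrow> Q v a \<in> M (d - 1)"
    and "k \<le> n" "koszul_chain k (Suc i) (M d) z" "boundary k z = 0"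
  shows "\<exists>w. koszul_chain k (Suc (Suc i)) (M (d - 1)) w \<and> boundary k w = z"
  using assms(3-)
proof (induction k arbitrary: z)
  case 0
  have "z \<tau> = 0" for \<tau> using 0(2) by (auto simp: koszul_chain_def)
  then have "z = 0" by auto
  moreover have "koszul_chain 0 (Suc (Suc i)) (M (d - 1)) 0" using graded_submodule_zero[OF M] by (simp add: koszul_chain_def)
  ultimately show ?case using boundary_zero by blast
next
  case (Suc k)
  let ?v = "Suc k"
  let ?s = "\<lambda>\<tau>. card (\<tau> \<inter> {..<?v})"
  have zD: "z \<tau> \<noteq> 0 \<Longrightarrow> \<tau> \<subseteq> {1..?v} \<and> card \<tau> = Suc i" for \<tau> using Suc.prems(2) by (auto simp: koszul_chain_def)
  define w0 where "w0 \<sigma> = (if ?v \<in> \<sigma> then alt_sign (?s (\<sigma> - {?v})) (Q ?v (z (\<sigma> - {?v}))) else 0)" for \<sigma>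
  have w0: "koszul_chain ?v (Suc (Suc i)) (M (d - 1)) w0"
    unfolding koszul_chain_def
  proof (intro allI conjI impI)
    fix \<sigma>
    have "z (\<sigma> - {?v}) \<in> M d" using Suc.prems(2) by (auto simp: koszul_chain_def)
    then show "w0 \<sigma> \<in> M (d - 1)" using graded_submodule_zero[OF M] graded_submodule_alt_sign[OF M] QM by (auto simp: w0_def)
    assume "w0 \<sigma> \<noteq> 0"
    then have v: "?v \<in> \<sigma>" and "z (\<sigma> - {?v}) \<noteq> 0" by (auto simp: w0_def split: if_splits)
    then have *: "\<sigma> - {?v} \<subseteq> {1..?v}" "card (\<sigma> - {?v}) = Suc i" using zD by auto
    then show "\<sigma> \<subseteq> {1..?v}" by auto
    have "finite (\<sigma> - {?v})" using *(1) finite_atLeastAtMost finite_subset by blast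
    then have "card (insert ?v (\<sigma> - {?v})) = Suc (Suc i)" using *(2) by (simp add: card_insert_disjoint del: insert_Diff_single)
    then show "card \<sigma> = Suc (Suc i)" using v by (simp add: insert_absorb)
  qed
  have bw0: "boundary ?v w0 \<tau> = X ?v (Q ?v (z \<tau>))" if "?v \<notin> \<tau>" for \<tau>
  proof -
    have "boundary k w0 \<tau> = 0" unfolding boundary_def by (intro sum.neutral ballI) (use that in \<open>auto simp: w0_def\<close>)
    then show ?thesis using that by (simp add: boundary_Suc w0_def X_alt_sign)
  qed
  define z' where "z' = z - boundary ?v w0"
  have z'c: "koszul_chain ?v (Suc i) (M d) z'"
  proof -
    have "koszul_chain ?v (Suc i) (M d) (boundary ?v w0)"
    proof -
      have "graded_submodule ?v M" using M Suc.prems(1) by (auto simp: graded_submodule_def)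
      then show ?thesis using boundary_koszul_chain[of ?v M "Suc i" "d - 1" w0] w0 by simp
    qed
    then show ?thesis unfolding z'_def by (rule koszul_chain_diff[OF M Suc.prems(2)])
  qed
  have Qz': "Q ?v (z' \<tau>) = 0" if "?v \<notin> \<tau>" for \<tau>
    using that by (simp add: z'_def bw0 Q_diff Q_X)
  have bz': "boundary ?v z' = 0" unfolding z'_def boundary_diff boundary_squared Suc.prems(3) by (rule diff_self)
  have "z' (insert ?v \<tau>) = 0" if "?v \<notin> \<tau>" for \<tau>
  proof -
    have "Q ?v (boundary k z' \<tau>) = boundary k (\<lambda>\<sigma>. Q ?v (z' \<sigma>)) \<tau>"
      by (rule boundary_map[symmetric]) (auto simp: Q_add Q_X_other)
    also have "\<dots> = 0"
      unfolding boundary_def by (intro sum.neutral ballI) (use that Qz' in auto)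
    finally have q: "Q ?v (boundary k z' \<tau>) = 0" .
    have "boundary k z' \<tau> + alt_sign (?s \<tau>) (X ?v (z' (insert ?v \<tau>))) = 0"
      using fun_cong[OF bz', of \<tau>] that by (simp add: boundary_Suc)
    then have "alt_sign (?s \<tau>) (boundary k z' \<tau>) + X ?v (z' (insert ?v \<tau>)) = 0"
      by (metis alt_sign_add alt_sign_involution alt_sign_zero)
    then have "Q ?v (alt_sign (?s \<tau>) (boundary k z' \<tau>)) + z' (insert ?v \<tau>) = 0"
      by (metis Q_add Q_X Q_zero)
    moreover have "Q ?v (alt_sign (?s \<tau>) (boundary k z' \<tau>)) = 0"
      using q Q_diff[of ?v 0 "boundary k z' \<tau>"] by (simp add: alt_sign_def)
    ultimately show ?thesis by simp
  qed
  then have z'0: "z' \<tau> = 0" if "?v \<in> \<tau>" for \<tau>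
    using that by (metis Diff_iff insert_Diff insertI1)
  have z'k: "koszul_chain k (Suc i) (M d) z'"
    using z'c z'0 unfolding koszul_chain_def by (metis atLeastAtMostSuc_conv le_add1 plus_1_eq_Suc subset_insert)
  have "boundary k z' \<tau> = 0" for \<tau>
    using fun_cong[OF bz', of \<tau>] z'0[of "insert ?v \<tau>"] by (simp add: boundary_Suc split: if_splits)
  then have "boundary k z' = 0" by (simp add: fun_eq_iff)
  then obtain w' where w': "koszul_chain k (Suc (Suc i)) (M (d - 1)) w'" "boundary k w' = z'"
    using Suc.IH[OF _ z'k] Suc.prems(1) by auto
  have w'0: "w' (insert ?v \<tau>) = 0" for \<tau> using w'(1) by (fastforce simp: koszul_chain_def)
  have "boundary ?v w' = z'" by (rule ext) (simp add: boundary_Suc w'0 w'(2))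
  then have "boundary ?v (w0 + w') = z" by (simp add: boundary_add z'_def)
  moreover have "koszul_chain ?v (Suc (Suc i)) (M (d - 1)) w'"
    using w'(1) unfolding koszul_chain_def by (auto simp: subset_iff) (meson le_SucI)
  ultimately show ?case using koszul_chain_add[OF M w0] by blast
qed

lemma exactI:
  assumes "graded_submodule n M" "\<And>v d a. a \<in> M d \<Longrightarrow> Q v a \<in> M (d - 1)"
  shows "exact n M"
  unfolding exact_def using exactI_aux[OF assms order_refl] by blast

end

section \<open>The Koszul complex of a graded free module\<close>

definition var_op :: "nat \<Rightarrow> (nat \<Rightarrow> ('k::field) mpoly) \<Rightarrow> nat \<Rightarrow> 'k mpoly" where
  "var_op v f = (\<lambda>k. var v * f k)"
definition div_op :: "nat \<Rightarrow> (nat \<Rightarrow> ('k::field) mpoly) \<Rightarrow> nat \<Rightarrow> 'k mpoly" where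
  "div_op v f = (\<lambda>k. div_var v (f k))"

interpretation Koszul: divisible_operators var_op div_op
  by unfold_locales
    (auto simp: var_op_def div_op_def fun_eq_iff distrib_left div_var_add div_var_var div_var_var_other mult.left_commute)

lemma inj_var_op: "inj (var_op v)"
proof (rule injI, rule ext)
  fix f g :: "nat \<Rightarrow> 'a mpoly" and k assume "var_op v f = var_op v g"
  then have "var v * f k = var v * g k" unfolding var_op_def by (rule fun_cong)
  then show "f k = g k" by (rule var_mult_inj)
qed

definition graded_free :: "nat \<Rightarrow> nat \<Rightarrow> (nat \<Rightarrow> int) \<Rightarrow> int \<Rightarrow> (nat \<Rightarrow> ('k::field) mpoly) set" where
  "graded_free n r s d = {f. \<forall>k. if k < r then f k \<in> graded_polys n (d - s k) else f k = 0}"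

lemma graded_polys_var_mult: "v \<in> {1..n} \<Longrightarrow> p \<in> graded_polys n d \<Longrightarrow> var v * p \<in> graded_polys n (d + 1)"
  using graded_polys_mult[OF graded_polys_var, of v n p d] by (simp add: add.commute)

lemma graded_freeI: "(\<And>k. k < r \<Longrightarrow> f k \<in> graded_polys n (d - s k)) \<Longrightarrow> (\<And>k. k \<ge> r \<Longrightarrow> f k = 0) \<Longrightarrow> f \<in> graded_free n r s d"
  by (simp add: graded_free_def)
lemma graded_freeD: "f \<in> graded_free n r s d \<Longrightarrow> k < r \<Longrightarrow> f k \<in> graded_polys n (d - s k)"
  unfolding graded_free_def mem_Collect_eq by metis
lemma graded_freeD0: "f \<in> graded_free n r s d \<Longrightarrow> k \<ge> r \<Longrightarrow> f k = 0"
  unfolding graded_free_def mem_Collect_eq by (metis not_le)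

lemma graded_free_zero: "0 \<in> graded_free n r s d" by (rule graded_freeI) simp_all
lemma graded_free_add: "f \<in> graded_free n r s d \<Longrightarrow> g \<in> graded_free n r s d \<Longrightarrow> f + g \<in> graded_free n r s d"
  by (rule graded_freeI) (simp_all add: graded_polys_add graded_freeD graded_freeD0)
lemma graded_free_uminus: "f \<in> graded_free n r s d \<Longrightarrow> - f \<in> graded_free n r s d"
  by (rule graded_freeI) (simp_all add: graded_polys_uminus graded_freeD graded_freeD0)
lemma graded_free_var_op: assumes "f \<in> graded_free n r s d" "v \<in> {1..n}" shows "var_op v f \<in> graded_free n r s (d + 1)"
proof (rule graded_freeI)
  fix k assume "k < r"
  then show "var_op v f k \<in> graded_polys n (d + 1 - s k)"
    using graded_polys_var_mult[OF assms(2) graded_freeD[OF assms(1)], of k] by (simp add: var_op_def diff_add_eq)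
qed (simp add: var_op_def graded_freeD0[OF assms(1)])

lemma graded_free_graded_submodule: "Koszul.graded_submodule n (graded_free n r s)"
  unfolding Koszul.graded_submodule_def by (simp add: graded_free_zero graded_free_add graded_free_uminus graded_free_var_op)

lemma div_var_zero [simp]: "div_var v 0 = 0"
  by (rule poly_mapping_eqI) simp

lemma graded_free_div_op: assumes "f \<in> graded_free n r s d" shows "div_op v f \<in> graded_free n r s (d - 1)"
proof (rule graded_freeI)
  fix k assume "k < r"
  moreover have "d - 1 - s k = d - s k - 1" by simp
  ultimately show "div_op v f k \<in> graded_polys n (d - 1 - s k)"
    using div_var_graded_polys[OF graded_freeD[OF assms], of k v] by (metis div_op_def)
qed (simp add: div_op_def graded_freeD0[OF assms])

lemma graded_free_exact: "Koszul.exact n (graded_free n r s)"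
  by (rule Koszul.exactI[OF graded_free_graded_submodule graded_free_div_op])

text \<open>Each monomial other than $1$ is assigned to its least variable.\<close>

lemma graded_polys_in_max:
  assumes p: "p \<in> graded_polys n d" and p0: "Poly_Mapping.lookup p 0 = 0"
  shows "\<exists>w. (\<forall>v. w v \<in> graded_polys n (d - 1)) \<and> p = (\<Sum>v\<in>{1..n}. var v * w v)"
proof -
  define q where "q v = restrict_mons (\<lambda>m. m \<noteq> 0 \<and> Min (Poly_Mapping.keys m) = v) p" for v
  have ne: "Poly_Mapping.keys m \<noteq> {}" if "m \<noteq> 0" for m :: "nat \<Rightarrow>\<^sub>0 nat"
    using that keys_eq_0 by blast
  have q: "var v * div_var v (q v) = q v" for v
    by (rule var_div_var) (auto simp: q_def keys_restrict_mons ne intro: Min_in)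
  have "p = (\<Sum>v\<in>{1..n}. q v)"
  proof (rule poly_mapping_eqI)
    fix m
    have "(\<Sum>v\<in>{1..n}. Poly_Mapping.lookup (q v) m) = Poly_Mapping.lookup p m"
    proof (cases "m \<noteq> 0 \<and> m \<in> Poly_Mapping.keys p")
      case True
      then have "Min (Poly_Mapping.keys m) \<in> {1..n}"
        using p ne[of m] Min_in[of "Poly_Mapping.keys m"] finite_keys[of m] unfolding graded_polys_iff by blast
      then show ?thesis using True by (simp add: q_def lookup_restrict_mons)
    next
      case False
      then have "Poly_Mapping.lookup p m = 0" using p0 by (cases "m = 0") (auto simp: in_keys_iff)
      then have "\<forall>v\<in>{1..n}. Poly_Mapping.lookup (q v) m = 0" by (simp add: q_def lookup_restrict_mons)
      then show ?thesis using \<open>Poly_Mapping.lookup p m = 0\<close> by simp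
    qed
    then show "Poly_Mapping.lookup p m = Poly_Mapping.lookup (\<Sum>v\<in>{1..n}. q v) m"
      by (simp add: lookup_sum)
  qed
  moreover have "div_var v (q v) \<in> graded_polys n (d - 1)" for v
    by (rule div_var_graded_polys) (use p in \<open>auto simp: q_def graded_polys_iff keys_restrict_mons\<close>)
  ultimately show ?thesis using q by (intro exI[of _ "\<lambda>v. div_var v (q v)"]) simp
qed

lemma graded_free_in_max:
  assumes f: "f \<in> graded_free n r s d" and f0: "\<And>k. k < r \<Longrightarrow> Poly_Mapping.lookup (f k) 0 = 0"
  shows "\<exists>w. (\<forall>v\<in>{1..n}. w v \<in> graded_free n r s (d - 1)) \<and> f = (\<Sum>v\<in>{1..n}. var_op v (w v))"
proof -
  have "\<exists>w. (\<forall>v. w v \<in> graded_polys n (d - s k - 1)) \<and> f k = (\<Sum>v\<in>{1..n}. var v * w v)" if "k < r" for k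
    using f f0[OF that] that by (intro graded_polys_in_max) (auto simp: graded_free_def)
  then obtain w where w: "\<And>k v. k < r \<Longrightarrow> w k v \<in> graded_polys n (d - s k - 1)"
      "\<And>k. k < r \<Longrightarrow> f k = (\<Sum>v\<in>{1..n}. var v * w k v)" by metis
  let ?w = "\<lambda>v k. if k < r then w k v else 0"
  have "?w v \<in> graded_free n r s (d - 1)" for v 
  proof (intro graded_freeI)
    fix k assume k: "k < r"
    show "?w v k \<in> graded_polys n (d - 1 - s k)" using w(1)[OF k, of v] k by (simp add: algebra_simps)
  qed simp
  moreover have "f k = (\<Sum>v\<in>{1..n}. var_op v (?w v)) k" for k
    using w(2)[of k] graded_freeD0[OF f, of k] by (cases "k < r") (simp_all add: sum_fun_apply var_op_def)
  ultimately show ?thesis by (intro exI[of _ ?w]) (auto simp: fun_eq_iff)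
qed

text \<open>In exterior degree zero, an element all of whose coordinates have positive degree lies in
  $(x_1,\dots,x_n)F$; higher exterior degrees are covered by exactness.\<close>

lemma reg_le_free:
  assumes "\<And>k. k < r \<Longrightarrow> s k \<le> c"
  shows "Koszul.reg_le n (graded_free n r s) c"
  unfolding Koszul.reg_le_def
proof (intro allI impI)
  fix i d and z :: "nat set \<Rightarrow> nat \<Rightarrow> 'a mpoly"
  assume d: "c < d" and z: "Koszul.koszul_chain n i (graded_free n r s d) z" and bz: "Koszul.boundary n z = 0"
  show "\<exists>w. Koszul.koszul_chain n (Suc i) (graded_free n r s (d - 1)) w \<and> Koszul.boundary n w = z"
  proof (cases i)
    case 0
    have zz: "z {} \<in> graded_free n r s d" using z by (simp add: Koszul.koszul_chain_def)
    have "Poly_Mapping.lookup (z {} k) 0 = 0" if "k < r" for k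
      using graded_polys_lookup0[of "z {} k" n "d - s k"] zz that assms[OF that] d by (auto simp: graded_free_def)
    then obtain w where w: "\<forall>v\<in>{1..n}. w v \<in> graded_free n r s (d - 1)" "z {} = (\<Sum>v\<in>{1..n}. var_op v (w v))"
      using graded_free_in_max[OF zz] by blast
    have "Koszul.koszul_chain n 1 (graded_free n r s (d - 1)) (Koszul.linear_chain n w)"
      using Koszul.linear_chain_is_chain[of "graded_free n r s (d - 1)" n w] w(1) Koszul.graded_submodule_zero[OF graded_free_graded_submodule] by blast
    moreover have "Koszul.boundary n (Koszul.linear_chain n w) = z"
    proof
      fix \<tau> show "Koszul.boundary n (Koszul.linear_chain n w) \<tau> = z \<tau>"
        using Koszul.koszul_chain_0_eq[OF z[unfolded 0], of \<tau>] w(2) by (simp add: Koszul.boundary_linear_chain)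
    qed
    ultimately show ?thesis using 0 by (intro exI[of _ "Koszul.linear_chain n w"]) simp
  next
    case (Suc j)
    then show ?thesis using graded_free_exact z bz unfolding Koszul.exact_def by blast
  qed
qed

section \<open>Regularity of squarefree monomial ideals\<close>

text \<open>The piece of degree $d$ of the ideal generated by the squarefree monomials
  $\prod_{i\in G}x_i$ with $G\in\mathcal G$, placed in coordinate $0$. Such an ideal is spanned by
  monomials, and $\prod_{i\in G}x_i$ divides a monomial exactly when $G$ is contained in its
  support.\<close>

definition graded_mon_ideal :: "nat \<Rightarrow> nat set set \<Rightarrow> int \<Rightarrow> (nat \<Rightarrow> ('k::field) mpoly) set" where
  "graded_mon_ideal n \<G> d = {f. f 0 \<in> graded_polys n d \<and> (\<forall>m\<in>Poly_Mapping.keys (f 0). \<exists>G\<in>\<G>. G \<subseteq> Poly_Mapping.keys m)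
      \<and> (\<forall>k>0. f k = 0)}"

lemma graded_mon_ideal_D: "f \<in> graded_mon_ideal n \<G> d \<Longrightarrow> m \<in> Poly_Mapping.keys (f 0) \<Longrightarrow> \<exists>G\<in>\<G>. G \<subseteq> Poly_Mapping.keys m"
  unfolding graded_mon_ideal_def by (elim CollectE conjE) (rule bspec)

lemma graded_mon_ideal_mono:
  assumes "\<G> \<subseteq> \<H>" shows "graded_mon_ideal n \<G> d \<subseteq> graded_mon_ideal n \<H> d"
proof
  fix f :: "nat \<Rightarrow> 'a mpoly" assume f: "f \<in> graded_mon_ideal n \<G> d"
  have "\<exists>H\<in>\<H>. H \<subseteq> Poly_Mapping.keys m" if "m \<in> Poly_Mapping.keys (f 0)" for m
    by (rule bexE[OF graded_mon_ideal_D[OF f that]]) (rule bexI, assumption, erule subsetD[OF assms])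
  then show "f \<in> graded_mon_ideal n \<H> d" using f by (simp add: graded_mon_ideal_def)
qed

lemma graded_mon_ideal_graded_submodule: "Koszul.graded_submodule n (graded_mon_ideal n \<G>)"
proof -
  have "a + b \<in> graded_mon_ideal n \<G> d" if "a \<in> graded_mon_ideal n \<G> d" "b \<in> graded_mon_ideal n \<G> d" for a b :: "nat \<Rightarrow> 'a mpoly" and d
    using that keys_add[of "a 0" "b 0"] unfolding graded_mon_ideal_def mem_Collect_eq plus_fun_apply
    by (intro conjI allI impI graded_polys_add) (blast, blast, blast, simp)
  moreover have "var_op v a \<in> graded_mon_ideal n \<G> (d + 1)" if "a \<in> graded_mon_ideal n \<G> d" "v \<in> {1..n}" for a :: "nat \<Rightarrow> 'a mpoly" and d v
  proof -
    have "\<exists>G\<in>\<G>. G \<subseteq> Poly_Mapping.keys m" if m: "m \<in> Poly_Mapping.keys (var v * a 0)" for m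
    proof -
      obtain x b where b: "b \<in> Poly_Mapping.keys (a 0)" "m = x + b"
        using m keys_mult_E by blast
      then obtain G where "G \<in> \<G>" "G \<subseteq> Poly_Mapping.keys b" using \<open>a \<in> graded_mon_ideal n \<G> d\<close> unfolding graded_mon_ideal_def by blast
      then show ?thesis using b by (intro bexI[of _ G]) (auto simp: keys_exponent_add)
    qed
    then show ?thesis using that by (simp add: graded_mon_ideal_def var_op_def graded_polys_var_mult)
  qed
  moreover have "(0 :: nat \<Rightarrow> 'a mpoly) \<in> graded_mon_ideal n \<G> d" for d by (simp add: graded_mon_ideal_def)
  moreover have "- a \<in> graded_mon_ideal n \<G> d" if "a \<in> graded_mon_ideal n \<G> d" for a :: "nat \<Rightarrow> 'a mpoly" and d
    using that by (simp add: graded_mon_ideal_def graded_polys_uminus keys_uminus)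
  ultimately show ?thesis unfolding Koszul.graded_submodule_def by simp
qed

lemma graded_mon_ideal_empty: "graded_mon_ideal n {} d = {0}"
proof -
  have "f = 0" if "f \<in> graded_mon_ideal n {} d" for f :: "nat \<Rightarrow> 'a mpoly"
  proof
    fix k
    have "Poly_Mapping.keys (f 0) = {}" "\<forall>k>0. f k = 0" using that by (auto simp: graded_mon_ideal_def)
    then show "f k = 0 k" by (cases "k = 0") (auto simp: keys_eq_0)
  qed
  moreover have "0 \<in> graded_mon_ideal n {} d" by (simp add: graded_mon_ideal_def)
  ultimately show ?thesis by blast
qed

lemma reg_le_mon_ideal_empty: "Koszul.reg_le n (graded_mon_ideal n {}) c"
  unfolding Koszul.reg_le_def graded_mon_ideal_empty
proof (intro allI impI)
  fix i and z :: "nat set \<Rightarrow> nat \<Rightarrow> 'a mpoly"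
  assume "Koszul.koszul_chain n i {0} z"
  then have "z = 0" by (auto simp: Koszul.koszul_chain_def fun_eq_iff)
  then show "\<exists>w. Koszul.koszul_chain n (Suc i) {0} w \<and> Koszul.boundary n w = z"
    using Koszul.boundary_zero by (intro exI[of _ 0]) (auto simp: Koszul.koszul_chain_def)
qed

lemma reg_le_mon_ideal_one:
  assumes "{} \<in> \<G>" shows "Koszul.reg_le n (graded_mon_ideal n \<G> :: int \<Rightarrow> (nat \<Rightarrow> ('a::field) mpoly) set) 0"
proof -
  have "(graded_mon_ideal n \<G> d :: (nat \<Rightarrow> 'a mpoly) set) = graded_free n 1 (\<lambda>_. 0) d" for d
    using assms by (auto simp: graded_mon_ideal_def graded_free_def)
  then have "(graded_mon_ideal n \<G> :: int \<Rightarrow> (nat \<Rightarrow> 'a mpoly) set) = graded_free n 1 (\<lambda>_. 0)" by (rule ext)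
  then show ?thesis using reg_le_free[of 1 "\<lambda>_. 0" 0 n] by (simp only:) simp
qed

lemma graded_mon_ideal_Un: "graded_mon_ideal n (\<G> \<union> \<H>) d = {a + b | a b. a \<in> graded_mon_ideal n \<G> d \<and> b \<in> graded_mon_ideal n \<H> d}"
proof (intro equalityI subsetI)
  fix f :: "nat \<Rightarrow> 'a mpoly" assume f: "f \<in> graded_mon_ideal n (\<G> \<union> \<H>) d"
  let ?P = "\<lambda>m. \<exists>G\<in>\<G>. G \<subseteq> Poly_Mapping.keys m"
  let ?a = "\<lambda>k::nat. if k = 0 then restrict_mons ?P (f 0) else 0"
  let ?b = "\<lambda>k::nat. if k = 0 then restrict_mons (\<lambda>m. \<not> ?P m) (f 0) else 0"
  have "restrict_mons ?P (f 0) + restrict_mons (\<lambda>m. \<not> ?P m) (f 0) = f 0"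
    by (rule poly_mapping_eqI) (simp add: lookup_add lookup_restrict_mons)
  then have "f = ?a + ?b" using f by (auto simp: fun_eq_iff graded_mon_ideal_def)
  moreover have "?a \<in> graded_mon_ideal n \<G> d" using f by (auto simp: graded_mon_ideal_def graded_polys_iff keys_restrict_mons)
  moreover have "?b \<in> graded_mon_ideal n \<H> d"
  proof -
    have "\<exists>H\<in>\<H>. H \<subseteq> Poly_Mapping.keys m" if "m \<in> Poly_Mapping.keys (f 0)" "\<not> ?P m" for m
      using graded_mon_ideal_D[OF f that(1)] that(2) by (simp only: bex_Un) simp
    then show ?thesis using f by (simp add: graded_mon_ideal_def graded_polys_iff keys_restrict_mons)
  qed
  ultimately show "f \<in> {a + b | a b. a \<in> graded_mon_ideal n \<G> d \<and> b \<in> graded_mon_ideal n \<H> d}" by blast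
next
  fix f :: "nat \<Rightarrow> 'a mpoly" assume "f \<in> {a + b | a b. a \<in> graded_mon_ideal n \<G> d \<and> b \<in> graded_mon_ideal n \<H> d}"
  then obtain a b where f: "f = a + b" and ab: "a \<in> graded_mon_ideal n \<G> d" "b \<in> graded_mon_ideal n \<H> d" by auto
  have "a \<in> graded_mon_ideal n (\<G> \<union> \<H>) d" "b \<in> graded_mon_ideal n (\<G> \<union> \<H>) d"
    using ab graded_mon_ideal_mono[of \<G> "\<G> \<union> \<H>" n d] graded_mon_ideal_mono[of \<H> "\<G> \<union> \<H>" n d] by auto
  then show "f \<in> graded_mon_ideal n (\<G> \<union> \<H>) d" unfolding f by (rule Koszul.graded_submodule_add[OF graded_mon_ideal_graded_submodule])
qed

text \<open>The least common multiple of two squarefree monomials has the union of their supports as its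
  support.\<close>

lemma graded_mon_ideal_Int: "graded_mon_ideal n \<G> d \<inter> graded_mon_ideal n \<H> d = graded_mon_ideal n {G \<union> H | G H. G \<in> \<G> \<and> H \<in> \<H>} d"
proof (intro equalityI subsetI)
  fix f :: "nat \<Rightarrow> 'a mpoly" assume f: "f \<in> graded_mon_ideal n \<G> d \<inter> graded_mon_ideal n \<H> d"
  have "\<exists>U\<in>{G \<union> H | G H. G \<in> \<G> \<and> H \<in> \<H>}. U \<subseteq> Poly_Mapping.keys m"
    if m0: "m \<in> Poly_Mapping.keys (f 0)" for m
  proof -
    obtain G where G: "G \<in> \<G>" "G \<subseteq> Poly_Mapping.keys m" by (rule bexE[OF graded_mon_ideal_D[OF IntD1[OF f] m0]])
    obtain H where H: "H \<in> \<H>" "H \<subseteq> Poly_Mapping.keys m" by (rule bexE[OF graded_mon_ideal_D[OF IntD2[OF f] m0]])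
    show ?thesis
    proof
      show "G \<union> H \<subseteq> Poly_Mapping.keys m" using G H by simp
      show "G \<union> H \<in> {G \<union> H | G H. G \<in> \<G> \<and> H \<in> \<H>}" using G(1) H(1) by blast
    qed
  qed
  then show "f \<in> graded_mon_ideal n {G \<union> H | G H. G \<in> \<G> \<and> H \<in> \<H>} d" using f by (simp add: graded_mon_ideal_def)
next
  fix f :: "nat \<Rightarrow> 'a mpoly" assume f: "f \<in> graded_mon_ideal n {G \<union> H | G H. G \<in> \<G> \<and> H \<in> \<H>} d"
  have *: "(\<exists>G\<in>\<G>. G \<subseteq> Poly_Mapping.keys m) \<and> (\<exists>H\<in>\<H>. H \<subseteq> Poly_Mapping.keys m)"
    if m0: "m \<in> Poly_Mapping.keys (f 0)" for m
  proof -
    obtain U where "U \<in> {G \<union> H | G H. G \<in> \<G> \<and> H \<in> \<H>}" and U: "U \<subseteq> Poly_Mapping.keys m"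
      by (rule bexE[OF graded_mon_ideal_D[OF f m0]])
    then obtain G H where "U = G \<union> H" "G \<in> \<G>" "H \<in> \<H>" by blast
    then show ?thesis using U by (metis Un_subset_iff)
  qed
  then show "f \<in> graded_mon_ideal n \<G> d \<inter> graded_mon_ideal n \<H> d" using f by (simp add: graded_mon_ideal_def)
qed

lemma graded_mon_ideal_insert:
  assumes v: "v \<in> {1..n}" and \<G>: "\<And>G. G \<in> \<G> \<Longrightarrow> v \<notin> G"
  shows "graded_mon_ideal n (insert v ` \<G>) d = var_op v ` graded_mon_ideal n \<G> (d - 1)"
proof (intro equalityI subsetI)
  fix f :: "nat \<Rightarrow> 'a mpoly" assume f: "f \<in> graded_mon_ideal n (insert v ` \<G>) d"
  have "var v * div_var v (f 0) = f 0" by (rule var_div_var) (use f in \<open>auto simp: graded_mon_ideal_def\<close>)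
  then have "var v * div_var v (f k) = f k" for k using f by (cases "k = 0") (auto simp: graded_mon_ideal_def)
  then have "f = var_op v (div_op v f)" by (simp add: var_op_def div_op_def)
  moreover have "div_op v f \<in> graded_mon_ideal n \<G> (d - 1)"
  proof -
    have "\<exists>G\<in>\<G>. G \<subseteq> Poly_Mapping.keys m" if "m \<in> Poly_Mapping.keys (div_var v (f 0))" for m
    proof -
      have "var_exp v + m \<in> Poly_Mapping.keys (f 0)" using that by (simp add: in_keys_iff)
      then obtain G where "G \<in> \<G>" "insert v G \<subseteq> Poly_Mapping.keys (var_exp v + m)"
        using f unfolding graded_mon_ideal_def by blast
      then show ?thesis using \<G>[of G] by (auto simp: keys_exponent_add)
    qed
    then show ?thesis using f by (auto simp: graded_mon_ideal_def div_op_def div_var_graded_polys)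
  qed
  ultimately show "f \<in> var_op v ` graded_mon_ideal n \<G> (d - 1)" by blast
next
  fix f :: "nat \<Rightarrow> 'a mpoly" assume "f \<in> var_op v ` graded_mon_ideal n \<G> (d - 1)"
  then obtain g where f: "f = var_op v g" and g: "g \<in> graded_mon_ideal n \<G> (d - 1)" by blast
  have "\<exists>G\<in>insert v ` \<G>. G \<subseteq> Poly_Mapping.keys m" if m: "m \<in> Poly_Mapping.keys (var v * g 0)" for m
  proof -
    obtain b where b: "b \<in> Poly_Mapping.keys (g 0)" "m = var_exp v + b"
      using m by (auto elim!: keys_mult_E simp: var_var_exp)
    then obtain G where "G \<in> \<G>" "G \<subseteq> Poly_Mapping.keys b" using g by (auto simp: graded_mon_ideal_def)
    then show ?thesis using b by (intro bexI[of _ "insert v G"]) (auto simp: keys_exponent_add)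
  qed
  moreover have "var v * g 0 \<in> graded_polys n d" using g graded_polys_var_mult[OF v, of "g 0" "d - 1"] by (simp add: graded_mon_ideal_def)
  ultimately show "f \<in> graded_mon_ideal n (insert v ` \<G>) d" using g unfolding f by (simp add: graded_mon_ideal_def var_op_def)
qed

text \<open>Mayer--Vietoris for $I=J+x_vH$, where no generator of $J$ or of $H$ contains $x_v$, so that
  $J\cap x_vH=x_v(J\cap H)$. The bound $c+1$ that is needed for the intersection is the bound $c$
  for $J\cap H$, shifted by the factor $x_v$.\<close>

lemma reg_le_mon_ideal_step:
  assumes v: "v \<in> {1..n}" and v0: "\<And>G. G \<in> \<G> \<Longrightarrow> v \<notin> G" and v1: "\<And>H. H \<in> \<H> \<Longrightarrow> v \<notin> H"
    and 0: "Koszul.reg_le n (graded_mon_ideal n \<G> :: int \<Rightarrow> (nat \<Rightarrow> ('k::field) mpoly) set) c"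
    and 1: "Koszul.reg_le n (graded_mon_ideal n \<H> :: int \<Rightarrow> (nat \<Rightarrow> 'k mpoly) set) (c - 1)"
    and 2: "Koszul.reg_le n (graded_mon_ideal n {G \<union> H | G H. G \<in> \<G> \<and> H \<in> \<H>} :: int \<Rightarrow> (nat \<Rightarrow> 'k mpoly) set) c"
  shows "Koszul.reg_le n (graded_mon_ideal n (\<G> \<union> insert v ` \<H>) :: int \<Rightarrow> (nat \<Rightarrow> 'k mpoly) set) c"
proof -
  let ?M = "\<lambda>\<G>. graded_mon_ideal n \<G> :: int \<Rightarrow> (nat \<Rightarrow> 'k mpoly) set"
  let ?U = "{G \<union> H | G H. G \<in> \<G> \<and> H \<in> \<H>}"
  have e1: "?M (insert v ` \<H>) = (\<lambda>d. var_op v ` ?M \<H> (d - 1))"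
    using graded_mon_ideal_insert[OF v v1] by (rule ext)
  have e2: "?M (insert v ` ?U) = (\<lambda>d. var_op v ` ?M ?U (d - 1))"
    by (rule ext, rule graded_mon_ideal_insert[OF v]) (use v0 v1 in auto)
  have "{G \<union> H | G H. G \<in> \<G> \<and> H \<in> insert v ` \<H>} = insert v ` ?U"
  proof (intro equalityI subsetI)
    fix S assume "S \<in> {G \<union> H | G H. G \<in> \<G> \<and> H \<in> insert v ` \<H>}"
    then obtain G H where "S = G \<union> insert v H" "G \<in> \<G>" "H \<in> \<H>" by blast
    then have "S = insert v (G \<union> H)" "G \<union> H \<in> ?U" by (simp, blast)
    then show "S \<in> insert v ` ?U" by blast
  next
    fix S assume "S \<in> insert v ` ?U"
    then obtain G H where *: "S = insert v (G \<union> H)" "G \<in> \<G>" "H \<in> \<H>" by blast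
    then have "S = G \<union> insert v H" "insert v H \<in> insert v ` \<H>" by (simp, blast)
    then show "S \<in> {G \<union> H | G H. G \<in> \<G> \<and> H \<in> insert v ` \<H>}" using *(2) by blast
  qed
  then have e3: "(\<lambda>d. ?M \<G> d \<inter> ?M (insert v ` \<H>) d) = ?M (insert v ` ?U)"
    by (simp add: graded_mon_ideal_Int fun_eq_iff)
  have "Koszul.reg_le n (?M (insert v ` \<H>)) c"
    unfolding e1 using Koszul.reg_le_shift[OF 1 inj_var_op, of v] by simp
  moreover have "Koszul.reg_le n (?M (insert v ` ?U)) (c + 1)"
    unfolding e2 using Koszul.reg_le_shift[OF 2 inj_var_op, of v] by simp
  ultimately have "Koszul.reg_le n (\<lambda>d. {a + b | a b. a \<in> ?M \<G> d \<and> b \<in> ?M (insert v ` \<H>) d}) c"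
    using Koszul.reg_le_sum[OF graded_mon_ideal_graded_submodule graded_mon_ideal_graded_submodule 0, of "insert v ` \<H>"] unfolding e3 by blast
  moreover have "(\<lambda>d. {a + b | a b. a \<in> ?M \<G> d \<and> b \<in> ?M (insert v ` \<H>) d}) = ?M (\<G> \<union> insert v ` \<H>)"
    by (rule ext) (rule graded_mon_ideal_Un[symmetric])
  ultimately show ?thesis by simp
qed

lemma split_family:
  "\<G> = {G \<in> \<G>. v \<notin> G} \<union> insert v ` ((\<lambda>G. G - {v}) ` {G \<in> \<G>. v \<in> G})"
  by (auto simp: insert_absorb image_image)

text \<open>Each variable costs at most one: if the bound holds for the generators without $x_v$, for the
  quotients by $x_v$ of the others, and for their pairwise least common multiples, then
  \<open>reg_le_mon_ideal_step\<close> gives the bound for all generators together. Without variables the ideal is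
  zero or the whole ring.\<close>

lemma reg_le_squarefree:
  assumes "finite W" "W \<subseteq> {1..n}" "\<G> \<subseteq> Pow W"
  shows "Koszul.reg_le n (graded_mon_ideal n \<G> :: int \<Rightarrow> (nat \<Rightarrow> ('k::field) mpoly) set) (int (card W))"
  using assms
proof (induction W arbitrary: \<G> rule: finite_induct)
  case empty
  then have "\<G> = {} \<or> {} \<in> \<G>" by (auto simp: subset_singleton_iff)
  then show ?case using reg_le_mon_ideal_empty reg_le_mon_ideal_one by auto
next
  case (insert v W)
  let ?\<G> = "{G \<in> \<G>. v \<notin> G}" and ?\<H> = "(\<lambda>G. G - {v}) ` {G \<in> \<G>. v \<in> G}"
  have P: "?\<G> \<subseteq> Pow W" "?\<H> \<subseteq> Pow W" using insert.prems(2) by auto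
  then have "{G \<union> H | G H. G \<in> ?\<G> \<and> H \<in> ?\<H>} \<subseteq> Pow W" by blast
  note IH = insert.IH[OF _ P(1)] insert.IH[OF _ P(2)] insert.IH[OF _ this]
  have W: "W \<subseteq> {1..n}" and c: "int (card (insert v W)) = int (card W) + 1"
    using insert by auto
  have "Koszul.reg_le n (graded_mon_ideal n (?\<G> \<union> insert v ` ?\<H>) :: int \<Rightarrow> (nat \<Rightarrow> 'k mpoly) set) (int (card W) + 1)"
  proof (rule reg_le_mon_ideal_step)
    show "v \<in> {1..n}" using insert by auto
    show "Koszul.reg_le n (graded_mon_ideal n ?\<H> :: int \<Rightarrow> (nat \<Rightarrow> 'k mpoly) set) (int (card W) + 1 - 1)"
      using IH(2)[OF W] by simp
  qed (use IH(1)[OF W] IH(3)[OF W] in \<open>auto intro: Koszul.reg_le_mono\<close>)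
  then show ?case unfolding c split_family[of \<G> v, symmetric] .
qed

text \<open>A generator that contains $v\in A$ contains no other variable of $A$, so division by $x_v$ leaves a
  monomial in the variables outside $A$, and \<open>reg_le_squarefree\<close> applies with $|W|-|A|$ variables.
  The other generators, and their least common multiples with such quotients, live in
  $W\setminus\{v\}$ and contain at most one variable from $A\setminus\{v\}$, so the induction
  hypothesis covers both.\<close>

lemma reg_le_transversal:
  assumes "finite A" "A \<noteq> {}" "A \<subseteq> W" "W \<subseteq> {1..n}" "\<G> \<subseteq> Pow W"
    and "\<And>G. G \<in> \<G> \<Longrightarrow> card (G \<inter> A) \<le> 1"
  shows "Koszul.reg_le n (graded_mon_ideal n \<G> :: int \<Rightarrow> (nat \<Rightarrow> ('k::field) mpoly) set) (int (card W) - int (card A) + 1)"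
  using assms
proof (induction A arbitrary: W \<G> rule: finite_ne_induct)
  case (singleton x)
  then show ?case using reg_le_squarefree[of W n \<G>] finite_subset[of W "{1..n}"] by simp
next
  case (insert v A)
  let ?\<G> = "{G \<in> \<G>. v \<notin> G}" and ?\<H> = "(\<lambda>G. G - {v}) ` {G \<in> \<G>. v \<in> G}"
  let ?W = "W - {v}"
  have finW: "finite W" using insert.prems(2) finite_subset by blast
  have HA: "H \<inter> A = {}" if "H \<in> ?\<H>" for H
  proof -
    obtain G where G: "G \<in> \<G>" "v \<in> G" "H = G - {v}" using \<open>H \<in> ?\<H>\<close> by blast
    have "card (G \<inter> insert v A) \<le> 1" using insert.prems(4) G by blast
    moreover have "finite (G \<inter> insert v A)" using insert.hyps by auto
    ultimately have "x = v" if "x \<in> G \<inter> insert v A" for x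
      using that G(2) by (auto simp: card_le_Suc0_iff_eq)
    then show ?thesis using G insert.hyps by auto
  qed
  have GA: "card (G \<inter> A) \<le> 1" if "G \<in> ?\<G>" for G
  proof -
    have "G \<inter> insert v A = G \<inter> A" using that by auto
    then show ?thesis using insert.prems(4)[of G] that by auto
  qed
  have P: "?\<G> \<subseteq> Pow ?W" "?\<H> \<subseteq> Pow ?W" using insert.prems(3) by auto
  have PH: "?\<H> \<subseteq> Pow (W - insert v A)" 
  proof
    fix H assume H: "H \<in> ?\<H>"
    have "H \<subseteq> W - {v}" using subsetD[OF P(2) H] by simp
    then show "H \<in> Pow (W - insert v A)" using HA[OF H] by blast
  qed
  have PU: "{G \<union> H | G H. G \<in> ?\<G> \<and> H \<in> ?\<H>} \<subseteq> Pow ?W" using P by blast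
  have UA: "card (G \<inter> A) \<le> 1" if "G \<in> {G \<union> H | G H. G \<in> ?\<G> \<and> H \<in> ?\<H>}" for G
  proof -
    obtain G' H where *: "G = G' \<union> H" "G' \<in> ?\<G>" "H \<in> ?\<H>" using \<open>G \<in> _\<close> by blast
    then have "G \<inter> A = G' \<inter> A" using HA[OF *(3)] by auto
    then show ?thesis using GA[OF *(2)] by simp
  qed
  have AW: "A \<subseteq> ?W" "?W \<subseteq> {1..n}" using insert.prems insert.hyps by auto
  have cW: "int (card ?W) = int (card W) - 1"
  proof -
    have "v \<in> W" using insert.prems(1) by simp
    then have "card W = Suc (card (W - {v}))" using finW by (metis card.remove)
    then show ?thesis by simp
  qed
  have cA: "int (card (insert v A)) = int (card A) + 1" using insert.hyps by simp
  have "card (insert v A) \<le> card W" using insert.prems(1) finW by (rule card_mono[rotated])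
  then have cH: "int (card (W - insert v A)) = int (card W) - int (card A) - 1"
    using insert.prems(1) insert.hyps finW by (simp add: card_Diff_subset)
  let ?c = "int (card W) - int (card A)"
  have 0: "Koszul.reg_le n (graded_mon_ideal n ?\<G> :: int \<Rightarrow> (nat \<Rightarrow> 'k mpoly) set) ?c"
    using insert.IH[OF AW P(1) GA] cW by simp
  have 1: "Koszul.reg_le n (graded_mon_ideal n ?\<H> :: int \<Rightarrow> (nat \<Rightarrow> 'k mpoly) set) (?c - 1)"
    using reg_le_squarefree[of "W - insert v A" n ?\<H>] finW PH insert.prems(2) cH by auto
  have 2: "Koszul.reg_le n (graded_mon_ideal n {G \<union> H | G H. G \<in> ?\<G> \<and> H \<in> ?\<H>} :: int \<Rightarrow> (nat \<Rightarrow> 'k mpoly) set) ?c"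
    using insert.IH[OF AW PU UA] cW by simp
  have v: "v \<in> {1..n}" using insert.prems by auto
  have "Koszul.reg_le n (graded_mon_ideal n (?\<G> \<union> insert v ` ?\<H>) :: int \<Rightarrow> (nat \<Rightarrow> 'k mpoly) set) ?c"
    by (rule reg_le_mon_ideal_step[OF v _ _ 0 1 2]) auto
  then show ?case unfolding split_family[of \<G> v, symmetric] cA by simp
qed

section \<open>Minimal covers by free modules\<close>


definition poly_scale :: "('k::field) mpoly \<Rightarrow> (nat \<Rightarrow> 'k mpoly) \<Rightarrow> nat \<Rightarrow> 'k mpoly" where
  "poly_scale p f = (\<lambda>k. p * f k)"

lemma poly_scale_add_left: "poly_scale (p + q) f = poly_scale p f + poly_scale q f" by (simp add: poly_scale_def fun_eq_iff distrib_right)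
lemma poly_scale_add_right: "poly_scale p (f + g) = poly_scale p f + poly_scale p g" by (simp add: poly_scale_def fun_eq_iff distrib_left)
lemma poly_scale_poly_scale: "poly_scale p (poly_scale q f) = poly_scale (p * q) f" by (simp add: poly_scale_def fun_eq_iff mult.assoc)
lemma poly_scale_one [simp]: "poly_scale 1 f = f" by (simp add: poly_scale_def)
lemma poly_scale_zero_left [simp]: "poly_scale 0 f = 0" by (simp add: poly_scale_def fun_eq_iff)
lemma poly_scale_zero_right [simp]: "poly_scale p 0 = 0" by (simp add: poly_scale_def fun_eq_iff)
lemma poly_scale_uminus_left: "poly_scale (- p) f = - poly_scale p f" by (simp add: poly_scale_def fun_eq_iff)
lemma poly_scale_sum_left: "poly_scale (sum p A) f = (\<Sum>a\<in>A. poly_scale (p a) f)"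
  by (induction A rule: infinite_finite_induct) (simp_all only: poly_scale_zero_left poly_scale_add_left sum.infinite sum.empty sum.insert not_False_eq_True)
lemma poly_scale_sum_right: "poly_scale p (sum f A) = (\<Sum>a\<in>A. poly_scale p (f a))"
  by (induction A rule: infinite_finite_induct) (simp_all only: poly_scale_zero_right poly_scale_add_right sum.infinite sum.empty sum.insert not_False_eq_True)
lemma var_op_poly_scale: "var_op v f = poly_scale (var v) f" by (simp add: var_op_def poly_scale_def)

text \<open>Unlike \<open>graded_submodule\<close>, closed under multiplication by all homogeneous polynomials and in
  particular by scalars; this is what generation by finitely many elements refers to.\<close>

definition poly_submodule :: "nat \<Rightarrow> (int \<Rightarrow> (nat \<Rightarrow> ('k::field) mpoly) set) \<Rightarrow> bool" where
  "poly_submodule n N \<longleftrightarrow> (\<forall>d. 0 \<in> N d \<and> (\<forall>f\<in>N d. \<forall>g\<in>N d. f + g \<in> N d)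
     \<and> (\<forall>f\<in>N d. \<forall>e. \<forall>p\<in>graded_polys n e. poly_scale p f \<in> N (d + e)))"

lemma poly_submodule_zero: "poly_submodule n N \<Longrightarrow> 0 \<in> N d" unfolding poly_submodule_def by metis
lemma poly_submodule_add: "poly_submodule n N \<Longrightarrow> f \<in> N d \<Longrightarrow> g \<in> N d \<Longrightarrow> f + g \<in> N d"
  unfolding poly_submodule_def by metis
lemma poly_submodule_poly_scale: "poly_submodule n N \<Longrightarrow> f \<in> N d \<Longrightarrow> p \<in> graded_polys n e \<Longrightarrow> poly_scale p f \<in> N (d + e)"
  unfolding poly_submodule_def by metis
lemma poly_submodule_sum: "poly_submodule n N \<Longrightarrow> (\<And>a. a \<in> A \<Longrightarrow> f a \<in> N d) \<Longrightarrow> sum f A \<in> N d"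
  by (induction A rule: infinite_finite_induct) (simp_all add: poly_submodule_zero poly_submodule_add)
lemma poly_submodule_graded:
  assumes "poly_submodule n N" shows "Koszul.graded_submodule n N"
proof -
  have "- f \<in> N d" if "f \<in> N d" for f d
  proof -
    have "poly_scale (Poly_Mapping.single 0 (- 1)) f = - f"
      by (simp add: poly_scale_uminus_left single_uminus)
    then show ?thesis using poly_submodule_poly_scale[OF assms that graded_polys_const[of "- 1"]] by simp
  qed
  moreover have "var_op v f \<in> N (d + 1)" if "f \<in> N d" "v \<in> {1..n}" for f d v
    unfolding var_op_poly_scale by (rule poly_submodule_poly_scale[OF assms that(1) graded_polys_var[OF that(2)]])
  ultimately show ?thesis
    unfolding Koszul.graded_submodule_def using poly_submodule_zero[OF assms] poly_submodule_add[OF assms] by blast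
qed

lemma graded_free_poly_scale: assumes "f \<in> graded_free n r s d" "p \<in> graded_polys n e" shows "poly_scale p f \<in> graded_free n r s (d + e)"
proof (rule graded_freeI)
  fix k assume "k < r"
  then have "p * f k \<in> graded_polys n (e + (d - s k))" by (intro graded_polys_mult assms(2) graded_freeD[OF assms(1)])
  then show "poly_scale p f k \<in> graded_polys n (d + e - s k)" by (simp add: poly_scale_def algebra_simps)
qed (simp add: poly_scale_def graded_freeD0[OF assms(1)])

definition mat_map :: "nat \<Rightarrow> nat \<Rightarrow> (nat \<Rightarrow> nat \<Rightarrow> ('k::field) mpoly) \<Rightarrow> (nat \<Rightarrow> 'k mpoly) \<Rightarrow> nat \<Rightarrow> 'k mpoly" where
  "mat_map r r' D w = (\<lambda>l. if l < r then \<Sum>k<r'. D l k * w k else 0)"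

lemma mat_map_add: "mat_map r r' D (v + w) = mat_map r r' D v + mat_map r r' D w"
  by (simp add: mat_map_def fun_eq_iff distrib_left sum.distrib)
lemma mat_map_zero [simp]: "mat_map r r' D 0 = 0"
  by (simp add: mat_map_def fun_eq_iff)
lemma mat_map_sum: "mat_map r r' D (sum f A) = (\<Sum>a\<in>A. mat_map r r' D (f a))"
  by (induction A rule: infinite_finite_induct) (simp_all only: mat_map_zero mat_map_add sum.infinite sum.empty sum.insert not_False_eq_True)
lemma mat_map_poly_scale: "mat_map r r' D (poly_scale p w) = poly_scale p (mat_map r r' D w)"
  by (simp add: mat_map_def poly_scale_def fun_eq_iff sum_distrib_left mult.left_commute)
lemma mat_map_var_op: "mat_map r r' D (var_op v w) = var_op v (mat_map r r' D w)"
  by (simp add: var_op_poly_scale mat_map_poly_scale)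

definition graded_matrix :: "nat \<Rightarrow> nat \<Rightarrow> (nat \<Rightarrow> int) \<Rightarrow> nat \<Rightarrow> (nat \<Rightarrow> int) \<Rightarrow> (nat \<Rightarrow> nat \<Rightarrow> ('k::field) mpoly) \<Rightarrow> bool" where
  "graded_matrix n r s r' s' D \<longleftrightarrow> (\<forall>l<r. \<forall>k<r'. D l k \<in> graded_polys n (s' k - s l))"

lemma mat_map_graded_free:
  assumes "graded_matrix n r s r' s' D" "w \<in> graded_free n r' s' d" shows "mat_map r r' D w \<in> graded_free n r s d"
proof (rule graded_freeI)
  fix l assume l: "l < r"
  have "D l k * w k \<in> graded_polys n (d - s l)" if "k < r'" for k
    using graded_polys_mult[of "D l k" n "s' k - s l" "w k" "d - s' k"] assms l that graded_freeD[OF assms(2) that]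
    by (simp add: graded_matrix_def)
  then show "mat_map r r' D w l \<in> graded_polys n (d - s l)" using l by (auto simp: mat_map_def intro!: graded_polys_sum)
qed (simp add: mat_map_def)

definition graded_kernel :: "nat \<Rightarrow> nat \<Rightarrow> nat \<Rightarrow> (nat \<Rightarrow> int) \<Rightarrow> (nat \<Rightarrow> nat \<Rightarrow> ('k::field) mpoly) \<Rightarrow> int \<Rightarrow> (nat \<Rightarrow> 'k mpoly) set" where
  "graded_kernel n r r' s' D = (\<lambda>d. {w \<in> graded_free n r' s' d. mat_map r r' D w = 0})"

lemma graded_kernel_poly_submodule: "poly_submodule n (graded_kernel n r r' s' D)"
  unfolding poly_submodule_def graded_kernel_def by (simp add: graded_free_zero graded_free_add graded_free_poly_scale mat_map_add mat_map_poly_scale)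

text \<open>A graded map onto $N$ from a free module, whose kernel lies in $(x_1,\dots,x_n)$ times that free
  module. Minimality is stated for the kernel and not for the next matrix, so that it makes sense
  for one step at a time.\<close>

definition minimal_cover where
  "minimal_cover n r s N r' s' D \<longleftrightarrow> graded_matrix n r s r' s' D \<and> (\<forall>d. mat_map r r' D ` graded_free n r' s' d = N d) \<and>
     (\<forall>d. \<forall>w\<in>graded_kernel n r r' s' D d. \<forall>k<r'. Poly_Mapping.lookup (w k) 0 = 0)"

lemma reg_le_graded_kernel:
  assumes "minimal_cover n r s N r' s' D" "Koszul.reg_le n N c"
  shows "Koszul.reg_le n (graded_kernel n r r' s' D) (c + 1)"
  unfolding graded_kernel_def
proof (rule Koszul.reg_le_kernel[OF graded_free_graded_submodule graded_free_exact mat_map_add mat_map_var_op _ assms(2)])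
  show "mat_map r r' D ` graded_free n r' s' d = N d" for d using assms(1) by (simp add: minimal_cover_def)
  fix d f assume "f \<in> graded_free n r' s' d" "mat_map r r' D f = 0"
  then show "\<exists>w. (\<forall>v\<in>{1..n}. w v \<in> graded_free n r' s' (d - 1)) \<and> f = (\<Sum>v\<in>{1..n}. var_op v (w v))"
    using assms(1) by (intro graded_free_in_max) (auto simp: minimal_cover_def graded_kernel_def)
qed

definition basis_fun :: "nat \<Rightarrow> nat \<Rightarrow> ('k::field) mpoly" where
  "basis_fun k = (\<lambda>j. if j = k then 1 else 0)"

lemma basis_fun_graded_free: "k < r \<Longrightarrow> basis_fun k \<in> graded_free n r s (s k)"
  using graded_polys_const[of 1 n] by (auto simp: basis_fun_def intro!: graded_freeI)

text \<open>The difference of $e_k$ and $y$ lies in the kernel, hence has no constant terms.\<close>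

lemma minimal_cover_basis_not_in_max:
  assumes "minimal_cover n r s N r' s' D" "k < r'" "y \<in> graded_free n r' s' (s' k)"
    and "mat_map r r' D y = mat_map r r' D (basis_fun k)"
  shows "Poly_Mapping.lookup (y k) 0 = 1"
proof -
  let ?w = "basis_fun k - y"
  have "?w \<in> graded_free n r' s' (s' k)" using Koszul.graded_submodule_diff[OF graded_free_graded_submodule basis_fun_graded_free[OF assms(2)] assms(3)] .
  moreover have "mat_map r r' D ?w = 0"
    using mat_map_add[of r r' D ?w y] assms(4) by simp
  ultimately have "?w \<in> graded_kernel n r r' s' D (s' k)" unfolding graded_kernel_def by blast
  then have "Poly_Mapping.lookup (?w k) 0 = 0"
    using assms(1,2) unfolding minimal_cover_def by blast
  then show ?thesis by (simp add: basis_fun_def lookup_minus)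
qed

text \<open>If the degree of $e_k$ exceeded $c$, its image in $N$ would be a combination
  $\sum_vx_vw_v$ of elements of $N$, and lifting the $w_v$ would give a preimage
  $y\in(x_1,\dots,x_n)F$ of the image of $e_k$.\<close>

lemma minimal_cover_shift_le:
  assumes mc: "minimal_cover n r s N r' s' D" and N: "Koszul.reg_le n N c" "Koszul.graded_submodule n N" and k: "k < r'"
  shows "s' k \<le> c"
proof (rule ccontr)
  assume c: "\<not> s' k \<le> c"
  have im: "mat_map r r' D ` graded_free n r' s' d = N d" for d using mc by (simp add: minimal_cover_def)
  have uN: "mat_map r r' D (basis_fun k) \<in> N (s' k)" using im[of "s' k"] basis_fun_graded_free[OF k] by blast
  have c': "c < s' k" using c by simp
  obtain w where w: "\<And>v. v \<in> {1..n} \<Longrightarrow> w v \<in> N (s' k - 1)"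
      "mat_map r r' D (basis_fun k) = (\<Sum>v\<in>{1..n}. var_op v (w v))"
    by (rule Koszul.reg_le_generated[OF N(1) c' uN N(2)]) blast
  have "\<forall>v\<in>{1..n}. \<exists>y. y \<in> graded_free n r' s' (s' k - 1) \<and> w v = mat_map r r' D y"
    using w(1) im by blast
  then obtain y where y: "\<And>v. v \<in> {1..n} \<Longrightarrow> y v \<in> graded_free n r' s' (s' k - 1)"
     "\<And>v. v \<in> {1..n} \<Longrightarrow> w v = mat_map r r' D (y v)" by metis
  let ?y = "\<Sum>v\<in>{1..n}. var_op v (y v)"
  have "?y \<in> graded_free n r' s' (s' k)"
    by (rule Koszul.graded_submodule_sum[OF graded_free_graded_submodule]) (use graded_free_var_op[OF y(1)] in auto)
  moreover have "mat_map r r' D ?y = mat_map r r' D (basis_fun k)"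
    using y(2) w(2) by (simp add: mat_map_sum mat_map_var_op)
  ultimately have "Poly_Mapping.lookup (?y k) 0 = 1" by (rule minimal_cover_basis_not_in_max[OF mc k])
  moreover have "Poly_Mapping.lookup (?y k) 0 = 0"
    by (simp add: sum_fun_apply lookup_sum var_op_def lookup_var_mult_0)
  ultimately show False by simp
qed

lemma minimal_cover_nonzero_column:
  assumes mc: "minimal_cover n r s N r' s' D" and k: "k < r'"
  obtains l where "l < r" "D l k \<noteq> 0"
proof -
  have "\<exists>l<r. D l k \<noteq> 0"
  proof (rule ccontr)
    assume *: "\<not> (\<exists>l<r. D l k \<noteq> 0)"
    have "mat_map r r' D (basis_fun k) = mat_map r r' D 0"
    proof
      fix l
      have "(\<Sum>j<r'. D l j * basis_fun k j) = 0" if "l < r"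
        using * that by (intro sum.neutral) (auto simp: basis_fun_def)
      then show "mat_map r r' D (basis_fun k) l = mat_map r r' D 0 l" by (simp add: mat_map_def)
    qed
    then have "Poly_Mapping.lookup ((0 :: nat \<Rightarrow> 'a mpoly) k) 0 = 1"
      using minimal_cover_basis_not_in_max[OF mc k graded_free_zero] by metis
    then show False by simp
  qed
  then show thesis using that by blast
qed

lemma mat_map_basis_fun: "l < r \<Longrightarrow> k < r' \<Longrightarrow> mat_map r r' D (basis_fun k) l = D l k"
  by (simp add: mat_map_def basis_fun_def if_distrib[of "(*) _"] cong: if_cong)

section \<open>Existence of minimal covers\<close>

definition field_scale :: "'k::field \<Rightarrow> (nat \<Rightarrow> 'k mpoly) \<Rightarrow> nat \<Rightarrow> 'k mpoly" where
  "field_scale c = poly_scale (Poly_Mapping.single 0 c)"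

interpretation V: vector_space field_scale
  by unfold_locales
    (simp_all add: field_scale_def poly_scale_add_right poly_scale_add_left[symmetric] single_add poly_scale_poly_scale mult_single)

lemma finite_monomials: "finite {m. Poly_Mapping.keys m \<subseteq> {1..n} \<and> mon_degree m = e}"
proof -
  let ?M = "{m. Poly_Mapping.keys m \<subseteq> {1..n} \<and> mon_degree m = e}"
  have "Poly_Mapping.lookup m i \<le> e" if "m \<in> ?M" "i \<in> {1..n}" for m i
  proof -
    have "mon_degree m = (\<Sum>i\<in>{1..n}. Poly_Mapping.lookup m i)"
      using that by (intro mon_degree_superset) auto
    moreover have "Poly_Mapping.lookup m i \<le> (\<Sum>i\<in>{1..n}. Poly_Mapping.lookup m i)"
      using that by (intro member_le_sum) auto
    ultimately show ?thesis using that by simp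
  qed
  moreover have "Poly_Mapping.lookup m i = 0" if "m \<in> ?M" "i \<notin> {1..n}" for m i
    using that by (auto simp: in_keys_iff)
  ultimately have "Poly_Mapping.lookup ` ?M \<subseteq>
      {f. \<forall>i. (i \<in> {1..n} \<longrightarrow> f i \<in> {0..e}) \<and> (i \<notin> {1..n} \<longrightarrow> f i = 0)}" by auto
  then have "finite (Poly_Mapping.lookup ` ?M)"
    by (rule finite_subset) (intro finite_set_of_finite_funs, simp_all)
  then show ?thesis by (rule finite_imageD) (simp add: inj_on_def poly_mapping.lookup_inject)
qed

lemma finite_graded_monomials: "finite {m. Poly_Mapping.keys m \<subseteq> {1..n} \<and> int (mon_degree m) = d}"
  by (rule finite_subset[OF _ finite_monomials[of n "nat d"]]) auto

lemma poly_expand: "p = (\<Sum>m\<in>Poly_Mapping.keys p. Poly_Mapping.single m (Poly_Mapping.lookup p m))"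
  by (rule poly_mapping_eqI) (simp add: lookup_sum lookup_single when_def in_keys_iff)

text \<open>The monomials in the coordinates form a basis, and only finitely many monomials have a given
  degree.\<close>

lemma graded_free_finite_span: "\<exists>T. finite T \<and> graded_free n r s d \<subseteq> V.span T"
proof -
  let ?M = "\<lambda>k. {m. Poly_Mapping.keys m \<subseteq> {1..n} \<and> int (mon_degree m) = d - s k}"
  let ?t = "\<lambda>k m j. if j = k then Poly_Mapping.single m 1 else (0 :: 'a mpoly)"
  let ?T = "\<Union>k\<in>{..<r}. ?t k ` ?M k"
  have "f \<in> V.span ?T" if f: "f \<in> graded_free n r s d" for f
  proof -
    have "f = (\<Sum>k<r. \<Sum>m\<in>Poly_Mapping.keys (f k). field_scale (Poly_Mapping.lookup (f k) m) (?t k m))"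
    proof
      fix j
      have "(\<Sum>k<r. \<Sum>m\<in>Poly_Mapping.keys (f k). field_scale (Poly_Mapping.lookup (f k) m) (?t k m)) j
        = (\<Sum>k<r. \<Sum>m\<in>Poly_Mapping.keys (f k). if j = k then Poly_Mapping.single m (Poly_Mapping.lookup (f k) m) else 0)"
        unfolding sum_fun_apply by (intro sum.cong refl) (simp add: field_scale_def poly_scale_def mult_single)
      also have "\<dots> = (\<Sum>k<r. if j = k then f k else 0)"
        by (intro sum.cong refl) (simp add: poly_expand[symmetric])
      also have "\<dots> = f j" using graded_freeD0[OF f, of j] by simp
      finally show "f j = (\<Sum>k<r. \<Sum>m\<in>Poly_Mapping.keys (f k). field_scale (Poly_Mapping.lookup (f k) m) (?t k m)) j" ..
    qed
    moreover have "?t k m \<in> ?T" if "k < r" "m \<in> Poly_Mapping.keys (f k)" for k m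
    proof -
      have "m \<in> ?M k" using graded_freeD[OF f that(1)] that(2) by (simp add: graded_polys_iff)
      then show ?thesis using that(1) by blast
    qed
    ultimately show ?thesis
      by (metis (no_types, lifting) V.span_sum V.span_scale V.span_base lessThan_iff)
  qed
  moreover have "finite ?T" using finite_graded_monomials by blast
  ultimately show ?thesis by blast
qed

lemma graded_piece_basis:
  fixes N :: "int \<Rightarrow> (nat \<Rightarrow> ('k::field) mpoly) set"
  assumes "N d \<subseteq> graded_free n r s d"
  obtains B where "finite B" "B \<subseteq> N d" "N d \<subseteq> V.span B"
proof -
  obtain B where B: "B \<subseteq> N d" "V.independent B" "N d \<subseteq> V.span B"
    by (rule V.maximal_independent_subset[of "N d"]) blast
  obtain T :: "(nat \<Rightarrow> 'k mpoly) set" where T: "finite T" "graded_free n r s d \<subseteq> V.span T"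
    using graded_free_finite_span[of n r s d] by blast
  have "B \<subseteq> V.span T" using B(1) assms T(2) by (meson order_trans)
  then have "finite B" using V.independent_span_bound[OF T(1) B(2)] by simp
  then show thesis using that B by blast
qed

definition generates :: "nat \<Rightarrow> (int \<times> (nat \<Rightarrow> ('k::field) mpoly)) set \<Rightarrow> (int \<Rightarrow> (nat \<Rightarrow> 'k mpoly) set) \<Rightarrow> bool" where
  "generates n P N \<longleftrightarrow> finite P \<and> (\<forall>p\<in>P. snd p \<in> N (fst p)) \<and>
     (\<forall>d. \<forall>f\<in>N d. \<exists>w. (\<forall>p\<in>P. w p \<in> graded_polys n (d - fst p)) \<and> f = (\<Sum>p\<in>P. poly_scale (w p) (snd p)))"

text \<open>Bases of the finitely many nonzero pieces of degree at most $c$ suffice: below the least shift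
  the pieces vanish, and above $c$ the Koszul bound expresses every element through the variables
  and elements of one degree less.\<close>

lemma finitely_generated:
  assumes N: "poly_submodule n N" "\<And>d. N d \<subseteq> graded_free n r s d" and c: "Koszul.reg_le n N c"
  shows "\<exists>P. generates n P N"
proof -
  (* Below lo all pieces vanish; this starts the induction on the degree. *)
  obtain lo :: int where lo: "\<And>k. k < r \<Longrightarrow> lo \<le> s k"
    using Min_le[of "s ` {..<r}"] by (metis finite_imageI finite_lessThan image_eqI lessThan_iff)
  have low: "f = 0" if "f \<in> N d" "d < lo" for f d
  proof
    fix k
    have f: "f \<in> graded_free n r s d" using that N(2) by blast
    show "f k = 0 k" using graded_polys_neg[OF graded_freeD[OF f]] lo[of k] graded_freeD0[OF f] that(2) by (cases "k < r") fastforce+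
  qed
  have "\<exists>B. finite B \<and> B \<subseteq> N d \<and> N d \<subseteq> V.span B" for d
    by (rule graded_piece_basis[of N d n r s, OF N(2)]) blast
  then obtain B where B: "\<And>d. finite (B d)" "\<And>d. B d \<subseteq> N d" "\<And>d. N d \<subseteq> V.span (B d)" by metis
  let ?P = "SIGMA d:{lo..c}. B d"
  have "\<exists>w. (\<forall>p\<in>?P. w p \<in> graded_polys n (d - fst p)) \<and> f = (\<Sum>p\<in>?P. poly_scale (w p) (snd p))"
    if "f \<in> N d" for f d
    using that
  proof (induction "nat (d - lo)" arbitrary: f d rule: less_induct)
    case less
    consider "d < lo" | "lo \<le> d" "d \<le> c" | "lo \<le> d" "c < d" by linarith
    then show ?case
    proof cases
      case 1
      then show ?thesis using low[OF less.prems] by (intro exI[of _ "\<lambda>_. 0"]) simp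
    next
      case 2
      have "f \<in> V.span (B d)" using B(3) less.prems by blast
      then obtain u where u: "f = (\<Sum>b\<in>B d. field_scale (u b) b)"
        using V.span_finite[OF B(1)] by auto
      let ?w = "\<lambda>p. if fst p = d then Poly_Mapping.single 0 (u (snd p)) else 0"
      have "(\<Sum>p\<in>?P. poly_scale (?w p) (snd p)) = (\<Sum>e\<in>{lo..c}. \<Sum>b\<in>B e. poly_scale (?w (e, b)) b)"
      proof -
        have "(\<Sum>p\<in>?P. poly_scale (?w p) (snd p)) = (\<Sum>(e, b)\<in>?P. poly_scale (?w (e, b)) b)"
          by (rule sum.cong[OF refl]) auto
        also have "\<dots> = (\<Sum>e\<in>{lo..c}. \<Sum>b\<in>B e. poly_scale (?w (e, b)) b)"
          by (rule sum.Sigma[symmetric]) (simp_all add: B(1))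
        finally show ?thesis .
      qed
      also have "\<dots> = (\<Sum>e\<in>{lo..c}. if e = d then f else 0)"
        by (intro sum.cong refl) (simp add: u field_scale_def)
      also have "\<dots> = f" using 2 by simp
      finally have "f = (\<Sum>p\<in>?P. poly_scale (?w p) (snd p))" ..
      moreover have "\<forall>p\<in>?P. ?w p \<in> graded_polys n (d - fst p)" by (simp add: graded_polys_const)
      ultimately show ?thesis by (intro exI[of _ ?w] conjI)
    next
      case 3
      obtain g where g: "\<And>v. v \<in> {1..n} \<Longrightarrow> g v \<in> N (d - 1)" "f = (\<Sum>v\<in>{1..n}. var_op v (g v))"
        by (rule Koszul.reg_le_generated[OF c 3(2) less.prems poly_submodule_graded[OF N(1)]]) blast
      have "\<exists>w. (\<forall>p\<in>?P. w p \<in> graded_polys n (d - 1 - fst p)) \<and> g v = (\<Sum>p\<in>?P. poly_scale (w p) (snd p))"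
        if v: "v \<in> {1..n}" for v
      proof (cases "d - 1 < lo")
        case True
        then show ?thesis using low[OF g(1)[OF v]] by (intro exI[of _ "\<lambda>_. 0"]) simp
      next
        case False
        then show ?thesis using less.hyps[of "d - 1" "g v"] g(1)[OF v] by simp
      qed
      then have "\<forall>v\<in>{1..n}. \<exists>w. (\<forall>p\<in>?P. w p \<in> graded_polys n (d - 1 - fst p)) \<and> g v = (\<Sum>p\<in>?P. poly_scale (w p) (snd p))"
        by (intro ballI)
      from bchoice[OF this] obtain w where w': "\<forall>v\<in>{1..n}. (\<forall>p\<in>?P. w v p \<in> graded_polys n (d - 1 - fst p))
          \<and> g v = (\<Sum>p\<in>?P. poly_scale (w v p) (snd p))" ..
      have w: "w v p \<in> graded_polys n (d - 1 - fst p)" if "v \<in> {1..n}" "p \<in> ?P" for v p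
        using conjunct1[OF bspec[OF w' that(1)]] that(2) by (rule bspec)
      have gw: "g v = (\<Sum>p\<in>?P. poly_scale (w v p) (snd p))" if "v \<in> {1..n}" for v
        by (rule conjunct2[OF bspec[OF w' that]])
      let ?w = "\<lambda>p. \<Sum>v\<in>{1..n}. var v * w v p"
      have "?w p \<in> graded_polys n (d - fst p)" if p: "p \<in> ?P" for p
      proof (rule graded_polys_sum)
        fix v assume v: "v \<in> {1..n}"
        have "var v * w v p \<in> graded_polys n (d - 1 - fst p + 1)" by (rule graded_polys_var_mult[OF v w[OF v p]])
        then show "var v * w v p \<in> graded_polys n (d - fst p)" by (simp add: algebra_simps)
      qed
      moreover have "f = (\<Sum>p\<in>?P. poly_scale (?w p) (snd p))"
      proof -
        have "f = (\<Sum>v\<in>{1..n}. \<Sum>p\<in>?P. poly_scale (var v * w v p) (snd p))"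
          unfolding g(2) by (intro sum.cong refl) (simp add: gw var_op_poly_scale poly_scale_sum_right poly_scale_poly_scale)
        also have "\<dots> = (\<Sum>p\<in>?P. \<Sum>v\<in>{1..n}. poly_scale (var v * w v p) (snd p))" by (rule sum.swap)
        finally show ?thesis by (simp add: poly_scale_sum_left)
      qed
      ultimately show ?thesis by (intro exI[of _ ?w]) blast
    qed
  qed
  moreover have "finite ?P" using B(1) by (intro finite_SigmaI) auto
  moreover have "\<forall>p\<in>?P. snd p \<in> N (fst p)" using B(2) by auto
  ultimately have "generates n ?P N" unfolding generates_def by blast
  then show ?thesis ..
qed

text \<open>A generating set of least size is minimal in the sense of Nakayama: in a homogeneous relation, a
  coefficient with nonzero constant term is a nonzero constant, so its generator could be expressed
  through the others and removed.\<close>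

lemma minimal_generators:
  assumes "\<exists>P. generates n P N"
  obtains P where "generates n P N"
    "\<And>d w p. (\<And>q. q \<in> P \<Longrightarrow> w q \<in> graded_polys n (d - fst q)) \<Longrightarrow> (\<Sum>q\<in>P. poly_scale (w q) (snd q)) = 0 \<Longrightarrow> p \<in> P
       \<Longrightarrow> Poly_Mapping.lookup (w p) 0 = 0"
proof -
  obtain P where P: "generates n P N" and least: "\<And>Q. generates n Q N \<Longrightarrow> card P \<le> card Q"
    using assms ex_has_least_nat[of "\<lambda>P. generates n P N" _ card] by metis
  have finP: "finite P" using P by (simp add: generates_def)
  show thesis
  proof (rule that[OF P], rule ccontr)
    fix d w p
    assume w: "\<And>q. q \<in> P \<Longrightarrow> w q \<in> graded_polys n (d - fst q)" and rel: "(\<Sum>q\<in>P. poly_scale (w q) (snd q)) = 0"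
      and p: "p \<in> P" and ne: "Poly_Mapping.lookup (w p) 0 \<noteq> 0"
    have d: "d = fst p" using graded_polys_lookup0[OF w[OF p]] ne by linarith
    define c where "c = Poly_Mapping.lookup (w p) 0"
    have wp: "w p = Poly_Mapping.single 0 c" using graded_polys_0[of "w p" n] w[OF p] d by (simp add: c_def)
    (* The relation divided by c expresses the generator p with the coefficients a. *)
    define a where "a q = - (Poly_Mapping.single 0 (inverse c) * w q)" for q
    have a: "a q \<in> graded_polys n (fst p - fst q)" if "q \<in> P" for q
      using graded_polys_uminus[OF graded_polys_mult[OF graded_polys_const w[OF that]], of "inverse c"] d by (simp add: a_def)
    let ?Q = "P - {p}"
    have "poly_scale (w p) (snd p) + (\<Sum>q\<in>?Q. poly_scale (w q) (snd q)) = 0"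
      using rel sum.remove[OF finP p, of "\<lambda>q. poly_scale (w q) (snd q)"] by simp
    then have "poly_scale (Poly_Mapping.single 0 (inverse c)) (poly_scale (w p) (snd p) + (\<Sum>q\<in>?Q. poly_scale (w q) (snd q))) = 0"
      by simp
    then have "snd p + (\<Sum>q\<in>?Q. poly_scale (- a q) (snd q)) = 0"
      using ne by (simp add: poly_scale_add_right poly_scale_sum_right poly_scale_poly_scale wp mult_single a_def c_def[symmetric])
    then have sp: "snd p = (\<Sum>q\<in>?Q. poly_scale (a q) (snd q))"
      by (simp add: poly_scale_uminus_left sum_negf)
    have "\<exists>u. (\<forall>q\<in>?Q. u q \<in> graded_polys n (e - fst q)) \<and> f = (\<Sum>q\<in>?Q. poly_scale (u q) (snd q))" if f: "f \<in> N e" for e f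
    proof -
      obtain u where u: "\<And>q. q \<in> P \<Longrightarrow> u q \<in> graded_polys n (e - fst q)" "f = (\<Sum>q\<in>P. poly_scale (u q) (snd q))"
      proof -
        have "\<exists>u. (\<forall>q\<in>P. u q \<in> graded_polys n (e - fst q)) \<and> f = (\<Sum>q\<in>P. poly_scale (u q) (snd q))"
          using P f by (simp add: generates_def)
        then show ?thesis using that by blast
      qed
      let ?u = "\<lambda>q. u p * a q + u q"
      have "?u q \<in> graded_polys n (e - fst q)" if "q \<in> ?Q" for q
      proof -
        have "u p * a q \<in> graded_polys n (e - fst p + (fst p - fst q))" using that by (intro graded_polys_mult u(1) a p) simp
        then show ?thesis using that u(1)[of q] by (intro graded_polys_add) simp_all
      qed
      moreover have "f = poly_scale (u p) (snd p) + (\<Sum>q\<in>?Q. poly_scale (u q) (snd q))"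
        using u(2) sum.remove[OF finP p, of "\<lambda>q. poly_scale (u q) (snd q)"] by simp
      then have "f = (\<Sum>q\<in>?Q. poly_scale (?u q) (snd q))"
        by (subst (asm) sp) (simp add: poly_scale_sum_right poly_scale_poly_scale poly_scale_add_left sum.distrib)
      ultimately show ?thesis by (intro exI[of _ ?u]) blast
    qed
    then have "generates n ?Q N" using P unfolding generates_def by simp
    then have "card P \<le> card ?Q" by (rule least)
    then show False using card_Diff1_less[OF finP p] by simp
  qed
qed

lemma minimal_cover_exists:
  assumes N: "poly_submodule n N" "\<And>d. N d \<subseteq> graded_free n r s d" and c: "Koszul.reg_le n N c"
  shows "\<exists>r' s' D. minimal_cover n r s N r' s' D"
proof -
  obtain P where P: "generates n P N" and min:
    "\<And>d w p. (\<And>q. q \<in> P \<Longrightarrow> w q \<in> graded_polys n (d - fst q)) \<Longrightarrow> (\<Sum>q\<in>P. poly_scale (w q) (snd q)) = 0 \<Longrightarrow> p \<in> P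
       \<Longrightarrow> Poly_Mapping.lookup (w p) 0 = 0"
    by (rule minimal_generators[OF finitely_generated[OF N c]]) blast
  have finP: "finite P" and PN: "\<And>p. p \<in> P \<Longrightarrow> snd p \<in> N (fst p)" using P by (auto simp: generates_def)
  define r' where "r' = card P"
  obtain h where h: "bij_betw h {..<r'} P"
    using ex_bij_betw_nat_finite[OF finP] by (auto simp: r'_def lessThan_atLeast0)
  define s' where "s' k = fst (h k)" for k
  define D where "D l k = snd (h k) l" for l k
  have hP: "h k \<in> P" if "k < r'" for k using h that by (auto dest: bij_betwE)
  have hF: "snd (h k) \<in> graded_free n r s (s' k)" if "k < r'" for k
    using PN[OF hP[OF that]] N(2) by (auto simp: s'_def)
  have ap: "mat_map r r' D w = (\<Sum>k<r'. poly_scale (w k) (snd (h k)))" for w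
  proof
    fix l
    show "mat_map r r' D w l = (\<Sum>k<r'. poly_scale (w k) (snd (h k))) l"
      using graded_freeD0[OF hF, of _ l] by (simp add: mat_map_def D_def sum_fun_apply poly_scale_def mult.commute)
  qed
  have reind: "(\<Sum>k<r'. poly_scale (w (h k)) (snd (h k))) = (\<Sum>q\<in>P. poly_scale (w q) (snd q))" for w
    by (rule sum.reindex_bij_betw[OF h, of "\<lambda>q. poly_scale (w q) (snd q)"])
  let ?i = "inv_into {..<r'} h"
  have ih: "?i (h k) = k" if "k < r'" for k using h that by (simp add: bij_betw_inv_into_left)
  have hi: "h (?i q) = q" "?i q < r'" if "q \<in> P" for q
    using h that bij_betw_inv_into_right[OF h that] bij_betwE[OF bij_betw_inv_into[OF h]] by auto
  have "graded_matrix n r s r' s' D"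
    unfolding graded_matrix_def D_def using graded_freeD[OF hF] by blast
  moreover have "mat_map r r' D ` graded_free n r' s' d = N d" for d
  proof (intro equalityI subsetI)
    fix f assume "f \<in> mat_map r r' D ` graded_free n r' s' d"
    then obtain w where w: "w \<in> graded_free n r' s' d" and f: "f = (\<Sum>k<r'. poly_scale (w k) (snd (h k)))" using ap by auto
    show "f \<in> N d" unfolding f
    proof (rule poly_submodule_sum[OF N(1)])
      fix k assume "k \<in> {..<r'}"
      then have k: "k < r'" by simp
      show "poly_scale (w k) (snd (h k)) \<in> N d"
        using poly_submodule_poly_scale[OF N(1) PN[OF hP[OF k]] graded_freeD[OF w k]] by (simp add: s'_def)
    qed
  next
    fix f assume "f \<in> N d"
    then obtain w where w: "\<And>p. p \<in> P \<Longrightarrow> w p \<in> graded_polys n (d - fst p)" "f = (\<Sum>p\<in>P. poly_scale (w p) (snd p))"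
    proof -
      have "\<exists>w. (\<forall>p\<in>P. w p \<in> graded_polys n (d - fst p)) \<and> f = (\<Sum>p\<in>P. poly_scale (w p) (snd p))"
        using P \<open>f \<in> N d\<close> by (simp add: generates_def)
      then show ?thesis using that by blast
    qed
    let ?w = "\<lambda>k. if k < r' then w (h k) else 0"
    have "?w \<in> graded_free n r' s' d" using w(1) hP by (intro graded_freeI) (simp_all add: s'_def)
    moreover have "f = mat_map r r' D ?w" using w(2) reind[of w] by (simp add: ap)
    ultimately show "f \<in> mat_map r r' D ` graded_free n r' s' d" by blast
  qed
  moreover have "Poly_Mapping.lookup (w k) 0 = 0" if w: "w \<in> graded_kernel n r r' s' D d" and k: "k < r'" for d w k
  proof -
    have wF: "w \<in> graded_free n r' s' d" and w0: "mat_map r r' D w = 0" using w by (auto simp: graded_kernel_def)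
    have "(\<Sum>q\<in>P. poly_scale (w (?i q)) (snd q)) = (\<Sum>k<r'. poly_scale (w (?i (h k))) (snd (h k)))"
      using reind[of "\<lambda>q. w (?i q)"] by simp
    also have "\<dots> = 0" using w0 ih by (simp add: ap)
    finally have "(\<Sum>q\<in>P. poly_scale (w (?i q)) (snd q)) = 0" .
    moreover have "w (?i q) \<in> graded_polys n (d - fst q)" if "q \<in> P" for q
      using graded_freeD[OF wF hi(2)[OF that]] hi(1)[OF that] by (simp add: s'_def)
    ultimately have "Poly_Mapping.lookup (w (?i (h k))) 0 = 0"
      using min[of "\<lambda>q. w (?i q)" d "h k"] hP[OF k] by blast
    then show ?thesis using ih[OF k] by simp
  qed
  ultimately have "minimal_cover n r s N r' s' D" unfolding minimal_cover_def by blast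
  then show ?thesis by blast
qed

text \<open>Minimal covers $F_i\to N_i$ in which $N_{i+1}$ is the kernel of the previous cover. The free module
  $F_i$ has rank \<open>rk (Suc i)\<close> and shifts \<open>sh (Suc i)\<close>; index $0$ belongs to the free module that
  contains $N_0$.\<close>

definition minimal_tower where
  "minimal_tower n rk sh N D \<longleftrightarrow> (\<forall>i. minimal_cover n (rk i) (sh i) (N i) (rk (Suc i)) (sh (Suc i)) (D i) \<and>
      N (Suc i) = graded_kernel n (rk i) (rk (Suc i)) (sh (Suc i)) (D i))"

lemma minimal_towerD:
  assumes "minimal_tower n rk sh N D"
  shows "minimal_cover n (rk i) (sh i) (N i) (rk (Suc i)) (sh (Suc i)) (D i)"
    and "N (Suc i) = graded_kernel n (rk i) (rk (Suc i)) (sh (Suc i)) (D i)"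
  using assms unfolding minimal_tower_def by metis+

text \<open>The Koszul bound passes from each module to the kernel of its cover, so a cover exists at every
  step.\<close>

lemma minimal_tower_exists:
  assumes N: "poly_submodule n N0" "\<And>d. N0 d \<subseteq> graded_free n r0 s0 d" and c: "Koszul.reg_le n N0 c"
  shows "\<exists>rk sh N D. minimal_tower n rk sh N D \<and> rk 0 = r0 \<and> sh 0 = s0 \<and> N 0 = N0"
proof -
  define ok :: "nat \<Rightarrow> nat \<times> (nat \<Rightarrow> int) \<times> (int \<Rightarrow> (nat \<Rightarrow> 'a mpoly) set) \<Rightarrow> bool"
    where "ok i x \<longleftrightarrow> poly_submodule n (snd (snd x)) \<and> (\<forall>d. snd (snd x) d \<subseteq> graded_free n (fst x) (fst (snd x)) d)
       \<and> (\<exists>c. Koszul.reg_le n (snd (snd x)) c) \<and> (i = 0 \<longrightarrow> x = (r0, s0, N0))" for i x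
  define st where "st x y D \<longleftrightarrow> minimal_cover n (fst x) (fst (snd x)) (snd (snd x)) (fst y) (fst (snd y)) D
     \<and> snd (snd y) = graded_kernel n (fst x) (fst y) (fst (snd y)) D"
    for x y :: "nat \<times> (nat \<Rightarrow> int) \<times> (int \<Rightarrow> (nat \<Rightarrow> 'a mpoly) set)" and D
  have "\<exists>f. \<forall>i. ok i (f i) \<and> (\<exists>D. st (f i) (f (Suc i)) D)"
  proof (rule dependent_nat_choice)
    show "\<exists>x. ok 0 x" using N c by (intro exI[of _ "(r0, s0, N0)"]) (auto simp: ok_def)
    fix x and i :: nat assume ok: "ok i x"
    then obtain c where c: "Koszul.reg_le n (snd (snd x)) c" unfolding ok_def by blast
    obtain r' s' D where D: "minimal_cover n (fst x) (fst (snd x)) (snd (snd x)) r' s' D"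
      using minimal_cover_exists[OF _ _ c] ok unfolding ok_def by metis
    let ?y = "(r', s', graded_kernel n (fst x) r' s' D)"
    have "ok (Suc i) ?y"
      using graded_kernel_poly_submodule reg_le_graded_kernel[OF D c] unfolding ok_def by (auto simp: graded_kernel_def)
    moreover have "st x ?y D" using D by (simp add: st_def)
    ultimately show "\<exists>y. ok (Suc i) y \<and> (\<exists>D. st x y D)" by blast
  qed
  then obtain f D where f: "\<And>i. ok i (f i)" "\<And>i. st (f i) (f (Suc i)) (D i)" by metis
  have "minimal_tower n (\<lambda>i. fst (f i)) (\<lambda>i. fst (snd (f i))) (\<lambda>i. snd (snd (f i))) D"
    using f(2) by (simp add: minimal_tower_def st_def)
  moreover have "f 0 = (r0, s0, N0)" using f(1)[of 0] by (simp add: ok_def)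
  ultimately show ?thesis
    by (intro exI[of _ "\<lambda>i. fst (f i)"] exI[of _ "\<lambda>i. fst (snd (f i))"] exI[of _ "\<lambda>i. snd (snd (f i))"]
        exI[of _ D]) simp
qed

lemma minimal_tower_poly_submodule: "minimal_tower n rk sh N D \<Longrightarrow> poly_submodule n (N 0) \<Longrightarrow> poly_submodule n (N i)"
  by (cases i) (simp_all add: minimal_tower_def graded_kernel_poly_submodule)

lemma minimal_tower_reg_le:
  assumes "minimal_tower n rk sh N D" "Koszul.reg_le n (N 0) c"
  shows "Koszul.reg_le n (N i) (c + int i)"
proof (induction i)
  case (Suc i)
  have "minimal_cover n (rk i) (sh i) (N i) (rk (Suc i)) (sh (Suc i)) (D i)"
    and "N (Suc i) = graded_kernel n (rk i) (rk (Suc i)) (sh (Suc i)) (D i)" by (rule minimal_towerD[OF assms(1)])+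
  then show ?case using reg_le_graded_kernel[OF _ Suc] by (simp add: algebra_simps)
qed (use assms in simp)

lemma minimal_tower_shift_le:
  assumes "minimal_tower n rk sh N D" "Koszul.reg_le n (N 0) c" "poly_submodule n (N 0)" "k < rk (Suc i)"
  shows "sh (Suc i) k \<le> c + int i"
  by (rule minimal_cover_shift_le[OF minimal_towerD(1)[OF assms(1)] minimal_tower_reg_le[OF assms(1,2)]
        poly_submodule_graded[OF minimal_tower_poly_submodule[OF assms(1,3)]] assms(4)])

text \<open>A column of a matrix in the tower is nonzero by minimality. From the second matrix on, its nonzero
  entries have no constant term and hence positive degree, so the shift grows by at least one.\<close>

lemma minimal_tower_shift_ge:
  assumes m: "minimal_tower n rk sh N D" and 0: "\<And>k. k < rk 0 \<Longrightarrow> sh 0 k \<ge> 0"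
  shows "k < rk (Suc i) \<Longrightarrow> sh (Suc i) k \<ge> int i"
proof (induction i arbitrary: k)
  case 0
  have mc: "minimal_cover n (rk 0) (sh 0) (N 0) (rk (Suc 0)) (sh (Suc 0)) (D 0)" by (rule minimal_towerD(1)[OF m])
  obtain l where l: "l < rk 0" "D 0 l k \<noteq> 0" using minimal_cover_nonzero_column[OF mc 0] by metis
  have "D 0 l k \<in> graded_polys n (sh (Suc 0) k - sh 0 l)" using mc l 0 by (simp add: minimal_cover_def graded_matrix_def)
  then have "sh (Suc 0) k - sh 0 l \<ge> 0" using graded_polys_neg l(2) by (metis linorder_not_le)
  then show ?case using assms(2)[OF l(1)] by simp
next
  case (Suc i)
  have mc: "minimal_cover n (rk i) (sh i) (N i) (rk (Suc i)) (sh (Suc i)) (D i)"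
    and mc': "minimal_cover n (rk (Suc i)) (sh (Suc i)) (N (Suc i)) (rk (Suc (Suc i))) (sh (Suc (Suc i))) (D (Suc i))"
    and N: "N (Suc i) = graded_kernel n (rk i) (rk (Suc i)) (sh (Suc i)) (D i)" by (rule minimal_towerD[OF m])+
  obtain l where l: "l < rk (Suc i)" "D (Suc i) l k \<noteq> 0" using minimal_cover_nonzero_column[OF mc' Suc.prems] by metis
  have e: "D (Suc i) l k \<in> graded_polys n (sh (Suc (Suc i)) k - sh (Suc i) l)"
    using mc' l Suc.prems by (simp add: minimal_cover_def graded_matrix_def)
  have "mat_map (rk (Suc i)) (rk (Suc (Suc i))) (D (Suc i)) (basis_fun k) \<in> N (Suc i) (sh (Suc (Suc i)) k)"
    using mc' basis_fun_graded_free[OF Suc.prems] unfolding minimal_cover_def by blast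
  then have "Poly_Mapping.lookup (D (Suc i) l k) 0 = 0"
    using mc l(1) mat_map_basis_fun[OF l(1) Suc.prems, of "D (Suc i)"] unfolding N minimal_cover_def by metis
  then have "sh (Suc (Suc i)) k - sh (Suc i) l \<noteq> 0"
    using graded_polys_0[of "D (Suc i) l k" n] e l(2) by (metis single_zero)
  moreover have "sh (Suc (Suc i)) k - sh (Suc i) l \<ge> 0" using graded_polys_neg[OF e] l(2) by linarith
  ultimately show ?case using Suc.IH[OF l(1)] by simp
qed

section \<open>Ideals of spread monomials\<close>

lemma poly_ring_simps:
  "x \<otimes>\<^bsub>poly_ring n\<^esub> y = x * y" "x \<oplus>\<^bsub>poly_ring n\<^esub> y = x + y"
  "\<one>\<^bsub>poly_ring n\<^esub> = 1" "\<zero>\<^bsub>poly_ring n\<^esub> = 0"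
  by (simp_all add: poly_ring_def)

lemma poly_ring_ring: "ring (poly_ring n :: ('k::field) mpoly ring)"
proof (rule ringI)
  show "abelian_group (poly_ring n :: 'k mpoly ring)"
  proof (rule abelian_groupI)
    fix x :: "'k mpoly" assume "x \<in> Polys n"
    then show "\<exists>y\<in>Polys n. y \<oplus>\<^bsub>poly_ring n\<^esub> x = \<zero>\<^bsub>poly_ring n\<^esub>"
      by (intro bexI[of _ "- x"]) (simp_all add: poly_ring_simps Polys_uminus)
  qed (simp_all add: poly_ring_simps Polys_add ac_simps)
  show "monoid (poly_ring n :: 'k mpoly ring)"
    by (rule monoidI) (simp_all add: poly_ring_simps Polys_mult ac_simps)
qed (simp_all add: poly_ring_simps distrib_left distrib_right)

definition mon_ideal :: "nat \<Rightarrow> nat set set \<Rightarrow> ('k::field) mpoly set" where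
  "mon_ideal n \<G> = {p \<in> Polys n. \<forall>m\<in>Poly_Mapping.keys p. \<exists>G\<in>\<G>. G \<subseteq> Poly_Mapping.keys m}"

lemma mon_idealD: "p \<in> mon_ideal n \<G> \<Longrightarrow> m \<in> Poly_Mapping.keys p \<Longrightarrow> \<exists>G\<in>\<G>. G \<subseteq> Poly_Mapping.keys m"
  unfolding mon_ideal_def by (elim CollectE conjE) (rule bspec)

lemma mon_ideal_zero: "0 \<in> mon_ideal n \<G>" by (simp add: mon_ideal_def)

lemma mon_ideal_add:
  assumes "p \<in> mon_ideal n \<G>" "q \<in> mon_ideal n \<G>" shows "p + q \<in> mon_ideal n \<G>"
proof -
  have "\<exists>G\<in>\<G>. G \<subseteq> Poly_Mapping.keys m" if "m \<in> Poly_Mapping.keys (p + q)" for m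
    using subsetD[OF keys_add that] mon_idealD[OF assms(1)] mon_idealD[OF assms(2)] by (elim UnE) simp_all
  then show ?thesis using assms by (simp add: mon_ideal_def Polys_add)
qed

lemma mon_ideal_mult:
  assumes "p \<in> mon_ideal n \<G>" "q \<in> Polys n" shows "q * p \<in> mon_ideal n \<G>"
proof -
  have "\<exists>G\<in>\<G>. G \<subseteq> Poly_Mapping.keys m" if m: "m \<in> Poly_Mapping.keys (q * p)" for m
  proof -
    obtain a b where ab: "m = a + b" "b \<in> Poly_Mapping.keys p" using m by (rule keys_mult_E)
    obtain G where "G \<in> \<G>" "G \<subseteq> Poly_Mapping.keys b" by (rule bexE[OF mon_idealD[OF assms(1) ab(2)]])
    then show ?thesis using ab(1) by (intro bexI[of _ G]) (simp_all add: keys_exponent_add le_supI2)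
  qed
  then show ?thesis using assms by (simp add: mon_ideal_def Polys_mult)
qed

lemma mon_ideal_ideal: "ideal (mon_ideal n \<G>) (poly_ring n :: ('k::field) mpoly ring)"
proof (rule idealI[OF poly_ring_ring])
  let ?J = "mon_ideal n \<G> :: 'k mpoly set"
  interpret ring "poly_ring n :: 'k mpoly ring" by (rule poly_ring_ring)
  have sub: "?J \<subseteq> Polys n" by (auto simp: mon_ideal_def)
  show "subgroup ?J (add_monoid (poly_ring n))"
  proof (rule subgroup.intro)
    fix x :: "'k mpoly" assume x: "x \<in> ?J"
    then have xc: "x \<in> Polys n" using sub by blast
    have "\<ominus>\<^bsub>poly_ring n\<^esub> x = - x"
      by (rule minus_equality) (simp_all add: poly_ring_simps xc Polys_uminus)
    moreover have "- x \<in> ?J" using x by (simp add: mon_ideal_def Polys_uminus keys_uminus)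
    ultimately show "inv\<^bsub>add_monoid (poly_ring n)\<^esub> x \<in> ?J" by (simp add: a_inv_def)
  qed (use sub in \<open>simp_all add: poly_ring_simps mon_ideal_add mon_ideal_zero\<close>)
  show "x \<otimes>\<^bsub>poly_ring n\<^esub> a \<in> ?J" "a \<otimes>\<^bsub>poly_ring n\<^esub> x \<in> ?J" if "a \<in> ?J" "x \<in> Polys n" for a x
    using mon_ideal_mult[OF that] by (simp_all add: poly_ring_simps mult.commute)
qed

text \<open>The exponent vector of $\prod_{i\in A}x_i$.\<close>

definition squarefree_exp :: "nat set \<Rightarrow> (nat \<Rightarrow>\<^sub>0 nat)" where
  "squarefree_exp A = (\<Sum>i\<in>A. var_exp i)"

lemma lookup_squarefree_exp: "finite A \<Longrightarrow> Poly_Mapping.lookup (squarefree_exp A) i = (if i \<in> A then 1 else 0)"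
  by (simp add: squarefree_exp_def lookup_sum var_exp_def lookup_single when_def)

lemma keys_squarefree_exp: "finite A \<Longrightarrow> Poly_Mapping.keys (squarefree_exp A) = A"
  by (auto simp: in_keys_iff lookup_squarefree_exp split: if_splits)

lemma squarefree_exp_split:
  assumes "finite A" "A \<subseteq> Poly_Mapping.keys m" shows "m = (m - squarefree_exp A) + squarefree_exp A"
proof (rule poly_mapping_eqI)
  fix i
  have "1 \<le> Poly_Mapping.lookup m i" if "i \<in> A"
  proof -
    have "i \<in> Poly_Mapping.keys m" using that assms(2) by (rule rev_subsetD)
    then show ?thesis by (simp add: in_keys_iff)
  qed
  then show "Poly_Mapping.lookup m i = Poly_Mapping.lookup (m - squarefree_exp A + squarefree_exp A) i"
    using assms(1) by (simp add: lookup_add lookup_minus lookup_squarefree_exp)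
qed

lemma prod_list_var: "distinct is \<Longrightarrow> prod_list (map var is) = Poly_Mapping.single (squarefree_exp (set is)) (1 :: 'k::field)"
  by (induction "is") (simp_all add: squarefree_exp_def var_var_exp mult_single)

lemma genideal_squarefree:
  fixes U :: "('k::field) mpoly set"
  assumes \<G>: "\<G> \<subseteq> Pow {1..n}" and U: "U = (\<lambda>A. Poly_Mapping.single (squarefree_exp A) 1) ` \<G>"
  shows "Idl\<^bsub>poly_ring n\<^esub> U = mon_ideal n \<G>"
proof
  interpret ring "poly_ring n :: 'k mpoly ring" by (rule poly_ring_ring)
  have fin: "finite A" if "A \<in> \<G>" for A using that \<G> finite_subset by blast
  have UJ: "U \<subseteq> mon_ideal n \<G>"
  proof
    fix u assume "u \<in> U"
    then obtain A where A: "A \<in> \<G>" "u = Poly_Mapping.single (squarefree_exp A) 1" using U by blast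
    then have "A \<subseteq> {1..n}" using \<G> by blast
    then show "u \<in> mon_ideal n \<G>" using A fin[OF A(1)]
      by (simp add: mon_ideal_def Polys_iff keys_squarefree_exp) (rule bexI[of _ A], simp_all)
  qed
  then show "Idl\<^bsub>poly_ring n\<^esub> U \<subseteq> mon_ideal n \<G>" by (rule genideal_minimal[OF mon_ideal_ideal])
  have "U \<subseteq> Polys n" using UJ by (auto simp: mon_ideal_def)
  then interpret I: ideal "Idl\<^bsub>poly_ring n\<^esub> U" "poly_ring n :: 'k mpoly ring" by (rule genideal_ideal)
  show "mon_ideal n \<G> \<subseteq> Idl\<^bsub>poly_ring n\<^esub> U"
  proof
    fix p :: "'k mpoly" assume p: "p \<in> mon_ideal n \<G>"
    have t: "Poly_Mapping.single m (Poly_Mapping.lookup p m) \<in> Idl\<^bsub>poly_ring n\<^esub> U"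
      if m: "m \<in> Poly_Mapping.keys p" for m
    proof -
      obtain A where A: "A \<in> \<G>" "A \<subseteq> Poly_Mapping.keys m" by (rule bexE[OF mon_idealD[OF p m]])
      let ?q = "Poly_Mapping.single (m - squarefree_exp A) (Poly_Mapping.lookup p m)"
      have mn: "Poly_Mapping.keys m \<subseteq> {1..n}" using p m by (simp add: mon_ideal_def Polys_iff)
      have "Poly_Mapping.keys (m - squarefree_exp A) \<subseteq> Poly_Mapping.keys m"
        by (auto simp: in_keys_iff lookup_minus)
      then have "Poly_Mapping.keys (m - squarefree_exp A) \<subseteq> {1..n}" using mn by (rule order_trans)
      then have q: "?q \<in> Polys n" by (simp add: Polys_iff)
      have "Poly_Mapping.single (squarefree_exp A) 1 \<in> Idl\<^bsub>poly_ring n\<^esub> U"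
        using genideal_self[OF \<open>U \<subseteq> Polys n\<close>] U A(1) by blast
      from I.I_l_closed[OF this q] show ?thesis
        using squarefree_exp_split[OF fin[OF A(1)] A(2)] by (simp add: poly_ring_simps mult_single)
    qed
    have "(\<Sum>m\<in>K. Poly_Mapping.single m (Poly_Mapping.lookup p m)) \<in> Idl\<^bsub>poly_ring n\<^esub> U"
      if "finite K" "K \<subseteq> Poly_Mapping.keys p" for K
      using that
    proof (induction K rule: finite_induct)
      case empty
      show ?case using I.zero_closed by (simp add: poly_ring_simps)
    next
      case (insert m K)
      have "Poly_Mapping.single m (Poly_Mapping.lookup p m) \<in> Idl\<^bsub>poly_ring n\<^esub> U"
        using insert.prems by (intro t) simp
      moreover have "(\<Sum>m\<in>K. Poly_Mapping.single m (Poly_Mapping.lookup p m)) \<in> Idl\<^bsub>poly_ring n\<^esub> U"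
        using insert.prems by (intro insert.IH) simp
      ultimately show ?case using I.a_closed insert.hyps by (simp add: poly_ring_simps)
    qed
    from this[OF finite_keys order_refl] show "p \<in> Idl\<^bsub>poly_ring n\<^esub> U"
      using poly_expand[of p] by simp
  qed
qed

text \<open>Two indices of a $t$-spread monomial differ by at least $t$, so the interval $\{1,\dots,t\}$
  contains at most one of them. As $t\ge1$, the indices are distinct and the monomial is squarefree.\<close>

lemma t_spread_monomial_support:
  assumes "t_spread_monomial n t u" "t \<ge> 1"
  obtains A where "A \<subseteq> {1..n}" "card (A \<inter> {1..t}) \<le> 1" "u = Poly_Mapping.single (squarefree_exp A) (1 :: 'k::field)"
proof -
  obtain "is" where i: "set is \<subseteq> {1..n}" "\<And>j. Suc j < length is \<Longrightarrow> int (is ! Suc j) - int (is ! j) \<ge> int t"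
      and u: "u = prod_list (map var is)"
    using assms(1) unfolding t_spread_monomial_def by blast
  have "transp (\<lambda>a b :: nat. a + t \<le> b)" by (rule transpI) simp
  then have s: "sorted_wrt (\<lambda>a b. a + t \<le> b) is"
    using i(2) by (subst sorted_wrt_iff_nth_Suc_transp) (auto, fastforce)
  have "sorted_wrt (<) is"
    by (rule sorted_wrt_mono_rel[OF _ s]) (use assms(2) in auto)
  then have d: "distinct is" by (simp add: strict_sorted_iff)
  have gap: "a + t \<le> b \<or> b + t \<le> a" if ab: "a \<in> set is" "b \<in> set is" "a \<noteq> b" for a b
  proof -
    obtain p q where pq: "p < length is" "q < length is" "a = is ! p" "b = is ! q"
      using ab by (auto simp: in_set_conv_nth)
    then have "p \<noteq> q" using ab(3) by auto
    then consider "p < q" | "q < p" by linarith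
    then show ?thesis
      by cases (use s pq in \<open>auto simp: sorted_wrt_iff_nth_less\<close>)
  qed
  have "a = b" if "a \<in> set is \<inter> {1..t}" "b \<in> set is \<inter> {1..t}" for a b
    using gap[of a b] that by fastforce
  then have "card (set is \<inter> {1..t}) \<le> Suc 0" by (subst card_le_Suc0_iff_eq) auto
  then show thesis using that[of "set is"] i(1) u prod_list_var[OF d] by simp
qed

lemma t_spread_ideal_squarefree:
  fixes I :: "('k::field) mpoly set"
  assumes "t_spread_ideal n t I" "t \<ge> 1"
  obtains \<G> where "\<G> \<subseteq> Pow {1..n}" "\<And>A. A \<in> \<G> \<Longrightarrow> card (A \<inter> {1..t}) \<le> 1" "I = mon_ideal n \<G>"
proof -
  obtain U :: "'k mpoly set" where U: "\<And>u. u \<in> U \<Longrightarrow> t_spread_monomial n t u" "I = Idl\<^bsub>poly_ring n\<^esub> U"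
    using assms(1) unfolding t_spread_ideal_def by blast
  define \<G> where "\<G> = {A. A \<subseteq> {1..n} \<and> card (A \<inter> {1..t}) \<le> 1 \<and> Poly_Mapping.single (squarefree_exp A) (1 :: 'k) \<in> U}"
  have "U = (\<lambda>A. Poly_Mapping.single (squarefree_exp A) 1) ` \<G>"
  proof (intro equalityI subsetI)
    fix u assume u: "u \<in> U"
    obtain A where "A \<subseteq> {1..n}" "card (A \<inter> {1..t}) \<le> 1" "u = Poly_Mapping.single (squarefree_exp A) 1"
      by (rule t_spread_monomial_support[OF U(1)[OF u] assms(2)])
    then show "u \<in> (\<lambda>A. Poly_Mapping.single (squarefree_exp A) 1) ` \<G>" using u by (auto simp: \<G>_def)
  qed (auto simp: \<G>_def)
  moreover have "\<G> \<subseteq> Pow {1..n}" by (auto simp: \<G>_def)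
  ultimately have "I = mon_ideal n \<G>" using genideal_squarefree U(2) by metis
  then show thesis using that[of \<G>] by (simp add: \<G>_def Pow_def Collect_mono_iff)
qed

section \<open>Minimal graded free resolutions\<close>


definition free_funs :: "nat \<Rightarrow> nat \<Rightarrow> (nat \<Rightarrow> ('k::field) mpoly) set" where
  "free_funs n r = {f. (\<forall>k<r. f k \<in> Polys n) \<and> (\<forall>k\<ge>r. f k = 0)}"

lemma free_funsI: "(\<And>k. k < r \<Longrightarrow> f k \<in> Polys n) \<Longrightarrow> (\<And>k. k \<ge> r \<Longrightarrow> f k = 0) \<Longrightarrow> f \<in> free_funs n r"
  by (simp add: free_funs_def)
lemma free_funsD: "f \<in> free_funs n r \<Longrightarrow> k < r \<Longrightarrow> f k \<in> Polys n" by (simp add: free_funs_def)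
lemma free_funsD0: "f \<in> free_funs n r \<Longrightarrow> k \<ge> r \<Longrightarrow> f k = 0" by (simp add: free_funs_def)

lemma graded_free_free_funs: "f \<in> graded_free n r s d \<Longrightarrow> f \<in> free_funs n r"
  by (rule free_funsI) (simp_all add: graded_polys_Polys[OF graded_freeD] graded_freeD0)

lemma free_funs_zero: "0 \<in> free_funs n r" by (rule free_funsI) simp_all
lemma free_funs_add: "f \<in> free_funs n r \<Longrightarrow> g \<in> free_funs n r \<Longrightarrow> f + g \<in> free_funs n r"
  by (rule free_funsI) (simp_all add: Polys_add free_funsD free_funsD0)

lemma free_funs_sum: "(\<And>a. a \<in> A \<Longrightarrow> f a \<in> free_funs n r) \<Longrightarrow> sum f A \<in> free_funs n r"
  by (induction A rule: infinite_finite_induct)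
    (simp_all only: free_funs_zero free_funs_add sum.infinite sum.empty sum.insert not_False_eq_True insert_iff simp_thms)

definition degree_comp :: "(nat \<Rightarrow> int) \<Rightarrow> nat \<Rightarrow> int \<Rightarrow> (nat \<Rightarrow> ('k::field) mpoly) \<Rightarrow> nat \<Rightarrow> 'k mpoly" where
  "degree_comp s r d f = (\<lambda>k. if k < r then hom_comp (d - s k) (f k) else 0)"

lemma degree_comp_graded_free: "f \<in> free_funs n r \<Longrightarrow> degree_comp s r d f \<in> graded_free n r s d"
  by (rule graded_freeI) (simp_all add: degree_comp_def hom_comp_graded_polys free_funsD)

lemma hom_comp_sum: "hom_comp d (sum f A) = (\<Sum>a\<in>A. hom_comp d (f a))"
  by (simp add: hom_comp_def restrict_mons_sum)

lemma degree_comp_mat_map: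
  assumes "graded_matrix n r s r' s' D"
  shows "degree_comp s r d (mat_map r r' D w) = mat_map r r' D (degree_comp s' r' d w)"
proof
  fix l
  have "hom_comp (d - s l) (D l k * w k) = D l k * hom_comp (d - s' k) (w k)" if "l < r" "k < r'" for k
    using hom_comp_mult[of "D l k" n "s' k - s l" "d - s l" "w k"] assms that by (simp add: graded_matrix_def)
  then show "degree_comp s r d (mat_map r r' D w) l = mat_map r r' D (degree_comp s' r' d w) l"
    by (simp add: degree_comp_def mat_map_def hom_comp_sum)
qed

lemma hom_comp_id: "p \<in> graded_polys n d \<Longrightarrow> hom_comp d p = p"
  by (rule poly_mapping_eqI) (auto simp: hom_comp_def lookup_restrict_mons graded_polys_iff in_keys_iff)

lemma degree_comp_id: "f \<in> graded_free n r s d \<Longrightarrow> degree_comp s r d f = f"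
  by (rule ext) (simp add: degree_comp_def hom_comp_id[OF graded_freeD] graded_freeD0)

lemma degree_comp_free_funs: "f \<in> free_funs n r \<Longrightarrow> degree_comp s r d f \<in> free_funs n r"
  by (rule graded_free_free_funs[OF degree_comp_graded_free])

text \<open>Only the finitely many degrees of the occurring monomials contribute.\<close>

lemma degree_comp_decompose:
  assumes f: "f \<in> free_funs n r"
  obtains E where "f = (\<Sum>d\<in>E. degree_comp s r d f)"
proof -
  let ?E = "\<Union>k\<in>{..<r}. (\<lambda>m. int (mon_degree m) + s k) ` Poly_Mapping.keys (f k)"
  have *: "f k = (\<Sum>d\<in>?E. degree_comp s r d f k)" for k
  proof (cases "k < r")
    case True
    have "(\<Sum>d\<in>?E. Poly_Mapping.lookup (hom_comp (d - s k) (f k)) m) = Poly_Mapping.lookup (f k) m" for m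
    proof -
      have "(\<Sum>d\<in>?E. Poly_Mapping.lookup (hom_comp (d - s k) (f k)) m)
        = (\<Sum>d\<in>?E. if d = int (mon_degree m) + s k then Poly_Mapping.lookup (f k) m else 0)"
        by (rule sum.cong[OF refl]) (auto simp: hom_comp_def lookup_restrict_mons)
      also have "\<dots> = (if int (mon_degree m) + s k \<in> ?E then Poly_Mapping.lookup (f k) m else 0)"
        by (rule sum.delta) simp
      also have "\<dots> = Poly_Mapping.lookup (f k) m"
      proof (cases "m \<in> Poly_Mapping.keys (f k)")
        case m: True
        have "int (mon_degree m) + s k \<in> ?E" using True m by blast
        then show ?thesis by (simp only: if_True)
      qed (simp add: in_keys_iff)
      finally show ?thesis .
    qed
    then show ?thesis using True by (intro poly_mapping_eqI) (simp add: degree_comp_def lookup_sum)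
  next
    case False
    then show ?thesis using free_funsD0[OF f, of k] by (simp add: degree_comp_def)
  qed
  have "f = (\<Sum>d\<in>?E. degree_comp s r d f)"
    by (rule ext, subst sum_fun_apply, rule *)
  then show thesis by (rule that)
qed

text \<open>Graded maps commute with taking homogeneous components, and every element is the sum of its
  components. So exactness can be tested degree by degree.\<close>

lemma image_graded_iff:
  assumes D: "graded_matrix n r s r' s' D" and U: "U \<subseteq> free_funs n r" "0 \<in> U" "\<And>f g. f \<in> U \<Longrightarrow> g \<in> U \<Longrightarrow> f + g \<in> U"
    and Uc: "\<And>f d. f \<in> U \<Longrightarrow> degree_comp s r d f \<in> U"
  shows "mat_map r r' D ` free_funs n r' = U \<longleftrightarrow> (\<forall>d. mat_map r r' D ` graded_free n r' s' d = U \<inter> graded_free n r s d)"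
proof
  assume *: "mat_map r r' D ` free_funs n r' = U"
  show "\<forall>d. mat_map r r' D ` graded_free n r' s' d = U \<inter> graded_free n r s d"
  proof (intro allI equalityI subsetI)
    fix d f assume "f \<in> mat_map r r' D ` graded_free n r' s' d"
    then obtain w where w: "w \<in> graded_free n r' s' d" "f = mat_map r r' D w" by blast
    then show "f \<in> U \<inter> graded_free n r s d" using mat_map_graded_free[OF D w(1)] graded_free_free_funs[OF w(1)] * by blast
  next
    fix d f assume f: "f \<in> U \<inter> graded_free n r s d"
    then obtain w where w: "w \<in> free_funs n r'" "f = mat_map r r' D w" using * by blast
    have "f = mat_map r r' D (degree_comp s' r' d w)"
      using degree_comp_id[of f n r s d] f degree_comp_mat_map[OF D, of d w] w(2) by simp
    then show "f \<in> mat_map r r' D ` graded_free n r' s' d" using degree_comp_graded_free[OF w(1)] by blast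
  qed
next
  assume *: "\<forall>d. mat_map r r' D ` graded_free n r' s' d = U \<inter> graded_free n r s d"
  have sum: "(\<And>a. a \<in> A \<Longrightarrow> f a \<in> U) \<Longrightarrow> sum f A \<in> U" for f :: "int \<Rightarrow> nat \<Rightarrow> 'a mpoly" and A
    by (induction A rule: infinite_finite_induct) (simp_all add: U(2,3))
  show "mat_map r r' D ` free_funs n r' = U"
  proof (intro equalityI subsetI)
    fix f assume "f \<in> mat_map r r' D ` free_funs n r'"
    then obtain w where w: "w \<in> free_funs n r'" "f = mat_map r r' D w" by blast
    obtain E where E: "w = (\<Sum>d\<in>E. degree_comp s' r' d w)" using degree_comp_decompose[OF w(1)] by metis
    have "f = (\<Sum>d\<in>E. mat_map r r' D (degree_comp s' r' d w))"
      using w(2) E mat_map_sum[of r r' D "\<lambda>d. degree_comp s' r' d w" E] by simp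
    moreover have "mat_map r r' D (degree_comp s' r' d w) \<in> U" for d using * degree_comp_graded_free[OF w(1)] by blast
    ultimately show "f \<in> U" using sum by metis
  next
    fix f assume f: "f \<in> U"
    then have fF: "f \<in> free_funs n r" using U(1) by blast
    obtain E where E: "f = (\<Sum>d\<in>E. degree_comp s r d f)" using degree_comp_decompose[OF fF] by metis
    have "\<exists>w. w \<in> graded_free n r' s' d \<and> degree_comp s r d f = mat_map r r' D w" for d
      using * Uc[OF f, of d] degree_comp_graded_free[OF fF, of s d] by blast
    then obtain w where w: "\<And>d. w d \<in> graded_free n r' s' d" "\<And>d. degree_comp s r d f = mat_map r r' D (w d)" by metis
    have "f = mat_map r r' D (\<Sum>d\<in>E. w d)" using E w(2) by (simp add: mat_map_sum)
    moreover have "(\<Sum>d\<in>E. w d) \<in> free_funs n r'"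
      by (rule free_funs_sum) (rule graded_free_free_funs[OF w(1)])
    ultimately show "f \<in> mat_map r r' D ` free_funs n r'" by blast
  qed
qed

definition kernel_funs :: "nat \<Rightarrow> nat \<Rightarrow> nat \<Rightarrow> (nat \<Rightarrow> nat \<Rightarrow> ('k::field) mpoly) \<Rightarrow> (nat \<Rightarrow> 'k mpoly) set" where
  "kernel_funs n r r' D = {f \<in> free_funs n r'. mat_map r r' D f = 0}"

lemma degree_comp_zero [simp]: "degree_comp s r d 0 = 0"
  by (simp add: degree_comp_def fun_eq_iff hom_comp_def)

lemma kernel_funs_image_iff:
  assumes "graded_matrix n r s r' s' D" "graded_matrix n r' s' r'' s'' D'"
  shows "mat_map r' r'' D' ` free_funs n r'' = kernel_funs n r r' D \<longleftrightarrow> (\<forall>d. mat_map r' r'' D' ` graded_free n r'' s'' d = graded_kernel n r r' s' D d)"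
proof -
  have "kernel_funs n r r' D \<inter> graded_free n r' s' d = graded_kernel n r r' s' D d" for d
    using graded_free_free_funs by (auto simp: kernel_funs_def graded_kernel_def)
  moreover have "degree_comp s' r' d f \<in> kernel_funs n r r' D" if "f \<in> kernel_funs n r r' D" for f d
    using that degree_comp_mat_map[OF assms(1), of d f] by (simp add: kernel_funs_def degree_comp_free_funs)
  ultimately show ?thesis
    using image_graded_iff[OF assms(2), of "kernel_funs n r r' D"]
    by (simp add: kernel_funs_def free_funs_zero free_funs_add mat_map_add)
qed

definition ideal_funs :: "nat \<Rightarrow> nat set set \<Rightarrow> (nat \<Rightarrow> ('k::field) mpoly) set" where
  "ideal_funs n \<G> = {f \<in> free_funs n 1. f 0 \<in> mon_ideal n \<G>}"

lemma ideal_funs_image_iff: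
  assumes "graded_matrix n 1 (\<lambda>_. 0) r' s' D"
  shows "mat_map 1 r' D ` free_funs n r' = ideal_funs n \<G> \<longleftrightarrow> (\<forall>d. mat_map 1 r' D ` graded_free n r' s' d = graded_mon_ideal n \<G> d)"
proof -
  have "ideal_funs n \<G> \<inter> graded_free n 1 (\<lambda>_. 0) d = (graded_mon_ideal n \<G> d :: (nat \<Rightarrow> 'a mpoly) set)" for d
    by (auto simp: ideal_funs_def graded_mon_ideal_def free_funs_def graded_free_def mon_ideal_def graded_polys_def)
  moreover have "degree_comp (\<lambda>_. 0) 1 d f \<in> ideal_funs n \<G>" if "f \<in> ideal_funs n \<G>" for f :: "nat \<Rightarrow> 'a mpoly" and d
  proof -
    have "degree_comp (\<lambda>_. 0) 1 d f \<in> free_funs n 1" using that by (simp add: ideal_funs_def degree_comp_free_funs)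
    moreover have "hom_comp d (f 0) \<in> mon_ideal n \<G>"
      using that by (simp add: ideal_funs_def mon_ideal_def hom_comp_def Polys_iff keys_restrict_mons)
    ultimately show ?thesis by (simp add: ideal_funs_def degree_comp_def)
  qed
  ultimately show ?thesis
    using image_graded_iff[OF assms, of "ideal_funs n \<G>"]
    by (simp add: ideal_funs_def free_funs_zero free_funs_add mon_ideal_zero mon_ideal_add)
qed

text \<open>A graded free resolution with the augmentation as its first matrix: all indices are one higher
  than in the record, and index $0$ is the free module of rank one that contains the ideal.\<close>

definition fun_resolution where
  "fun_resolution n \<G> rk sh D \<longleftrightarrow> rk 0 = 1 \<and> sh 0 = (\<lambda>_. 0) \<and>
     (\<forall>i. graded_matrix n (rk i) (sh i) (rk (Suc i)) (sh (Suc i)) (D i)) \<and>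
     mat_map (rk 0) (rk (Suc 0)) (D 0) ` free_funs n (rk (Suc 0)) = ideal_funs n \<G> \<and>
     (\<forall>i. kernel_funs n (rk i) (rk (Suc i)) (D i) = mat_map (rk (Suc i)) (rk (Suc (Suc i))) (D (Suc i)) ` free_funs n (rk (Suc (Suc i))))"

text \<open>The matrix at index $0$ is the augmentation, on which minimality imposes no condition.\<close>

definition fun_minimal where
  "fun_minimal rk D \<longleftrightarrow> (\<forall>i. \<forall>l<rk (Suc i). \<forall>k<rk (Suc (Suc i)). Poly_Mapping.lookup (D (Suc i) l k) 0 = 0)"

text \<open>The kernel at each step is the image of the next matrix, whose entries have no constant terms.\<close>

lemma resolution_minimal_tower:
  assumes f: "fun_resolution n \<G> rk sh D" and m: "fun_minimal rk D"
  shows "\<exists>N. minimal_tower n rk sh N D \<and> N 0 = graded_mon_ideal n \<G>"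
proof -
  define N where "N i = (case i of 0 \<Rightarrow> graded_mon_ideal n \<G> | Suc j \<Rightarrow> graded_kernel n (rk j) (rk (Suc j)) (sh (Suc j)) (D j))" for i
  have e: "graded_matrix n (rk i) (sh i) (rk (Suc i)) (sh (Suc i)) (D i)" for i using f by (simp add: fun_resolution_def)
  have im: "mat_map (rk i) (rk (Suc i)) (D i) ` graded_free n (rk (Suc i)) (sh (Suc i)) d = N i d" for i d
  proof (cases i)
    case 0
    have r: "rk 0 = 1" "sh 0 = (\<lambda>_. 0)"
      and U: "mat_map (rk 0) (rk (Suc 0)) (D 0) ` free_funs n (rk (Suc 0)) = ideal_funs n \<G>"
      using f unfolding fun_resolution_def by blast+
    have "\<forall>d. mat_map 1 (rk (Suc 0)) (D 0) ` graded_free n (rk (Suc 0)) (sh (Suc 0)) d = graded_mon_ideal n \<G> d"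
      using ideal_funs_image_iff[OF e[of 0, unfolded r], of \<G>] U unfolding r by (rule iffD1)
    then show ?thesis unfolding 0 r(1) N_def by simp
  next
    case (Suc j)
    then show ?thesis using f kernel_funs_image_iff[OF e[of j] e[of "Suc j"]]
      by (simp add: fun_resolution_def N_def)
  qed
  have mn: "Poly_Mapping.lookup (w l) 0 = 0"
    if w: "w \<in> graded_kernel n (rk i) (rk (Suc i)) (sh (Suc i)) (D i) d" and l: "l < rk (Suc i)" for i d w l
  proof -
    have "w \<in> kernel_funs n (rk i) (rk (Suc i)) (D i)" using w graded_free_free_funs by (auto simp: graded_kernel_def kernel_funs_def)
    then obtain u where u: "w = mat_map (rk (Suc i)) (rk (Suc (Suc i))) (D (Suc i)) u"
      using f by (auto simp: fun_resolution_def)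
    show ?thesis using m l by (simp add: u mat_map_def lookup_sum lookup_mult_0 fun_minimal_def)
  qed
  have "minimal_tower n rk sh N D" unfolding minimal_tower_def minimal_cover_def using e im mn by (simp add: N_def)
  then show ?thesis by (intro exI[of _ N]) (simp add: N_def)
qed

text \<open>A column of a matrix is the image of a basis element and lies in the kernel of the previous
  matrix, so its entries have no constant terms.\<close>

lemma minimal_tower_resolves:
  assumes m: "minimal_tower n rk sh N D" and N: "N 0 = graded_mon_ideal n \<G>" and 0: "rk 0 = 1" "sh 0 = (\<lambda>_. 0)"
  shows "fun_resolution n \<G> rk sh D" "fun_minimal rk D"
proof -
  have e: "graded_matrix n (rk i) (sh i) (rk (Suc i)) (sh (Suc i)) (D i)" for i
    using minimal_towerD(1)[OF m] by (simp add: minimal_cover_def)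
  have im: "mat_map (rk i) (rk (Suc i)) (D i) ` graded_free n (rk (Suc i)) (sh (Suc i)) d = N i d" for i d
    using minimal_towerD(1)[OF m] by (simp add: minimal_cover_def)
  have "mat_map (rk 0) (rk (Suc 0)) (D 0) ` free_funs n (rk (Suc 0)) = ideal_funs n \<G>"
    using ideal_funs_image_iff[of n "rk 1" "sh 1" "D 0" \<G>] e[of 0] im[of 0] 0 N by simp
  moreover have "kernel_funs n (rk i) (rk (Suc i)) (D i) = mat_map (rk (Suc i)) (rk (Suc (Suc i))) (D (Suc i)) ` free_funs n (rk (Suc (Suc i)))" for i
    using kernel_funs_image_iff[OF e[of i] e[of "Suc i"]] im[of "Suc i"] minimal_towerD(2)[OF m, of i] by simp
  ultimately show "fun_resolution n \<G> rk sh D" using e 0 unfolding fun_resolution_def by blast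
  show "fun_minimal rk D" unfolding fun_minimal_def
  proof (intro allI impI)
    fix i l k assume l: "l < rk (Suc i)" and k: "k < rk (Suc (Suc i))"
    have "mat_map (rk (Suc i)) (rk (Suc (Suc i))) (D (Suc i)) (basis_fun k)
        \<in> graded_kernel n (rk i) (rk (Suc i)) (sh (Suc i)) (D i) (sh (Suc (Suc i)) k)"
      unfolding minimal_towerD(2)[OF m, of i, symmetric] im[of "Suc i", symmetric] by (rule imageI[OF basis_fun_graded_free[OF k]])
    then have "Poly_Mapping.lookup (mat_map (rk (Suc i)) (rk (Suc (Suc i))) (D (Suc i)) (basis_fun k) l) 0 = 0"
      using minimal_towerD(1)[OF m, of i] l unfolding minimal_cover_def by blast
    then show "Poly_Mapping.lookup (D (Suc i) l k) 0 = 0" by (simp add: mat_map_basis_fun[OF l k])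
  qed
qed

definition vec_fun :: "nat \<Rightarrow> ('k::field) mpoly vec \<Rightarrow> nat \<Rightarrow> 'k mpoly" where
  "vec_fun r v = (\<lambda>k. if k < r then v $ k else 0)"

lemma vec_fun_inj: "inj_on (vec_fun r) (carrier_vec r)"
  by (rule inj_onI) (auto simp: vec_fun_def fun_eq_iff intro!: eq_vecI, metis)

lemma vec_fun_free_funs: "vec_fun r ` free_module n r = free_funs n r"
proof (intro equalityI subsetI)
  fix f assume "f \<in> vec_fun r ` free_module n r"
  then show "f \<in> free_funs n r" by (auto simp: vec_fun_def free_module_def intro!: free_funsI)
next
  fix f :: "nat \<Rightarrow> 'a mpoly" assume f: "f \<in> free_funs n r"
  have "f = vec_fun r (vec r f)" using free_funsD0[OF f] by (auto simp: vec_fun_def)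
  moreover have "vec r f \<in> free_module n r" using free_funsD[OF f] by (simp add: free_module_def)
  ultimately show "f \<in> vec_fun r ` free_module n r" by blast
qed

lemma vec_fun_mult:
  assumes "A \<in> carrier_mat r r'" "w \<in> carrier_vec r'"
  shows "vec_fun r (A *\<^sub>v w) = mat_map r r' (\<lambda>l k. A $$ (l, k)) (vec_fun r' w)"
  using assms by (auto simp: vec_fun_def mat_map_def fun_eq_iff scalar_prod_def lessThan_atLeast0 intro!: sum.cong)

lemma scalar_prod_mat_map:
  assumes "a \<in> carrier_vec r'" "w \<in> carrier_vec r'"
  shows "mat_map 1 r' (\<lambda>l k. a $ k) (vec_fun r' w) = (\<lambda>j. if j = 0 then a \<bullet> w else 0)"
  using assms by (auto simp: vec_fun_def mat_map_def fun_eq_iff scalar_prod_def lessThan_atLeast0 intro!: sum.cong)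

text \<open>The functions \<open>ext_rank\<close>, \<open>ext_shift\<close> and \<open>ext_diff\<close> prepend the ring itself, in degree $0$,
  and the augmentation to the data of a complex.\<close>

definition ext_rank where "ext_rank F i = (case i of 0 \<Rightarrow> 1 | Suc j \<Rightarrow> rank F j)"
definition ext_shift where "ext_shift F i = (case i of 0 \<Rightarrow> (\<lambda>_. 0) | Suc j \<Rightarrow> shift F j)"
definition ext_diff where "ext_diff F i = (case i of 0 \<Rightarrow> (\<lambda>l k. aug F $ k) | Suc j \<Rightarrow> (\<lambda>l k. diff F j $$ (l, k)))"

lemma ext_rank_simps [simp]: "ext_rank F 0 = 1" "ext_rank F (Suc i) = rank F i" by (simp_all add: ext_rank_def)
lemma ext_shift_simps [simp]: "ext_shift F 0 = (\<lambda>_. 0)" "ext_shift F (Suc i) = shift F i" by (simp_all add: ext_shift_def)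
lemma ext_diff_simps [simp]: "ext_diff F 0 = (\<lambda>l k. aug F $ k)" "ext_diff F (Suc i) = (\<lambda>l k. diff F i $$ (l, k))"
  by (simp_all add: ext_diff_def)

lemma free_module_carrier: "free_module n r \<subseteq> carrier_vec r"
  by (auto simp: free_module_def)

lemma graded_free_resolution_iff:
  fixes F :: "('k::field) mpoly graded_free_complex"
  shows "graded_free_resolution n (mon_ideal n \<G>) F \<longleftrightarrow>
    aug F \<in> carrier_vec (rank F 0) \<and> (\<forall>i. diff F i \<in> carrier_mat (rank F i) (rank F (Suc i))) \<and>
    fun_resolution n \<G> (ext_rank F) (ext_shift F) (ext_diff F)"
proof (cases "aug F \<in> carrier_vec (rank F 0) \<and> (\<forall>i. diff F i \<in> carrier_mat (rank F i) (rank F (Suc i)))")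
  case True
  then have a: "aug F \<in> carrier_vec (rank F 0)" and
    d: "\<And>i. diff F i \<in> carrier_mat (rank F i) (rank F (Suc i))" by auto
  have ad: "w \<in> free_module n (rank F 0) \<Longrightarrow>
      mat_map 1 (rank F 0) (ext_diff F 0) (vec_fun (rank F 0) w) = (\<lambda>j. if j = 0 then aug F \<bullet> w else 0)" for w
    unfolding ext_diff_simps by (rule scalar_prod_mat_map[OF a subsetD[OF free_module_carrier]])
  have dd: "w \<in> free_module n (rank F (Suc i)) \<Longrightarrow>
      mat_map (rank F i) (rank F (Suc i)) (ext_diff F (Suc i)) (vec_fun (rank F (Suc i)) w) = vec_fun (rank F i) (diff F i *\<^sub>v w)" for i w
    unfolding ext_diff_simps by (rule vec_fun_mult[OF d subsetD[OF free_module_carrier], symmetric])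
  have dc: "diff F i *\<^sub>v w \<in> carrier_vec (rank F i)" for i w using d[of i] by (auto simp: mult_mat_vec_def)
  have e: "(\<forall>i. graded_matrix n (ext_rank F i) (ext_shift F i) (ext_rank F (Suc i)) (ext_shift F (Suc i)) (ext_diff F i)) \<longleftrightarrow>
     (\<forall>k<rank F 0. aug F $ k \<in> Polys n) \<and> (\<forall>k<rank F 0. homogeneous_of_degree (shift F 0 k) (aug F $ k)) \<and>
     (\<forall>i. \<forall>l<rank F i. \<forall>k<rank F (Suc i).
      diff F i $$ (l, k) \<in> carrier (poly_ring n) \<and>
      homogeneous_of_degree (shift F (Suc i) k - shift F i l) (diff F i $$ (l, k)))"
    (is "(\<forall>i. ?E i) \<longleftrightarrow> ?R")
  proof -
    have "(\<forall>i. ?E i) \<longleftrightarrow> ?E 0 \<and> (\<forall>i. ?E (Suc i))" by (metis not0_implies_Suc)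
    also have "\<dots> \<longleftrightarrow> ?R" by (auto simp: graded_matrix_def graded_polys_def)
    finally show ?thesis .
  qed
  have im0: "mat_map 1 (rank F 0) (ext_diff F 0) ` free_funs n (rank F 0) = ideal_funs n \<G> \<longleftrightarrow>
      (\<lambda>v. aug F \<bullet> v) ` free_module n (rank F 0) = mon_ideal n \<G>"
  proof -
    let ?c = "\<lambda>p j. if j = (0::nat) then p else (0 :: 'k mpoly)"
    have "mat_map 1 (rank F 0) (ext_diff F 0) ` free_funs n (rank F 0) = ?c ` (\<lambda>v. aug F \<bullet> v) ` free_module n (rank F 0)"
      unfolding vec_fun_free_funs[symmetric] image_image by (rule image_cong[OF refl ad])
    moreover have "ideal_funs n \<G> = ?c ` mon_ideal n \<G>"
    proof (intro equalityI subsetI)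
      fix f :: "nat \<Rightarrow> 'k mpoly" assume f: "f \<in> ideal_funs n \<G>"
      then have "f = ?c (f 0)" by (auto simp: ideal_funs_def free_funs_def fun_eq_iff)
      then show "f \<in> ?c ` mon_ideal n \<G>" using f by (auto simp: ideal_funs_def)
    qed (auto simp: ideal_funs_def free_funs_def mon_ideal_def)
    moreover have "inj ?c" by (rule injI) (auto simp: fun_eq_iff split: if_splits)
    ultimately show ?thesis by (simp add: inj_image_eq_iff)
  qed
  have k0: "kernel_funs n 1 (rank F 0) (ext_diff F 0) = vec_fun (rank F 0) ` {v \<in> free_module n (rank F 0). aug F \<bullet> v = 0}"
  proof -
    have "(\<lambda>j. if j = (0::nat) then p else 0) = (0 :: nat \<Rightarrow> 'k mpoly) \<longleftrightarrow> p = 0" for p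
      by (auto simp: fun_eq_iff)
    then show ?thesis unfolding kernel_funs_def vec_fun_free_funs[symmetric] using ad by auto
  qed
  have tz: "vec_fun r v = 0 \<longleftrightarrow> v = 0\<^sub>v r" if "v \<in> carrier_vec r" for r and v :: "'k mpoly vec"
    using that by (auto simp: vec_fun_def fun_eq_iff intro!: eq_vecI split: if_splits)
  have k1: "kernel_funs n (rank F i) (rank F (Suc i)) (ext_diff F (Suc i)) =
     vec_fun (rank F (Suc i)) ` {v \<in> free_module n (rank F (Suc i)). diff F i *\<^sub>v v = 0\<^sub>v (rank F i)}" for i
    unfolding kernel_funs_def vec_fun_free_funs[symmetric] using dd tz[OF dc] tz[OF zero_carrier_vec] by auto
  have im: "mat_map (rank F i) (rank F (Suc i)) (ext_diff F (Suc i)) ` free_funs n (rank F (Suc i)) =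
     vec_fun (rank F i) ` (\<lambda>w. diff F i *\<^sub>v w) ` free_module n (rank F (Suc i))" for i
    unfolding vec_fun_free_funs[symmetric] image_image by (rule image_cong[OF refl dd])
  have inj: "vec_fun r ` A = vec_fun r ` B \<longleftrightarrow> A = B" if "A \<subseteq> carrier_vec r" "B \<subseteq> carrier_vec r" for r and A B :: "'k mpoly vec set"
    using inj_on_image_eq_iff[OF vec_fun_inj that] .
  have x0: "kernel_funs n 1 (rank F 0) (ext_diff F 0) = mat_map (rank F 0) (rank F (Suc 0)) (ext_diff F (Suc 0)) ` free_funs n (rank F (Suc 0))
     \<longleftrightarrow> {v \<in> free_module n (rank F 0). aug F \<bullet> v = 0} = (\<lambda>w. diff F 0 *\<^sub>v w) ` free_module n (rank F 1)"
    unfolding k0 im unfolding One_nat_def by (rule inj) (use free_module_carrier dc in auto)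
  have x1: "kernel_funs n (rank F i) (rank F (Suc i)) (ext_diff F (Suc i))
      = mat_map (rank F (Suc i)) (rank F (Suc (Suc i))) (ext_diff F (Suc (Suc i))) ` free_funs n (rank F (Suc (Suc i)))
     \<longleftrightarrow> {v \<in> free_module n (rank F (Suc i)). diff F i *\<^sub>v v = 0\<^sub>v (rank F i)} =
      (\<lambda>w. diff F (Suc i) *\<^sub>v w) ` free_module n (rank F (Suc (Suc i)))" for i
    unfolding k1 im by (rule inj) (use free_module_carrier dc in auto)
  have x: "(\<forall>i. kernel_funs n (ext_rank F i) (ext_rank F (Suc i)) (ext_diff F i) = mat_map (ext_rank F (Suc i)) (ext_rank F (Suc (Suc i))) (ext_diff F (Suc i)) ` free_funs n (ext_rank F (Suc (Suc i))))
     \<longleftrightarrow> {v \<in> free_module n (rank F 0). aug F \<bullet> v = 0} = (\<lambda>w. diff F 0 *\<^sub>v w) ` free_module n (rank F 1)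
      \<and> (\<forall>i. {v \<in> free_module n (rank F (Suc i)). diff F i *\<^sub>v v = 0\<^sub>v (rank F i)} =
      (\<lambda>w. diff F (Suc i) *\<^sub>v w) ` free_module n (rank F (Suc (Suc i))))" (is "(\<forall>i. ?X i) \<longleftrightarrow> ?R")
  proof -
    have "(\<forall>i. ?X i) \<longleftrightarrow> ?X 0 \<and> (\<forall>i. ?X (Suc i))" by (metis not0_implies_Suc)
    also have "\<dots> \<longleftrightarrow> ?R" unfolding ext_rank_simps x0 x1 ..
    finally show ?thesis .
  qed
  have am: "aug F \<in> free_module n (rank F 0) \<longleftrightarrow> (\<forall>k<rank F 0. aug F $ k \<in> Polys n)"
    using a by (simp add: free_module_def)
  show ?thesis
    unfolding graded_free_resolution_def fun_resolution_def e x am ext_rank_simps(1) ext_shift_simps(1)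
    unfolding ext_rank_simps(2) im0 simp_thms eqTrueI[OF a] eqTrueI[OF allI[of "\<lambda>i. diff F i \<in> _ i", OF d]]
    by argo
next
  case False
  have "aug F \<in> carrier_vec (rank F 0) \<and> (\<forall>i. diff F i \<in> carrier_mat (rank F i) (rank F (Suc i)))"
    if g: "graded_free_resolution n (mon_ideal n \<G>) F"
    using g subsetD[OF free_module_carrier, of "aug F"] unfolding graded_free_resolution_def
    by (elim conjE) (intro conjI, assumption+)
  then show ?thesis using False by argo
qed

lemma minimal_iff:
  "(\<forall>i. \<forall>l<rank F i. \<forall>k<rank F (Suc i). Poly_Mapping.lookup (diff F i $$ (l, k)) 0 = 0)
     \<longleftrightarrow> fun_minimal (ext_rank F) (ext_diff F)"
  by (simp add: fun_minimal_def)

lemma fun_resolution_cong: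
  assumes "fun_resolution n \<G> rk sh D" "\<And>i l k. l < rk i \<Longrightarrow> k < rk (Suc i) \<Longrightarrow> D' i l k = D i l k"
  shows "fun_resolution n \<G> rk sh D'"
proof -
  have "mat_map (rk i) (rk (Suc i)) (D' i) = mat_map (rk i) (rk (Suc i)) (D i)" for i
    using assms(2) by (intro ext) (simp add: mat_map_def)
  note a = this
  have "graded_matrix n (rk i) (sh i) (rk (Suc i)) (sh (Suc i)) (D' i) \<longleftrightarrow>
      graded_matrix n (rk i) (sh i) (rk (Suc i)) (sh (Suc i)) (D i)" for i
    using assms(2) by (simp add: graded_matrix_def)
  note e = this
  show ?thesis using assms(1) unfolding fun_resolution_def kernel_funs_def a e .
qed

lemma graded_mon_ideal_poly_submodule: "poly_submodule n (graded_mon_ideal n \<G> :: int \<Rightarrow> (nat \<Rightarrow> ('k::field) mpoly) set)"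
proof -
  have "poly_scale p f \<in> graded_mon_ideal n \<G> (d + e)" if "f \<in> graded_mon_ideal n \<G> d" "p \<in> graded_polys n e" for f d and p :: "'k mpoly" and e
  proof -
    have "p * f 0 \<in> graded_polys n (d + e)" using that graded_polys_mult[of p n e "f 0" d] by (simp add: graded_mon_ideal_def add.commute)
    moreover have "p * f 0 \<in> mon_ideal n \<G>"
      using that graded_polys_Polys[of "f 0" n d] by (intro mon_ideal_mult) (simp_all add: graded_mon_ideal_def mon_ideal_def graded_polys_Polys)
    ultimately show ?thesis using that(1) by (simp add: graded_mon_ideal_def poly_scale_def mon_ideal_def)
  qed
  then show ?thesis
    unfolding poly_submodule_def using Koszul.graded_submodule_zero[OF graded_mon_ideal_graded_submodule] Koszul.graded_submodule_add[OF graded_mon_ideal_graded_submodule] by (intro allI conjI ballI)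
qed

text \<open>The maps of a minimal tower depend only on the matrix entries inside the given format, so matrices
  cut down to that format represent the same maps.\<close>

lemma minimal_resolution_exists:
  assumes "Koszul.reg_le n (graded_mon_ideal n \<G> :: int \<Rightarrow> (nat \<Rightarrow> ('k::field) mpoly) set) c"
  shows "\<exists>F :: 'k mpoly graded_free_complex. minimal_graded_free_resolution n (mon_ideal n \<G>) F"
proof -
  have "graded_mon_ideal n \<G> d = ideal_funs n \<G> \<inter> graded_free n 1 (\<lambda>_. 0) d" for d
    by (auto simp: ideal_funs_def graded_mon_ideal_def free_funs_def graded_free_def mon_ideal_def graded_polys_def)
  then have sub: "graded_mon_ideal n \<G> d \<subseteq> (graded_free n 1 (\<lambda>_. 0) d :: (nat \<Rightarrow> 'k mpoly) set)" for d by blast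
  obtain rk sh N D where m: "minimal_tower n rk sh N D" "rk 0 = 1" "sh 0 = (\<lambda>_. 0)"
      "N 0 = (graded_mon_ideal n \<G> :: int \<Rightarrow> (nat \<Rightarrow> 'k mpoly) set)"
    using minimal_tower_exists[OF graded_mon_ideal_poly_submodule sub assms] by blast
  define F :: "'k mpoly graded_free_complex" where
    "F = \<lparr>rank = \<lambda>i. rk (Suc i), shift = \<lambda>i. sh (Suc i), aug = vec (rk (Suc 0)) (\<lambda>k. D 0 0 k),
      diff = \<lambda>i. mat (rk (Suc i)) (rk (Suc (Suc i))) (\<lambda>(l, k). D (Suc i) l k)\<rparr>"
  have rk: "ext_rank F = rk" by (rule ext) (simp add: ext_rank_def F_def m(2) split: nat.split)
  have sh: "ext_shift F = sh" by (rule ext) (simp add: ext_shift_def F_def m(3) split: nat.split)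
  have D: "ext_diff F i l k = D i l k" if "l < rk i" "k < rk (Suc i)" for i l k
    using that m(2) by (cases i) (simp_all add: F_def)
  have "fun_resolution n \<G> rk sh (ext_diff F)" by (rule fun_resolution_cong[OF minimal_tower_resolves(1)[OF m(1,4,2,3)] D])
  moreover have "fun_minimal rk (ext_diff F)"
    using minimal_tower_resolves(2)[OF m(1,4,2,3)] D[of _ "Suc _"] unfolding fun_minimal_def by simp
  ultimately have "minimal_graded_free_resolution n (mon_ideal n \<G>) F"
    unfolding minimal_graded_free_resolution_def graded_free_resolution_iff minimal_iff rk sh
    by (simp add: F_def)
  then show ?thesis ..
qed

lemma minimal_resolution_bounds:
  fixes F :: "('k::field) mpoly graded_free_complex"
  assumes c: "Koszul.reg_le n (graded_mon_ideal n \<G> :: int \<Rightarrow> (nat \<Rightarrow> 'k mpoly) set) c"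
    and F: "minimal_graded_free_resolution n (mon_ideal n \<G>) F" and k: "k < rank F i"
  shows "int i \<le> shift F i k" "shift F i k \<le> c + int i"
proof -
  obtain N where m: "minimal_tower n (ext_rank F) (ext_shift F) N (ext_diff F)" and N: "N 0 = graded_mon_ideal n \<G>"
    using F resolution_minimal_tower unfolding minimal_graded_free_resolution_def graded_free_resolution_iff minimal_iff by blast
  have "poly_submodule n (N 0)" unfolding N by (rule graded_mon_ideal_poly_submodule)
  then show "shift F i k \<le> c + int i" using minimal_tower_shift_le[OF m, of c k i] c N k by simp
  show "int i \<le> shift F i k" using minimal_tower_shift_ge[OF m, of k i] k by simp
qed

theorem theorem4p3:
  fixes I :: "('k::field) mpoly set"
    and t n :: nat
  assumes "t \<ge> 1" and "n \<ge> t"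
    and "t_spread_ideal n t I" and "I \<noteq> {0}"
  shows "regularity n I \<le> int n - (int t - 1)"
proof -
  obtain \<G> where \<G>: "\<G> \<subseteq> Pow {1..n}" "\<And>A. A \<in> \<G> \<Longrightarrow> card (A \<inter> {1..t}) \<le> 1" "I = mon_ideal n \<G>"
    by (rule t_spread_ideal_squarefree[OF assms(3,1)]) blast
  let ?c = "int n - int t + 1"
  have c: "Koszul.reg_le n (graded_mon_ideal n \<G> :: int \<Rightarrow> (nat \<Rightarrow> 'k mpoly) set) ?c"
    using reg_le_transversal[of "{1..t}" "{1..n}" n \<G>] \<G>(1,2) assms(1,2) by simp
  define F where "F = (SOME F. minimal_graded_free_resolution n I F)"
  have F: "minimal_graded_free_resolution n I F"
    unfolding F_def using minimal_resolution_exists[OF c] unfolding \<G>(3) by (rule someI_ex)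
  have betti: "graded_betti n I i j = card {k. k < rank F i \<and> shift F i k = j}" for i j
    by (simp add: graded_betti_def F_def[symmetric])
  let ?S = "{j - int i | i j. graded_betti n I i j \<noteq> 0}"
  have bounds: "0 \<le> x \<and> x \<le> ?c" if xS: "x \<in> ?S" for x
  proof -
    obtain i j where x: "x = j - int i" and "graded_betti n I i j \<noteq> 0" using xS by blast
    then have "{k. k < rank F i \<and> shift F i k = j} \<noteq> {}" unfolding betti by (metis card.empty)
    then obtain k where "k < rank F i" "shift F i k = j" by blast
    then show ?thesis using minimal_resolution_bounds[OF c F[unfolded \<G>(3)], of k i] x by simp
  qed
  have "?S \<subseteq> {0..?c}"
  proof
    fix x assume "x \<in> ?S"
    from bounds[OF this] show "x \<in> {0..?c}" by simp
  qed
  then have fin: "finite ?S" by (rule finite_subset) simp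
  (* The maximum of the empty set is unspecified, so some Betti number must be nonzero. *)
  have "rank F 0 \<noteq> 0"
  proof
    assume 0: "rank F 0 = 0"
    have a: "aug F \<in> free_module n (rank F 0)" "(\<lambda>v. aug F \<bullet> v) ` free_module n (rank F 0) = I"
      using F by (simp_all add: minimal_graded_free_resolution_def graded_free_resolution_def)
    have "aug F \<bullet> v = 0" if "v \<in> free_module n (rank F 0)" for v
      using that 0 by (simp add: scalar_prod_def free_module_def)
    then have "I = {0}" using a by (auto simp: image_iff)
    then show False using assms(4) by simp
  qed
  then have "card {k. k < rank F 0 \<and> shift F 0 k = shift F 0 0} \<noteq> 0" by (auto simp: card_eq_0_iff)
  then have "shift F 0 0 - int 0 \<in> ?S" unfolding betti by blast
  then have "?S \<noteq> {}" by blast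
  from Max.boundedI[OF fin this] have "Max ?S \<le> ?c" using bounds by blast
  then show ?thesis by (simp add: regularity_def)
qed

end
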